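(* Let $d\geq 3$ be an integer and let $s=(d-3)+2\lambda$, with $0<\lambda<1$. Assume that the external field $Q:\mathbb{D}\to[0,\infty]$ is invariant with respect to rotations about the polar axis, that is $Q(x)=Q(r)$ for $x=(0,r\overline{x})\in\mathbb{D}$, $\overline{x}\in\mathbb{S}^{d-2}$, $0\leq r\leq 1$. Further suppose that $Q$ is a convex function, that is, $Q(r)$ is convex on $[0,1]$. Then the support of the $s$-extremal measure $\mu_Q$ on $\mathbb{D}$ is a ring contained in $\mathbb{D}$: there exist real numbers $a$ and $b$ with $0\leq a<b\leq 1$ such that $\operatorname{supp}\mu_Q=\mathscr{R}(a,b)$. Furthermore: (i) if $Q(r)$ is, in addition, an increasing function, then $a=0$, so that $\operatorname{supp}\mu_Q$ is a disk of radius $b\leq 1$ centered at the origin; (ii) if $Q(r)$ is (in addition to being convex) a decreasing function, then $b=1$, that is, $\operatorname{supp}\mu_Q$ is a ring with outer radius $1$.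
   Context: $|\cdot|$ is the Euclidean norm on $\mathbb{R}^d$, and $\mathbb{S}^{d-2}$ denotes the unit sphere of $\mathbb{R}^{d-1}$. The unit disk is $\mathbb{D}=\{(x_1,\ldots,x_d)\in\mathbb{R}^d: x_1=0,\ x_2^2+\cdots+x_d^2\leq 1\}$; its points are written $x=(0,r\overline{x})$ with $\overline{x}\in\mathbb{S}^{d-2}$, $0\leq r\leq 1$. The polar axis is the $x_1$-axis. The ring is $\mathscr{R}(a,b)=\{(0,r\overline{x})\in\mathbb{R}^d: a\leq r\leq b,\ \overline{x}\in\mathbb{S}^{d-2}\}$. $\mathcal{M}(\mathbb{D})$ is the class of unit positive Borel measures supported on $\mathbb{D}$, and $I_s(\mu)=\iint |x-y|^{-s}\,d\mu(x)\,d\mu(y)$ is the Riesz $s$-energy. An external field on $\mathbb{D}$ is a non-negative lower semicontinuous function $Q:\mathbb{D}\to[0,\infty]$ with $Q(x)<\infty$ on a set of positive surface area measure. The weighted energy is $I_Q(\mu)=I_s(\mu)+2\int Q\,d\mu$, and $V_Q=\inf\{I_Q(\mu):\mu\in\mathcal{M}(\mathbb{D})\}$. The $s$-extremal measure $\mu_Q\in\mathcal{M}(\mathbb{D})$ associated with $Q$ is the (unique) measure with $I_Q(\mu_Q)=V_Q$. *)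

theory Defs
  imports "HOL-Probability.Probability"
begin

text \<open>
  The space \<open>R^d\<close> is represented as \<open>real \<times> (real ^ 'n)\<close> with \<open>d = CARD('n) + 1\<close>; the first
  component is the coordinate \<open>x_1\<close> along the polar axis. The library norm on this product is
  the Euclidean one.
\<close>

definition unit_disk :: "(real \<times> (real ^ 'n)) set" where
  "unit_disk = {(x\<^sub>1, y). x\<^sub>1 = 0 \<and> norm y \<le> 1}"

definition disk_ring :: "real \<Rightarrow> real \<Rightarrow> (real \<times> (real ^ 'n)) set" where
  "disk_ring a b = {(0, r *\<^sub>R xbar) | r xbar. a \<le> r \<and> r \<le> b \<and> xbar \<in> sphere 0 1}"

definition measure_support :: "'a::topological_space measure \<Rightarrow> 'a set" where
  "measure_support \<mu> = {x. \<forall>U. open U \<and> x \<in> U \<longrightarrow> emeasure \<mu> U > 0}"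

definition disk_prob_measures :: "(real \<times> (real ^ 'n)) measure set" where
  "disk_prob_measures =
     {\<mu>. sets \<mu> = sets borel \<and> prob_space \<mu> \<and> measure_support \<mu> \<subseteq> unit_disk}"

text \<open>For \<open>s > 0\<close> the kernel \<open>|x - y|^(-s)\<close> is infinite on the diagonal, whereas the library has
  \<open>0 powr (-s) = 0\<close>.\<close>

definition riesz_kernel :: "real \<Rightarrow> 'a::metric_space \<Rightarrow> 'a \<Rightarrow> ennreal" where
  "riesz_kernel s x y = (if x = y then \<infinity> else ennreal (dist x y powr (- s)))"

definition riesz_energy :: "real \<Rightarrow> 'a::metric_space measure \<Rightarrow> ennreal" where
  "riesz_energy s \<mu> = (\<integral>\<^sup>+x. (\<integral>\<^sup>+y. riesz_kernel s x y \<partial>\<mu>) \<partial>\<mu>)"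

definition lower_semicontinuous_on :: "'a::topological_space set \<Rightarrow> ('a \<Rightarrow> ennreal) \<Rightarrow> bool" where
  "lower_semicontinuous_on A f \<longleftrightarrow>
     (\<forall>x\<in>A. \<forall>c<f x. eventually (\<lambda>y. c < f y) (at x within A))"

text \<open>Surface area measure on the hyperplane \<open>x_1 = 0\<close> is \<open>(d-1)\<close>-dimensional Lebesgue measure.\<close>

definition hyperplane_surface_measure :: "(real \<times> (real ^ 'n)) measure" where
  "hyperplane_surface_measure = distr lborel borel (\<lambda>y. (0, y))"

text \<open>Only the values of \<open>Q\<close> on the disk are relevant, here and in the energies below.\<close>

definition external_field :: "(real \<times> (real ^ 'n) \<Rightarrow> ennreal) \<Rightarrow> bool" where
  "external_field Q \<longleftrightarrow> lower_semicontinuous_on unit_disk Q \<and>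
     emeasure hyperplane_surface_measure {x \<in> unit_disk. Q x < \<infinity>} > 0"

definition weighted_energy ::
    "real \<Rightarrow> (real \<times> (real ^ 'n) \<Rightarrow> ennreal) \<Rightarrow> (real \<times> (real ^ 'n)) measure \<Rightarrow> ennreal" where
  "weighted_energy s Q \<mu> = riesz_energy s \<mu> + 2 * (\<integral>\<^sup>+x\<in>unit_disk. Q x \<partial>\<mu>)"

definition minimal_energy :: "real \<Rightarrow> (real \<times> (real ^ 'n) \<Rightarrow> ennreal) \<Rightarrow> ennreal" where
  "minimal_energy s Q = (INF \<mu>\<in>disk_prob_measures. weighted_energy s Q \<mu>)"

definition extremal_measure ::
    "real \<Rightarrow> (real \<times> (real ^ 'n) \<Rightarrow> ennreal) \<Rightarrow> (real \<times> (real ^ 'n)) measure \<Rightarrow> bool" where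
  "extremal_measure s Q \<mu> \<longleftrightarrow>
     \<mu> \<in> disk_prob_measures \<and> weighted_energy s Q \<mu> = minimal_energy s Q"

text \<open>Convexity for functions with values in \<open>[0, \<infinity>]\<close>, with the convention \<open>0 * \<infinity> = 0\<close>
  (the library's \<open>convex_on\<close> is only for real-valued functions).\<close>

definition ennreal_convex_on :: "'a::real_vector set \<Rightarrow> ('a \<Rightarrow> ennreal) \<Rightarrow> bool" where
  "ennreal_convex_on A f \<longleftrightarrow> convex A \<and>
     (\<forall>x\<in>A. \<forall>y\<in>A. \<forall>u\<ge>0. \<forall>v\<ge>0. u + v = 1 \<longrightarrow>
        f (u *\<^sub>R x + v *\<^sub>R y) \<le> ennreal u * f x + ennreal v * f y)"

end

theory Submission
  imports Defs
begin

text \<open>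
  Everything takes place in \<open>R^N\<close> with \<open>N = d - 1\<close> and \<open>N - 2 < s < N\<close>. The Gaussian representation
  of the Riesz kernel makes the energy strictly convex, so the minimizer \<open>\<nu>\<close> is unique, hence
  invariant under orthogonal maps, and its potential \<open>U\<close> is a function of \<open>r = |x|\<close>. The first
  variation gives \<open>U + q \<le> F\<close> on the support, while \<open>U + q < F\<close> cannot hold on a whole open shell.

  Off the support \<open>U'' + (N - 1) U' / r = s (s + 2 - N) W > 0\<close>, where \<open>W\<close> is the potential for the
  exponent \<open>s + 2\<close>. The part of \<open>U\<close> due to the mass inside a gap of the support is decreasing in \<open>r\<close>,
  hence convex; for the part due to the mass outside, \<open>W\<close> is increasing, which yields
  \<open>U' \<le> s (s + 2 - N) r W / N\<close> and again \<open>U'' > 0\<close>. So \<open>U + q\<close> is strictly convex in a gap and at most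
  \<open>F\<close> at its ends, a contradiction: the radii of the support form an interval \<open>[a, b]\<close>. Since \<open>U\<close>
  increases strictly on \<open>[0, a]\<close> and decreases strictly on \<open>[b, 1]\<close>, a monotone \<open>q\<close> forces \<open>a = 0\<close> or
  \<open>b = 1\<close>. Finally \<open>a < b\<close>: the potential of a measure on a single sphere has a cusp
  \<open>|r - a| powr (N - 1 - s)\<close> with exponent less than \<open>1\<close>, too steep for a convex \<open>q\<close> to compensate.
\<close>

section \<open>Strict convexity of the energy\<close>

text \<open>As \<open>s < N\<close>, the kernel is locally integrable and normalized Lebesgue
  measure on a shell has a bounded potential. It is therefore a legitimate competitor, and no notion
  of capacity or of exceptional sets enters. The price: the lower bound \<open>F\<close> for
  \<open>U + q\<close> is known only at some point of each shell, so every contradiction must be set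
  up on a whole interval of radii. As \<open>s + 2 > N\<close>, the factor
  \<open>s (s + 2 - N)\<close> is positive; this is where the lower end of the exponent range is
  decisive. Potentials and \<open>q\<close> may be infinite, so the variational part lives in
  \<open>ennreal\<close> and passes to reals only where finiteness is known. At the ends of a gap
  the potential is only shown to be continuous, hence derivatives are taken in the open gap and the
  convexity inequality is carried to its ends by continuity. The cusp at a sphere is estimated from
  outside, where no kernel value increases; moving inwards some distances shrink, so that side is
  reduced to the outer one by inversion.\<close>

lemma finite_borel_measure_eqI:
  fixes M N :: "'a::metric_space measure"
  assumes M: "finite_measure M" "sets M = sets borel" and N: "finite_measure N" "sets N = sets borel"
    and eq: "\<And>f. continuous_on UNIV (f :: 'a \<Rightarrow> real) \<Longrightarrow> (\<And>x. 0 \<le> f x \<and> f x \<le> (1::real)) \<Longrightarrow>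
      (\<integral>\<^sup>+x. ennreal (f x) \<partial>M) = (\<integral>\<^sup>+x. ennreal (f x) \<partial>N)"
  shows "M = N"
proof -
  note [measurable_cong] = M(2) N(2)
  have closed_eq: "emeasure M C = emeasure N C" if C: "closed C" for C
  \<comment> \<open>\<open>infdist x {}\<close> is 0 by convention, so for empty \<open>C\<close>
    the functions \<open>f n\<close> would be constantly 1 instead of approximating the
    indicator.\<close>
  proof (cases "C = {}")
    case False
    define f where "f n x = max 0 (1 - real n * infdist x C)" for n x
    have f01: "0 \<le> f n x \<and> f n x \<le> 1" for n x
      using infdist_nonneg[of x C] by (auto simp: f_def)
    have fc: "continuous_on UNIV (f n)" for n
      unfolding f_def by (intro continuous_intros)
    have [measurable]: "f n \<in> borel_measurable borel" for n
      using fc borel_measurable_continuous_onI by blast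
    have lim: "(\<lambda>n. ennreal (f n x)) \<longlonglongrightarrow> indicator C x" for x
    proof (cases "x \<in> C")
      case True
      then show ?thesis by (simp add: f_def)
    next
      case x: False
      then have pos: "infdist x C > 0"
        using C False by (metis in_closed_iff_infdist_zero infdist_nonneg less_eq_real_def)
      obtain n0 where n0: "real n0 * infdist x C > 1"
        using reals_Archimedean3[OF pos] by blast
      have "eventually (\<lambda>n. ennreal (f n x) = 0) sequentially"
        using eventually_ge_at_top[of n0]
      proof eventually_elim
        case (elim n)
        then have "real n0 * infdist x C \<le> real n * infdist x C"
          using pos by (intro mult_right_mono) auto
        then show ?case using n0 by (simp add: f_def)
      qed
      then show ?thesis using x by (simp add: tendsto_eventually)
    qed
    have conv: "(\<lambda>n. \<integral>\<^sup>+x. ennreal (f n x) \<partial>L) \<longlonglongrightarrow> emeasure L C"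
      if L: "finite_measure L" "sets L = sets borel" for L
    proof -
      note [measurable_cong] = L(2)
      have [measurable]: "C \<in> sets borel" using C by (rule borel_closed)
      have "(\<lambda>n. \<integral>\<^sup>+x. ennreal (f n x) \<partial>L) \<longlonglongrightarrow> (\<integral>\<^sup>+x. indicator C x \<partial>L)"
      proof (rule nn_integral_dominated_convergence[where w="\<lambda>_. 1"])
        show "(\<integral>\<^sup>+x. 1 \<partial>L) < \<infinity>"
          using finite_measure.emeasure_finite[OF L(1)] by (simp add: top.not_eq_extremum)
      qed (use f01 lim in \<open>auto simp: ennreal_le_1\<close>)
      then show ?thesis using L by simp
    qed
    show ?thesis
      using conv[OF M] conv[OF N] eq[OF fc f01] by (simp add: LIMSEQ_unique)
  qed simp
  have fin: "emeasure N UNIV \<noteq> \<infinity>"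
    using finite_measure.emeasure_finite[OF N(1)] by simp
  show ?thesis
  proof (rule measure_eqI_generator_eq[where E="Collect closed" and \<Omega>=UNIV and A="\<lambda>_. UNIV"])
    show "Int_stable (Collect closed :: 'a set set)"
      by (auto simp: Int_stable_def)
    show "sets M = sigma_sets UNIV (Collect closed)" "sets N = sigma_sets UNIV (Collect closed)"
      unfolding M N by (simp_all add: borel_eq_closed)
  qed (use closed_eq fin finite_measure.emeasure_finite[OF M(1)] in auto)
qed

section \<open>Gaussian integrals and the Gamma representation of the Riesz kernel\<close>

definition gauss_mass :: "'a::euclidean_space itself \<Rightarrow> real \<Rightarrow> ennreal" where
  "gauss_mass (T :: 'a itself) t = (\<integral>\<^sup>+(z::'a). ennreal (exp (- t * (norm z)\<^sup>2)) \<partial>lborel)"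

lemma nn_integral_gauss_real_finite:
  assumes "t > 0"
  shows "(\<integral>\<^sup>+(z::real). ennreal (exp (- t * z\<^sup>2)) \<partial>lborel) < \<infinity>"
proof -
  \<comment> \<open>The standard deviation for which \<open>t = 1 / (2 * \<sigma>^2)\<close>, so
    that the integrand is a multiple of a normal density.\<close>
  define \<sigma> where "\<sigma> = 1 / sqrt (2 * t)"
  have s: "\<sigma> > 0" "2 * \<sigma>\<^sup>2 * t = 1"
    using assms by (simp_all add: \<sigma>_def power_divide)
  have "exp (- t * z\<^sup>2) = sqrt (2 * pi * \<sigma>\<^sup>2) * normal_density 0 \<sigma> z" for z
  proof -
    have "- t * z\<^sup>2 = - z\<^sup>2 / (2 * \<sigma>\<^sup>2)"
      using s by (simp add: field_simps)
    then show ?thesis using s by (simp add: normal_density_def)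
  qed
  then have "integrable lborel (\<lambda>z::real. exp (- t * z\<^sup>2))"
    using s by simp
  then show ?thesis
    by (auto simp: integrable_iff_bounded)
qed

text \<open>Only these bounds are used, never a closed form: the mass is a normalizing constant. The
  Gaussian factors over the coordinates, which reduces finiteness to dimension one.\<close>

lemma gauss_mass_bounds:
  assumes "t > 0"
  shows "0 < gauss_mass TYPE('a::euclidean_space) t" "gauss_mass TYPE('a) t < \<infinity>"
proof -
  have "ennreal (exp (- t * (norm z)\<^sup>2)) = (\<Prod>b\<in>Basis. ennreal (exp (- t * (z \<bullet> b)\<^sup>2)))" for z :: 'a
    by (simp add: prod_ennreal exp_sum[symmetric] sum_distrib_left[symmetric] sum_negf
        power2_norm_eq_inner euclidean_inner[of z z] flip: power2_eq_square)
  then have "gauss_mass TYPE('a) t = (\<Prod>b\<in>(Basis::'a set). \<integral>\<^sup>+(z::real). ennreal (exp (- t * z\<^sup>2)) \<partial>lborel)"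
    unfolding gauss_mass_def by (simp only:) (subst nn_integral_lborel_prod, simp_all)
  also have "\<dots> < \<infinity>"
    using nn_integral_gauss_real_finite[OF assms] by (simp add: power_less_top_ennreal)
  finally show "gauss_mass TYPE('a) t < \<infinity>" .
  have "\<not> (AE z::'a in lborel. ennreal (exp (- t * (norm z)\<^sup>2)) = 0)"
  proof
    assume "AE z::'a in lborel. ennreal (exp (- t * (norm z)\<^sup>2)) = 0"
    then have "AE z::'a in lborel. False" by (rule AE_mp) (auto simp: ennreal_eq_0_iff not_le)
    then show False by (simp add: eventually_False ae_filter_eq_bot_iff)
  qed
  then show "0 < gauss_mass TYPE('a) t"
    unfolding gauss_mass_def by (subst (asm) nn_integral_0_iff_AE[symmetric]) (auto simp: zero_less_iff_neq_zero)
qed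

text \<open>The substitution \<open>t -> t / r\<close> in the Gamma integral.\<close>

lemma nn_integral_gamma_scale:
  assumes p: "p > (0::real)" and r: "r > 0"
  shows "(\<integral>\<^sup>+t. indicator {0<..} t * ennreal (t powr (p - 1) * exp (- t * r)) \<partial>lborel) = ennreal (Gamma p * r powr (- p))"
proof -
  have eq: "indicator {0<..} (0 + (1/r) * t) * ennreal ((0 + (1/r) * t) powr (p - 1) * exp (- (0 + (1/r) * t) * r))
      = ennreal (r powr (1 - p)) * ennreal (indicator {0..} t * t powr (p - 1) / exp t)" for t
  proof (cases "t > 0")
    case True
    then have "(0 + (1/r) * t) powr (p - 1) = t powr (p - 1) * r powr (1 - p)"
      using r by (simp add: powr_divide powr_diff)
    moreover have "exp (- (0 + (1/r) * t) * r) = 1 / exp t"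
      using r by (simp add: exp_minus field_simps)
    ultimately show ?thesis using True r
      by (simp add: ennreal_mult[symmetric] mult.commute)
  qed (use r in \<open>auto simp: indicator_def divide_less_0_iff zero_less_divide_iff\<close>)
  have "(\<integral>\<^sup>+t. indicator {0<..} t * ennreal (t powr (p - 1) * exp (- t * r)) \<partial>lborel) =
      \<bar>1/r\<bar> * (\<integral>\<^sup>+t. ennreal (r powr (1 - p)) * ennreal (indicator {0..} t * t powr (p - 1) / exp t) \<partial>lborel)"
    using r by (subst nn_integral_real_affine[where c="1/r" and t=0]) (simp_all only: eq, simp_all)
  also have "\<dots> = ennreal (1/r) * (ennreal (r powr (1 - p)) * ennreal (Gamma p))"
    using r by (simp add: nn_integral_cmult Gamma_conv_nn_integral_real[OF p])
  also have "\<dots> = ennreal (Gamma p * r powr (- p))"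
  proof -
    have "1 / r * r powr (1 - p) = r powr (- p)"
      using r by (simp add: powr_diff powr_minus divide_simps)
    then have "1 / r * (r powr (1 - p) * Gamma p) = Gamma p * r powr (- p)"
      by (metis mult.assoc mult.commute)
    then show ?thesis using r Gamma_real_pos[OF p]
      by (simp only: ennreal_mult[symmetric] powr_ge_zero less_imp_le mult_nonneg_nonneg zero_le_divide_1_iff)
  qed
  finally show ?thesis .
qed

text \<open>The limit case \<open>r = 0\<close> of the preceding formula. The integral dominates
  \<open>Gamma p * r powr (- p)\<close> for every \<open>r > 0\<close>, which is unbounded as
  \<open>r\<close> tends to 0.\<close>

lemma nn_integral_gamma_zero:
  assumes p: "p > (0::real)"
  shows "(\<integral>\<^sup>+t. indicator {0<..} t * ennreal (t powr (p - 1)) \<partial>lborel) = \<infinity>" (is "?I = _")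
proof -
  have ge: "ennreal (Gamma p * r powr (- p)) \<le> ?I" if "r > 0" for r
    unfolding nn_integral_gamma_scale[OF p that, symmetric]
    by (intro nn_integral_mono) (auto simp: indicator_def that less_imp_le intro!: ennreal_leI mult_left_le)
  have "ennreal (real n) \<le> ?I" for n
  proof -
    \<comment> \<open>Chosen so that \<open>Gamma p * r powr (- p)\<close> equals
      \<open>real n + Gamma p\<close>; the summand 1 keeps the base positive for
      \<open>n = 0\<close>.\<close>
    define r where "r = (real n / Gamma p + 1) powr (- 1 / p)"
    have g: "Gamma p > 0" using p by simp
    then have r: "r > 0" by (auto simp: r_def add_nonneg_eq_0_iff)
    have "r powr (- p) = real n / Gamma p + 1"
      using g p by (simp add: r_def powr_powr)
    then have "Gamma p * r powr (- p) = real n + Gamma p"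
      using g by (simp add: field_simps)
    then have "ennreal (real n) \<le> ennreal (Gamma p * r powr (- p))"
      using g by (intro ennreal_leI) simp
    then show ?thesis using ge[OF r] by simp
  qed
  then show ?thesis
    by (metis ennreal_of_nat_eq_real_of_nat ennreal_Ex_less_of_nat infinity_ennreal_def leD top.not_eq_extremum)
qed

text \<open>Divergence of the integral at distance 0 matches the value \<infinity> of
  \<open>riesz_kernel\<close> on the diagonal, so the identity has no exceptional points.\<close>

lemma riesz_kernel_gamma:
  fixes x y :: "'a::metric_space"
  assumes s: "s > 0"
  shows "riesz_kernel s x y =
    (\<integral>\<^sup>+t. indicator {0<..} t * ennreal (t powr (s/2 - 1) / Gamma (s/2)) * ennreal (exp (- t * (dist x y)\<^sup>2)) \<partial>lborel)"
proof -
  have p: "s/2 > 0" and g: "Gamma (s/2) > 0" using s by simp_all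
  have "(\<integral>\<^sup>+t. indicator {0<..} t * ennreal (t powr (s/2 - 1) / Gamma (s/2)) * ennreal (exp (- t * (dist x y)\<^sup>2)) \<partial>lborel)
     = (\<integral>\<^sup>+t. ennreal (1 / Gamma (s/2)) * (indicator {0<..} t * ennreal (t powr (s/2 - 1) * exp (- t * (dist x y)\<^sup>2))) \<partial>lborel)"
    using g by (intro nn_integral_cong) (auto simp: ennreal_mult[symmetric] indicator_def)
  also have "\<dots> = ennreal (1 / Gamma (s/2)) * (\<integral>\<^sup>+t. indicator {0<..} t * ennreal (t powr (s/2 - 1) * exp (- t * (dist x y)\<^sup>2)) \<partial>lborel)"
    by (subst nn_integral_cmult) auto
  also have "\<dots> = riesz_kernel s x y"
  proof (cases "x = y")
    case True
    then show ?thesis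
      using nn_integral_gamma_zero[OF p] g by (simp add: riesz_kernel_def ennreal_mult_top)
  next
    case False
    then have r: "(dist x y)\<^sup>2 > 0" by simp
    have "((dist x y)\<^sup>2) powr (- (s/2)) = dist x y powr (- s)"
      using False by (simp add: powr_powr flip: powr_numeral)
    then show ?thesis
      using False g by (subst nn_integral_gamma_scale[OF p r]) (simp add: riesz_kernel_def flip: ennreal_mult)
  qed
  finally show ?thesis by simp
qed

text \<open>By the parallelogram identity around the midpoint \<open>m\<close>, the product of
  Gaussians centred at \<open>x\<close> and \<open>y\<close> is a Gaussian centred at
  \<open>m\<close> times a factor in \<open>dist x y\<close> alone. The exponent
  \<open>2 * t\<close> on the left is what leaves exactly \<open>t\<close> on the right.\<close>

lemma gauss_convolution:
  fixes x y :: "'a::euclidean_space"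
  shows "(\<integral>\<^sup>+z. ennreal (exp (- 2 * t * (dist x z)\<^sup>2)) * ennreal (exp (- 2 * t * (dist y z)\<^sup>2)) \<partial>lborel)
    = gauss_mass TYPE('a) (4 * t) * ennreal (exp (- t * (dist x y)\<^sup>2))"
proof -
  define m where "m = (1/2) *\<^sub>R (x + y)"
  have id: "(dist x z)\<^sup>2 + (dist y z)\<^sup>2 = 2 * (norm (z - m))\<^sup>2 + (dist x y)\<^sup>2 / 2" for z
    unfolding m_def dist_norm power2_norm_eq_inner by (simp add: algebra_simps inner_commute field_simps)
  have "ennreal (exp (- 2 * t * (dist x z)\<^sup>2)) * ennreal (exp (- 2 * t * (dist y z)\<^sup>2))
     = ennreal (exp (- (4 * t) * (norm (z - m))\<^sup>2)) * ennreal (exp (- t * (dist x y)\<^sup>2))" for z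
  proof -
    have "- 2 * t * (dist x z)\<^sup>2 + - 2 * t * (dist y z)\<^sup>2 = - 2 * t * ((dist x z)\<^sup>2 + (dist y z)\<^sup>2)"
      by (simp add: algebra_simps)
    also have "\<dots> = - (4 * t) * (norm (z - m))\<^sup>2 + - t * (dist x y)\<^sup>2"
      unfolding id by (simp add: algebra_simps)
    finally show ?thesis by (simp flip: ennreal_mult exp_add)
  qed
  then have "(\<integral>\<^sup>+z. ennreal (exp (- 2 * t * (dist x z)\<^sup>2)) * ennreal (exp (- 2 * t * (dist y z)\<^sup>2)) \<partial>lborel)
     = (\<integral>\<^sup>+z. ennreal (exp (- (4 * t) * (norm (z - m))\<^sup>2)) \<partial>lborel) * ennreal (exp (- t * (dist x y)\<^sup>2))"
    by (simp add: nn_integral_multc)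
  also have "(\<integral>\<^sup>+z. ennreal (exp (- (4 * t) * (norm (z - m))\<^sup>2)) \<partial>lborel) = gauss_mass TYPE('a) (4 * t)"
    unfolding gauss_mass_def
    by (subst lborel_affine[of 1 m]) (simp_all add: nn_integral_density nn_integral_distr)
  finally show ?thesis .
qed

text \<open>The density that merges the two preceding identities: the Gamma weight in
  \<open>t\<close>, divided by the mass that the convolution in \<open>z\<close> produces.\<close>

definition gauss_weight :: "real \<Rightarrow> (real \<times> 'a::euclidean_space) \<Rightarrow> ennreal" where
  "gauss_weight s = (\<lambda>(t, z). indicator {0<..} t * ennreal (t powr (s/2 - 1) / Gamma (s/2)) / gauss_mass TYPE('a) (4 * t))"

definition gauss_feature :: "real \<times> 'a::euclidean_space \<Rightarrow> 'a \<Rightarrow> real" where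
  "gauss_feature \<tau> x = exp (- 2 * fst \<tau> * (dist x (snd \<tau>))\<^sup>2)"

definition gauss_measure :: "real \<Rightarrow> (real \<times> 'a::euclidean_space) measure" where
  "gauss_measure s = density (lborel \<Otimes>\<^sub>M lborel) (gauss_weight s)"

lemma measurable_gauss_mass [measurable]: "gauss_mass TYPE('a::euclidean_space) \<in> borel_measurable borel"
  unfolding gauss_mass_def[abs_def] by measurable

lemma measurable_gauss_weight [measurable]:
  "gauss_weight s \<in> borel_measurable (borel \<Otimes>\<^sub>M (borel :: 'a::euclidean_space measure))"
  unfolding gauss_weight_def by measurable

lemma measurable_gauss_feature [measurable]:
  assumes [measurable]: "f \<in> M \<rightarrow>\<^sub>M borel \<Otimes>\<^sub>M (borel :: 'a::euclidean_space measure)" "g \<in> M \<rightarrow>\<^sub>M borel"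
  shows "(\<lambda>w. gauss_feature (f w) (g w)) \<in> borel_measurable M"
  unfolding gauss_feature_def by measurable

lemma measurable_gauss_feature' [measurable]: "gauss_feature \<tau> \<in> borel_measurable borel"
  unfolding gauss_feature_def[abs_def] by measurable

text \<open>The kernel as a Gram kernel over the pairs \<open>(t, z)\<close>. All integrands are
  nonnegative, so positive definiteness can be read off Tonelli's theorem even where the kernel is
  infinite.\<close>

lemma riesz_kernel_gauss:
  fixes x y :: "'a::euclidean_space"
  assumes s: "s > 0"
  shows "riesz_kernel s x y = (\<integral>\<^sup>+\<tau>. ennreal (gauss_feature \<tau> x) * ennreal (gauss_feature \<tau> y) \<partial>gauss_measure s)"
proof -
  have "(\<integral>\<^sup>+\<tau>. ennreal (gauss_feature \<tau> x) * ennreal (gauss_feature \<tau> y) \<partial>gauss_measure s)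
    = (\<integral>\<^sup>+\<tau>. gauss_weight s \<tau> * (ennreal (gauss_feature \<tau> x) * ennreal (gauss_feature \<tau> y)) \<partial>(lborel \<Otimes>\<^sub>M lborel))"
    unfolding gauss_measure_def by (subst nn_integral_density) auto
  also have "\<dots> = (\<integral>\<^sup>+t. \<integral>\<^sup>+z. gauss_weight s (t, z) *
      (ennreal (gauss_feature (t, z) x) * ennreal (gauss_feature (t, z) y)) \<partial>lborel \<partial>lborel)"
    by (subst lborel.nn_integral_fst[symmetric]) auto
  also have "\<dots> = riesz_kernel s x y"
    unfolding riesz_kernel_gamma[OF s]
  proof (intro nn_integral_cong)
    fix t :: real
    show "(\<integral>\<^sup>+z. gauss_weight s (t, z) * (ennreal (gauss_feature (t, z) x) * ennreal (gauss_feature (t, z) y)) \<partial>lborel)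
      = indicator {0<..} t * ennreal (t powr (s/2 - 1) / Gamma (s/2)) * ennreal (exp (- t * (dist x y)\<^sup>2))"
    proof (cases "t > 0")
      case True
      have "(\<integral>\<^sup>+z. gauss_weight s (t, z) * (ennreal (gauss_feature (t, z) x) * ennreal (gauss_feature (t, z) y)) \<partial>lborel)
        = ennreal (t powr (s/2 - 1) / Gamma (s/2)) / gauss_mass TYPE('a) (4 * t) *
          (gauss_mass TYPE('a) (4 * t) * ennreal (exp (- t * (dist x y)\<^sup>2)))"
        using True unfolding gauss_weight_def gauss_feature_def gauss_convolution[symmetric]
        by (simp add: nn_integral_cmult)
      also have "\<dots> = ennreal (t powr (s/2 - 1) / Gamma (s/2)) * ennreal (exp (- t * (dist x y)\<^sup>2))"
        using gauss_mass_bounds[of "4 * t", where 'a='a] True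
        by (simp add: mult.assoc[symmetric] ennreal_divide_times ennreal_mult_divide_eq less_top)
      finally show ?thesis using True by simp
    qed (simp add: gauss_weight_def)
  qed
  finally show ?thesis by simp
qed

section \<open>The energy as an inner product of Gaussian transforms\<close>

definition mutual_energy :: "real \<Rightarrow> 'a::metric_space measure \<Rightarrow> 'a measure \<Rightarrow> ennreal" where
  "mutual_energy s M N = (\<integral>\<^sup>+x. \<integral>\<^sup>+y. riesz_kernel s x y \<partial>N \<partial>M)"

text \<open>Required for Tonelli. The density is finite because the mass in its denominator is
  positive wherever the numerator is not 0.\<close>

lemma sigma_finite_gauss_measure: "sigma_finite_measure (gauss_measure s :: (real \<times> 'a::euclidean_space) measure)"
proof -
  have "AE \<tau> in lborel \<Otimes>\<^sub>M (lborel :: 'a measure). gauss_weight s \<tau> \<noteq> \<infinity>"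
  proof (intro AE_I2)
    fix \<tau> :: "real \<times> 'a"
    show "gauss_weight s \<tau> \<noteq> \<infinity>"
      using gauss_mass_bounds(1)[of "4 * fst \<tau>", where 'a='a]
      by (auto simp: gauss_weight_def split_beta indicator_def ennreal_divide_eq_top_iff)
  qed
  then show ?thesis
    unfolding gauss_measure_def
    by (subst sigma_finite_measure.sigma_finite_iff_density_finite[OF sigma_finite_pair_measure[OF sigma_finite_lborel sigma_finite_lborel]]) auto
qed

text \<open>Real-valued, since the difference of two transforms will be squared. For negative
  \<open>fst \<tau>\<close> the integral may fail to exist and take the default value 0; such
  \<open>\<tau>\<close> form a null set for \<open>gauss_measure\<close>.\<close>

definition gauss_transform :: "'a measure \<Rightarrow> real \<times> 'a::euclidean_space \<Rightarrow> real" where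
  "gauss_transform M \<tau> = (\<integral>x. gauss_feature \<tau> x \<partial>M)"

lemma gauss_feature_bounds: "0 \<le> gauss_feature \<tau> x" "fst \<tau> > 0 \<Longrightarrow> gauss_feature \<tau> x \<le> 1"
  by (auto simp: gauss_feature_def)

lemma measurable_gauss_transform [measurable]:
  assumes "finite_measure M" "sets M = sets borel"
  shows "gauss_transform M \<in> borel_measurable (borel \<Otimes>\<^sub>M (borel :: 'a::euclidean_space measure))"
proof -
  interpret finite_measure M by fact
  note [measurable_cong] = assms(2)
  show ?thesis unfolding gauss_transform_def[abs_def] by measurable
qed

lemma nn_integral_gauss_feature:
  assumes "finite_measure M" "sets M = sets borel" "fst \<tau> > 0"
  shows "(\<integral>\<^sup>+x. ennreal (gauss_feature \<tau> x) \<partial>M) = ennreal (gauss_transform M \<tau>)"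
proof -
  interpret finite_measure M by fact
  note [measurable_cong] = assms(2)
  have "integrable M (gauss_feature \<tau>)"
    using gauss_feature_bounds(1)[of \<tau>] gauss_feature_bounds(2)[OF assms(3)]
    by (intro integrable_const_bound[where B=1] AE_I2) auto
  then show ?thesis
    unfolding gauss_transform_def using gauss_feature_bounds(1)[of \<tau>] by (intro nn_integral_eq_integral AE_I2) auto
qed

lemma AE_gauss_measure_pos: "AE \<tau> in gauss_measure s. fst \<tau> > 0"
  unfolding gauss_measure_def
  by (subst AE_density) (auto simp: gauss_weight_def ennreal_zero_less_divide zero_less_iff_neq_zero
      split: split_indicator_asm intro!: AE_I2)

text \<open>Tonelli turns the double integral into the inner product of the two transforms in the
  \<open>L2\<close> space of \<open>gauss_measure\<close>; both sides may be infinite.\<close>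

lemma mutual_energy_gauss:
  fixes M N :: "'a::euclidean_space measure"
  assumes M: "finite_measure M" "sets M = sets borel" and N: "finite_measure N" "sets N = sets borel"
    and s: "s > 0"
  shows "mutual_energy s M N = (\<integral>\<^sup>+\<tau>. ennreal (gauss_transform M \<tau> * gauss_transform N \<tau>) \<partial>gauss_measure s)"
proof -
  interpret M: finite_measure M by fact
  interpret N: finite_measure N by fact
  interpret G: sigma_finite_measure "gauss_measure s :: (real \<times> 'a) measure" by (rule sigma_finite_gauss_measure)
  note [measurable_cong] = M(2) N(2)
  have [measurable_cong]: "sets (gauss_measure s) = sets (borel \<Otimes>\<^sub>M (borel :: 'a measure))"
    by (simp add: gauss_measure_def)
  interpret GM: pair_sigma_finite M "gauss_measure s :: (real \<times> 'a) measure" ..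
  interpret GN: pair_sigma_finite N "gauss_measure s :: (real \<times> 'a) measure" ..
  have "mutual_energy s M N = (\<integral>\<^sup>+x. \<integral>\<^sup>+y. \<integral>\<^sup>+\<tau>. ennreal (gauss_feature \<tau> x) * ennreal (gauss_feature \<tau> y) \<partial>gauss_measure s \<partial>N \<partial>M)"
    unfolding mutual_energy_def riesz_kernel_gauss[OF s] ..
  also have "\<dots> = (\<integral>\<^sup>+x. \<integral>\<^sup>+\<tau>. \<integral>\<^sup>+y. ennreal (gauss_feature \<tau> x) * ennreal (gauss_feature \<tau> y) \<partial>N \<partial>gauss_measure s \<partial>M)"
    by (intro nn_integral_cong, subst GN.Fubini') auto
  also have "\<dots> = (\<integral>\<^sup>+\<tau>. \<integral>\<^sup>+x. \<integral>\<^sup>+y. ennreal (gauss_feature \<tau> x) * ennreal (gauss_feature \<tau> y) \<partial>N \<partial>M \<partial>gauss_measure s)"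
    by (subst GM.Fubini') auto
  also have "\<dots> = (\<integral>\<^sup>+\<tau>. (\<integral>\<^sup>+x. ennreal (gauss_feature \<tau> x) \<partial>M) * (\<integral>\<^sup>+y. ennreal (gauss_feature \<tau> y) \<partial>N) \<partial>gauss_measure s)"
    by (intro nn_integral_cong) (simp add: nn_integral_cmult nn_integral_multc)
  also have "\<dots> = (\<integral>\<^sup>+\<tau>. ennreal (gauss_transform M \<tau> * gauss_transform N \<tau>) \<partial>gauss_measure s)"
  proof (rule nn_integral_cong_AE, use AE_gauss_measure_pos[of s] in eventually_elim)
    case (elim \<tau>)
    have "0 \<le> gauss_transform M \<tau>" "0 \<le> gauss_transform N \<tau>"
      unfolding gauss_transform_def by (auto intro!: integral_nonneg_AE simp: gauss_feature_bounds)
    then show ?case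
      using elim by (simp add: nn_integral_gauss_feature[OF M] nn_integral_gauss_feature[OF N] ennreal_mult)
  qed
  finally show ?thesis .
qed

text \<open>The hypothesis \<open>le\<close> says that the squared \<open>L2\<close> distance of the
  two transforms is at most 0. To avoid subtraction in \<open>ennreal\<close>, the square is added
  to the mixed term: \<open>X + D \<le> X\<close> with finite \<open>X + D\<close> forces
  \<open>D = 0\<close>.\<close>

lemma gauss_transform_AE_eq:
  fixes M N :: "'a::euclidean_space measure"
  assumes M: "finite_measure M" "sets M = sets borel" and N: "finite_measure N" "sets N = sets borel"
    and s: "s > 0"
    and fin: "mutual_energy s M M < \<infinity>" "mutual_energy s N N < \<infinity>"
    and le: "mutual_energy s M M + mutual_energy s N N \<le> 2 * mutual_energy s M N"
  shows "AE \<tau> in gauss_measure s. gauss_transform M \<tau> = gauss_transform N \<tau>"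
proof -
  define a b where "a = gauss_transform M" and "b = gauss_transform N"
  have nn: "0 \<le> a \<tau>" "0 \<le> b \<tau>" for \<tau>
    unfolding a_def b_def gauss_transform_def by (auto intro!: integral_nonneg_AE simp: gauss_feature_bounds)
  have [measurable_cong]: "sets (gauss_measure s) = sets (borel \<Otimes>\<^sub>M (borel :: 'a measure))"
    by (simp add: gauss_measure_def)
  have [measurable]: "a \<in> borel_measurable (borel \<Otimes>\<^sub>M borel)" "b \<in> borel_measurable (borel \<Otimes>\<^sub>M borel)"
    unfolding a_def b_def using M N by (auto intro: measurable_gauss_transform)
  let ?G = "gauss_measure s :: (real \<times> 'a) measure"
  have "mutual_energy s M M + mutual_energy s N N =
      (\<integral>\<^sup>+\<tau>. ennreal (a \<tau> * a \<tau>) \<partial>?G) + (\<integral>\<^sup>+\<tau>. ennreal (b \<tau> * b \<tau>) \<partial>?G)"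
    using M N s by (simp add: mutual_energy_gauss a_def b_def)
  also have "\<dots> = (\<integral>\<^sup>+\<tau>. ennreal (a \<tau> * a \<tau>) + ennreal (b \<tau> * b \<tau>) \<partial>?G)"
    by (subst nn_integral_add) auto
  also have "\<dots> = (\<integral>\<^sup>+\<tau>. 2 * ennreal (a \<tau> * b \<tau>) + ennreal ((a \<tau> - b \<tau>)\<^sup>2) \<partial>?G)"
  proof (intro nn_integral_cong)
    fix \<tau>
    have "a \<tau> * a \<tau> + b \<tau> * b \<tau> = 2 * (a \<tau> * b \<tau>) + (a \<tau> - b \<tau>)\<^sup>2"
      by (simp add: power2_eq_square algebra_simps)
    then have "ennreal (a \<tau> * a \<tau> + b \<tau> * b \<tau>) = ennreal (2 * (a \<tau> * b \<tau>) + (a \<tau> - b \<tau>)\<^sup>2)"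
      by simp
    then show "ennreal (a \<tau> * a \<tau>) + ennreal (b \<tau> * b \<tau>) = 2 * ennreal (a \<tau> * b \<tau>) + ennreal ((a \<tau> - b \<tau>)\<^sup>2)"
      using nn[of \<tau>] by (simp add: ennreal_mult)
  qed
  also have "\<dots> = 2 * (\<integral>\<^sup>+\<tau>. ennreal (a \<tau> * b \<tau>) \<partial>?G) + (\<integral>\<^sup>+\<tau>. ennreal ((a \<tau> - b \<tau>)\<^sup>2) \<partial>?G)"
    by (subst nn_integral_add) (auto simp: nn_integral_cmult)
  finally have eq: "mutual_energy s M M + mutual_energy s N N =
      2 * mutual_energy s M N + (\<integral>\<^sup>+\<tau>. ennreal ((a \<tau> - b \<tau>)\<^sup>2) \<partial>?G)"
    using M N s by (simp add: mutual_energy_gauss a_def b_def)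
  define X where "X = 2 * mutual_energy s M N"
  define D where "D = (\<integral>\<^sup>+\<tau>. ennreal ((a \<tau> - b \<tau>)\<^sup>2) \<partial>?G)"
  have "X + D < \<infinity>" "X + D \<le> X"
  proof -
    have "mutual_energy s M M + mutual_energy s N N < \<infinity>"
      using fin by simp
    then show "X + D < \<infinity>" unfolding eq X_def D_def .
    show "X + D \<le> X" using le unfolding eq X_def D_def .
  qed
  then have "D = 0"
    by (cases X; cases D) (auto simp: ennreal_plus[symmetric] simp del: ennreal_plus)
  then have "AE \<tau> in ?G. ennreal ((a \<tau> - b \<tau>)\<^sup>2) = 0"
    unfolding D_def by (subst (asm) nn_integral_0_iff_AE) auto
  then show ?thesis
    by (rule AE_mp) (auto simp: a_def b_def)
qed

lemma nn_integral_lborel_scale: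
  fixes f :: "'a::euclidean_space \<Rightarrow> ennreal"
  assumes [measurable]: "f \<in> borel_measurable borel" and c: "c > 0"
  shows "(\<integral>\<^sup>+z. f z \<partial>lborel) = ennreal (c ^ DIM('a)) * (\<integral>\<^sup>+u. f (x + c *\<^sub>R u) \<partial>lborel)"
  using c by (subst lborel_affine[of c x]) (simp_all add: nn_integral_density nn_integral_distr nn_integral_cmult)

text \<open>For large \<open>t\<close> the transform is a Gaussian mollification of the measure, so
  it determines the measure in the limit. The transforms agree only for almost every
  \<open>(t, z)\<close>; the scales \<open>c n\<close> are therefore drawn from the set of good
  \<open>t\<close>, with \<open>t = 1 / (c n)^2\<close>.\<close>

lemma gauss_transform_eq_imp_eq:
  fixes M N :: "'a::euclidean_space measure"
  assumes M: "finite_measure M" "sets M = sets borel" and N: "finite_measure N" "sets N = sets borel"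
    and s: "s > 0"
    and eq: "AE \<tau> in gauss_measure s. gauss_transform M \<tau> = gauss_transform N \<tau>"
  shows "M = N"
proof -
  note [measurable_cong] = M(2) N(2)
  interpret M: finite_measure M by fact
  interpret N: finite_measure N by fact
  note [measurable] = measurable_gauss_transform[OF M] measurable_gauss_transform[OF N]
  have "AE \<tau> in lborel \<Otimes>\<^sub>M (lborel :: 'a measure). 0 < gauss_weight s \<tau> \<longrightarrow> gauss_transform M \<tau> = gauss_transform N \<tau>"
    using eq unfolding gauss_measure_def by (subst (asm) AE_density) auto
  then have "AE t in lborel. AE z in (lborel :: 'a measure). 0 < gauss_weight s (t, z) \<longrightarrow> gauss_transform M (t, z) = gauss_transform N (t, z)"
    by (rule lborel_pair.AE_pair)
  moreover have "0 < gauss_weight s (t, z :: 'a)" if "t > 0" for t z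
    using that s gauss_mass_bounds[of "4 * t", where 'a='a]
    by (simp add: gauss_weight_def ennreal_zero_less_divide)
  ultimately have ae: "AE t in lborel. t > 0 \<longrightarrow> (AE z in (lborel :: 'a measure). gauss_transform M (t, z) = gauss_transform N (t, z))"
    by (elim eventually_mono) auto
  \<comment> \<open>Were there no good scale below \<open>1 / real (Suc n)\<close>, all
    \<open>t\<close> beyond its inverse square would form a null set.\<close>
  have ex: "\<exists>c. 0 < c \<and> c < 1 / real (Suc n) \<and> (AE z in (lborel :: 'a measure). gauss_transform M (1 / c\<^sup>2, z) = gauss_transform N (1 / c\<^sup>2, z))" for n
  proof (rule ccontr)
    assume neg: "\<not> ?thesis"
    have "AE t in lborel. \<not> ((real (Suc n))\<^sup>2 < t)"
      using ae
    proof eventually_elim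
      case (elim t)
      show ?case
      proof
        assume t: "(real (Suc n))\<^sup>2 < t"
        then have t0: "t > 0" by (smt (verit) zero_le_power2)
        define c where "c = 1 / sqrt t"
        have "real (Suc n) < sqrt t" using t by (simp add: real_less_rsqrt)
        then have "c < 1 / real (Suc n)" "0 < c" "1 / c\<^sup>2 = t"
          using t0 by (auto simp: c_def power_divide divide_simps)
        then show False using neg elim t0 by blast
      qed
    qed
    then have "emeasure lborel {(real (Suc n))\<^sup>2<..} = 0"
      by (subst (asm) AE_iff_measurable[where N="{(real (Suc n))\<^sup>2<..}"]) auto
    moreover have "emeasure lborel {(real (Suc n))\<^sup>2<..<(real (Suc n))\<^sup>2 + 1} \<le> emeasure lborel {(real (Suc n))\<^sup>2<..}"
      by (rule emeasure_mono) auto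
    ultimately show False by simp
  qed
  then obtain c where c: "\<And>n. 0 < c n" "\<And>n. c n < 1 / real (Suc n)"
    "\<And>n. AE z in (lborel :: 'a measure). gauss_transform M (1 / (c n)\<^sup>2, z) = gauss_transform N (1 / (c n)\<^sup>2, z)"
    by metis
  have c0: "c \<longlonglongrightarrow> 0"
    by (rule tendsto_sandwich[OF _ _ tendsto_const LIMSEQ_inverse_real_of_nat])
      (use c(1,2) in \<open>auto simp: inverse_eq_divide less_imp_le intro!: always_eventually\<close>)
  show ?thesis
  proof (rule finite_borel_measure_eqI[OF M N])
    fix f :: "'a \<Rightarrow> real"
    assume fc: "continuous_on UNIV f" and f01: "\<And>x. 0 \<le> f x \<and> f x \<le> 1"
    have [measurable]: "f \<in> borel_measurable borel"
      using fc borel_measurable_continuous_onI by blast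
    \<comment> \<open>The test function averaged against a Gaussian of width \<open>c n\<close>,
      without the normalizing factor.\<close>
    define g where "g n x = (\<integral>\<^sup>+u. ennreal (f (x + c n *\<^sub>R u)) * ennreal (exp (- 2 * (norm u)\<^sup>2)) \<partial>lborel)" for n x
    have gm: "gauss_mass TYPE('a) 2 < \<infinity>" "0 < gauss_mass TYPE('a) 2"
      using gauss_mass_bounds[of 2, where 'a='a] by auto
    have [measurable]: "g n \<in> borel_measurable borel" for n
      unfolding g_def by measurable
    have g_lim: "(\<lambda>n. g n x) \<longlonglongrightarrow> ennreal (f x) * gauss_mass TYPE('a) 2" for x
    proof -
      have "(\<lambda>n. g n x) \<longlonglongrightarrow> (\<integral>\<^sup>+u. ennreal (f x) * ennreal (exp (- 2 * (norm (u::'a))\<^sup>2)) \<partial>lborel)"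
        unfolding g_def
      proof (rule nn_integral_dominated_convergence[where w="\<lambda>u. ennreal (exp (- 2 * (norm u)\<^sup>2))"])
        show "AE u in lborel. ennreal (f (x + c j *\<^sub>R u)) * ennreal (exp (- 2 * (norm u)\<^sup>2)) \<le> ennreal (exp (- 2 * (norm u)\<^sup>2))" for j
          using f01 by (intro AE_I2) (auto simp: ennreal_mult[symmetric] intro!: ennreal_leI mult_left_le_one_le)
        have "(\<lambda>n. f (x + c n *\<^sub>R u)) \<longlonglongrightarrow> f (x + 0 *\<^sub>R u)" for u
          using fc by (intro isCont_tendsto_compose[of _ f] tendsto_intros c0)
            (auto simp: continuous_on_eq_continuous_at)
        then show "AE u in lborel. (\<lambda>n. ennreal (f (x + c n *\<^sub>R u)) * ennreal (exp (- 2 * (norm u)\<^sup>2)))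
            \<longlonglongrightarrow> ennreal (f x) * ennreal (exp (- 2 * (norm u)\<^sup>2))"
          using f01 by (intro AE_I2) (auto simp: ennreal_mult[symmetric] intro!: tendsto_intros)
      qed (use gm in \<open>auto simp: gauss_mass_def\<close>)
      then show ?thesis by (simp add: nn_integral_cmult gauss_mass_def)
    qed
    have g_le: "g n x \<le> gauss_mass TYPE('a) 2" for n x
      unfolding g_def gauss_mass_def using f01
      by (intro nn_integral_mono) (auto simp: ennreal_mult[symmetric] intro!: ennreal_leI mult_left_le_one_le)
    have conv: "(\<lambda>n. \<integral>\<^sup>+x. g n x \<partial>L) \<longlonglongrightarrow> (\<integral>\<^sup>+x. ennreal (f x) \<partial>L) * gauss_mass TYPE('a) 2"
      if L: "finite_measure L" "sets L = sets borel" for L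
    proof -
      note [measurable_cong] = L(2)
      have "(\<lambda>n. \<integral>\<^sup>+x. g n x \<partial>L) \<longlonglongrightarrow> (\<integral>\<^sup>+x. ennreal (f x) * gauss_mass TYPE('a) 2 \<partial>L)"
        by (rule nn_integral_dominated_convergence[where w="\<lambda>_. gauss_mass TYPE('a) 2"])
          (use g_le g_lim gm finite_measure.emeasure_finite[OF L(1)] in \<open>auto simp: ennreal_mult_less_top less_top\<close>)
      then show ?thesis by (simp add: nn_integral_multc)
    qed
    \<comment> \<open>Substituting \<open>z = x + c n *\<^sub>R u\<close> and exchanging the
      integrals expresses the averages of \<open>f\<close> through the transform alone; the Jacobian
      cancels later.\<close>
    have transf: "ennreal (c n ^ DIM('a)) * (\<integral>\<^sup>+x. g n x \<partial>L) = (\<integral>\<^sup>+z. ennreal (f z) * ennreal (gauss_transform L (1 / (c n)\<^sup>2, z)) \<partial>lborel)"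
      if L: "finite_measure L" "sets L = sets borel" for L n
    proof -
      interpret L: finite_measure L by fact
      interpret LP: pair_sigma_finite L "lborel :: 'a measure" ..
      note [measurable_cong] = L(2)
      have "(\<integral>\<^sup>+z. ennreal (f z) * ennreal (gauss_feature (1 / (c n)\<^sup>2, z) x) \<partial>lborel) = ennreal (c n ^ DIM('a)) * g n x" for x
        using c(1)[of n] by (subst nn_integral_lborel_scale[of _ "c n" x])
          (auto simp: g_def gauss_feature_def dist_norm power_mult_distrib)
      then have "ennreal (c n ^ DIM('a)) * (\<integral>\<^sup>+x. g n x \<partial>L) = (\<integral>\<^sup>+x. \<integral>\<^sup>+z. ennreal (f z) * ennreal (gauss_feature (1 / (c n)\<^sup>2, z) x) \<partial>lborel \<partial>L)"
        by (simp add: nn_integral_cmult)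
      also have "\<dots> = (\<integral>\<^sup>+z. \<integral>\<^sup>+x. ennreal (f z) * ennreal (gauss_feature (1 / (c n)\<^sup>2, z) x) \<partial>L \<partial>lborel)"
        by (subst LP.Fubini') auto
      also have "\<dots> = (\<integral>\<^sup>+z. ennreal (f z) * ennreal (gauss_transform L (1 / (c n)\<^sup>2, z)) \<partial>lborel)"
        using c(1)[of n] by (intro nn_integral_cong) (simp add: nn_integral_cmult nn_integral_gauss_feature[OF L])
      finally show ?thesis .
    qed
    have "(\<integral>\<^sup>+x. g n x \<partial>M) = (\<integral>\<^sup>+x. g n x \<partial>N)" for n
    proof -
      have "ennreal (c n ^ DIM('a)) * (\<integral>\<^sup>+x. g n x \<partial>M) = ennreal (c n ^ DIM('a)) * (\<integral>\<^sup>+x. g n x \<partial>N)"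
        unfolding transf[OF M] transf[OF N]
        by (rule nn_integral_cong_AE) (use c(3)[of n] in \<open>auto elim!: eventually_mono\<close>)
      then show ?thesis using c(1)[of n] by (simp add: ennreal_mult_cancel_left)
    qed
    then have "(\<integral>\<^sup>+x. ennreal (f x) \<partial>M) * gauss_mass TYPE('a) 2 = (\<integral>\<^sup>+x. ennreal (f x) \<partial>N) * gauss_mass TYPE('a) 2"
      using conv[OF M] conv[OF N] by (simp add: LIMSEQ_unique)
    then show "(\<integral>\<^sup>+x. ennreal (f x) \<partial>M) = (\<integral>\<^sup>+x. ennreal (f x) \<partial>N)"
      using gm by (auto simp: mult.commute[of _ "gauss_mass TYPE('a) 2"] ennreal_mult_cancel_left)
  qed
qed

text \<open>The equality case of strict convexity: for finite energies, the energy of the signed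
  measure \<open>M - N\<close> vanishes only if \<open>M = N\<close>.\<close>

lemma mutual_energy_eq_imp_eq:
  fixes M N :: "'a::euclidean_space measure"
  assumes "finite_measure M" "sets M = sets borel" "finite_measure N" "sets N = sets borel" "s > 0"
    and "mutual_energy s M M < \<infinity>" "mutual_energy s N N < \<infinity>"
    and "mutual_energy s M M + mutual_energy s N N \<le> 2 * mutual_energy s M N"
  shows "M = N"
  using gauss_transform_eq_imp_eq[OF assms(1-5)] gauss_transform_AE_eq[OF assms] by blast

section \<open>First variation\<close>

definition potential :: "real \<Rightarrow> 'a::metric_space measure \<Rightarrow> 'a \<Rightarrow> ennreal" where
  "potential s M x = (\<integral>\<^sup>+y. riesz_kernel s x y \<partial>M)"

lemma riesz_kernel_commute: "riesz_kernel s x y = riesz_kernel s y x"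
  by (simp add: riesz_kernel_def dist_commute)

lemma measurable_riesz_kernel [measurable]:
  fixes f g :: "'b \<Rightarrow> 'a::euclidean_space"
  assumes [measurable]: "f \<in> M \<rightarrow>\<^sub>M borel" "g \<in> M \<rightarrow>\<^sub>M borel"
  shows "(\<lambda>w. riesz_kernel s (f w) (g w)) \<in> borel_measurable M"
proof -
  have "(\<lambda>w. if dist (f w) (g w) = 0 then \<infinity> else ennreal (dist (f w) (g w) powr (- s))) \<in> borel_measurable M"
    by measurable
  then show ?thesis by (simp add: riesz_kernel_def[abs_def])
qed

lemma measurable_potential [measurable]:
  assumes "sigma_finite_measure M" "sets M = sets (borel :: 'a::euclidean_space measure)"
  shows "potential s M \<in> borel_measurable borel"
proof -
  interpret sigma_finite_measure M by fact
  note [measurable_cong] = assms(2)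
  show ?thesis unfolding potential_def[abs_def] by measurable
qed

lemma mutual_energy_potential: "mutual_energy s M N = (\<integral>\<^sup>+x. potential s N x \<partial>M)"
  by (simp add: mutual_energy_def potential_def)

lemma mutual_energy_commute:
  fixes M N :: "'a::euclidean_space measure"
  assumes M: "sigma_finite_measure M" "sets M = sets borel" and N: "sigma_finite_measure N" "sets N = sets borel"
  shows "mutual_energy s M N = mutual_energy s N M"
proof -
  interpret M: sigma_finite_measure M by fact
  interpret N: sigma_finite_measure N by fact
  interpret P: pair_sigma_finite M N ..
  note [measurable_cong] = M(2) N(2)
  show ?thesis
    unfolding mutual_energy_def
    by (subst P.Fubini'[symmetric]) (auto simp: riesz_kernel_commute intro!: nn_integral_cong)
qed

text \<open>The convex combination \<open>(1 - t) M + t N\<close>. Encoded as a bind over a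
  Bernoulli variable, it takes its integrals from the rule for binds.\<close>

definition mixture :: "real \<Rightarrow> 'a measure \<Rightarrow> 'a measure \<Rightarrow> 'a measure" where
  "mixture t M N = measure_pmf (bernoulli_pmf t) \<bind> (\<lambda>b. if b then N else M)"

context
  fixes t :: real and M N :: "'a measure" and L :: "'a measure"
  assumes t: "0 \<le> t" "t \<le> 1" and M: "prob_space M" "sets M = sets L" and N: "prob_space N" "sets N = sets L"
begin

lemma measurable_mixture_kernel:
  "(\<lambda>b. if b then N else M) \<in> measure_pmf (bernoulli_pmf t) \<rightarrow>\<^sub>M prob_algebra L"
  using M N by (auto simp: space_prob_algebra)

lemma sets_mixture: "sets (mixture t M N) = sets L"
  unfolding mixture_def using M N by (intro sets_bind) auto

lemma nn_integral_mixture: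
  assumes "f \<in> borel_measurable L"
  shows "(\<integral>\<^sup>+x. f x \<partial>mixture t M N) = ennreal (1 - t) * (\<integral>\<^sup>+x. f x \<partial>M) + ennreal t * (\<integral>\<^sup>+x. f x \<partial>N)"
  unfolding mixture_def
  by (subst nn_integral_bind[OF assms measurable_prob_algebraD[OF measurable_mixture_kernel]])
    (use t in \<open>simp add: nn_integral_measure_pmf_support add.commute mult.commute\<close>)

lemma prob_space_mixture: "prob_space (mixture t M N)"
proof
  have "emeasure (mixture t M N) (space (mixture t M N)) = (\<integral>\<^sup>+x. 1 \<partial>mixture t M N)"
    by simp
  also have "\<dots> = ennreal (1 - t) * 1 + ennreal t * 1"
    using M N by (subst nn_integral_mixture) (auto simp: prob_space.emeasure_space_1)
  also have "\<dots> = 1"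
    using t by (simp flip: ennreal_plus)
  finally show "emeasure (mixture t M N) (space (mixture t M N)) = 1" .
qed

end

lemma mutual_energy_mixture:
  fixes M N :: "'a::euclidean_space measure"
  assumes t: "0 \<le> t" "t \<le> 1" and M: "prob_space M" "sets M = sets borel" and N: "prob_space N" "sets N = sets borel"
  shows "mutual_energy s (mixture t M N) (mixture t M N) =
    ennreal (1 - t) * (ennreal (1 - t) * mutual_energy s M M + ennreal t * mutual_energy s M N) +
    ennreal t * (ennreal (1 - t) * mutual_energy s M N + ennreal t * mutual_energy s N N)"
proof -
  interpret M: prob_space M by fact
  interpret N: prob_space N by fact
  note [measurable_cong] = M(2) N(2)
  have [measurable]: "potential s M \<in> borel_measurable borel" "potential s N \<in> borel_measurable borel"
    using M(2) N(2) M.sigma_finite_measure_axioms N.sigma_finite_measure_axioms by (auto intro: measurable_potential)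
  have pot: "potential s (mixture t M N) = (\<lambda>x. ennreal (1 - t) * potential s M x + ennreal t * potential s N x)"
    by (auto simp: potential_def nn_integral_mixture[OF assms])
  have "mutual_energy s (mixture t M N) (mixture t M N) =
    ennreal (1 - t) * (\<integral>\<^sup>+x. ennreal (1 - t) * potential s M x + ennreal t * potential s N x \<partial>M) +
    ennreal t * (\<integral>\<^sup>+x. ennreal (1 - t) * potential s M x + ennreal t * potential s N x \<partial>N)"
    unfolding mutual_energy_potential pot by (subst nn_integral_mixture[OF assms]) auto
  also have "\<dots> = ennreal (1 - t) * (ennreal (1 - t) * mutual_energy s M M + ennreal t * mutual_energy s M N) +
    ennreal t * (ennreal (1 - t) * mutual_energy s N M + ennreal t * mutual_energy s N N)"
    by (simp add: nn_integral_add nn_integral_cmult mutual_energy_potential)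
  also have "mutual_energy s N M = mutual_energy s M N"
    using M(2) N(2) M.sigma_finite_measure_axioms N.sigma_finite_measure_axioms by (intro mutual_energy_commute) auto
  finally show ?thesis .
qed

section \<open>Semicontinuity of potentials and local integrability of the kernel\<close>

lemma tendsto_riesz_kernel:
  fixes x y :: "'a::metric_space"
  assumes s: "s > 0" and X: "X \<longlonglongrightarrow> x"
  shows "(\<lambda>n. riesz_kernel s (X n) y) \<longlonglongrightarrow> riesz_kernel s x y"
proof (cases "x = y")
  case False
  have "(\<lambda>n. dist (X n) y) \<longlonglongrightarrow> dist x y"
    using X by (intro tendsto_dist tendsto_const)
  then have lim: "(\<lambda>n. ennreal (dist (X n) y powr (- s))) \<longlonglongrightarrow> ennreal (dist x y powr (- s))"
    using False by (intro tendsto_ennrealI tendsto_powr tendsto_const) auto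
  have "eventually (\<lambda>n. X n \<noteq> y) sequentially"
    using X False by (rule tendsto_imp_eventually_ne)
  then have "eventually (\<lambda>n. ennreal (dist (X n) y powr (- s)) = riesz_kernel s (X n) y) sequentially"
    by eventually_elim (simp add: riesz_kernel_def)
  from Lim_transform_eventually[OF lim this] show ?thesis
    using False by (simp add: riesz_kernel_def)
next
  case True
  have "(\<lambda>n. riesz_kernel s (X n) y) \<longlonglongrightarrow> top"
  proof (rule tendsto_top_iff_ennreal[THEN iffD2], intro allI impI)
    fix l :: real assume l: "0 \<le> l"
    \<comment> \<open>Within distance \<open>\<delta>\<close> the kernel is at least
      \<open>l + 1\<close>.\<close>
    define \<delta> where "\<delta> = (l + 1) powr (- 1 / s)"
    have \<delta>: "\<delta> > 0" using l by (simp add: \<delta>_def)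
    have "\<delta> powr (- s) = l + 1" using s l by (simp add: \<delta>_def powr_powr)
    moreover have "eventually (\<lambda>n. dist (X n) y < \<delta>) sequentially"
      using X True \<delta> by (simp add: tendsto_iff)
    ultimately show "eventually (\<lambda>n. ennreal l < riesz_kernel s (X n) y) sequentially"
    proof (elim eventually_mono)
      fix n assume *: "\<delta> powr (- s) = l + 1" "dist (X n) y < \<delta>"
      show "ennreal l < riesz_kernel s (X n) y"
      proof (cases "X n = y")
        case False
        then have "\<delta> powr (- s) \<le> dist (X n) y powr (- s)"
          using * s by (intro powr_mono2') auto
        then show ?thesis using False l * by (simp add: riesz_kernel_def ennreal_less_iff)
      qed (simp add: riesz_kernel_def)
    qed
  qed
  then show ?thesis using True by (simp add: riesz_kernel_def)
qed

text \<open>Fatou's lemma along a sequence on which the potential stays at most \<open>c\<close>.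
  The kernel is continuous in its first argument as a function into [0, \<infinity>], so it needs no
  truncation.\<close>

lemma potential_lsc:
  fixes x :: "'a::euclidean_space"
  assumes s: "s > 0" and M: "sets M = sets borel" and c: "c < potential s M x"
  shows "eventually (\<lambda>z. c < potential s M z) (nhds x)"
proof (rule ccontr)
  note [measurable_cong] = M
  assume "\<not> ?thesis"
  then have "\<exists>z. dist z x < 1 / real (Suc n) \<and> potential s M z \<le> c" for n
    unfolding eventually_nhds_metric by (force simp: not_less dist_commute dest: spec[of _ "1 / real (Suc n)"])
  then obtain X where X: "\<And>n. dist (X n) x < 1 / real (Suc n)" "\<And>n. potential s M (X n) \<le> c"
    by metis
  have "X \<longlonglongrightarrow> x"
    unfolding tendsto_dist_iff[of X]
    by (rule tendsto_sandwich[OF _ _ tendsto_const LIMSEQ_inverse_real_of_nat])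
      (use X(1) in \<open>auto simp: inverse_eq_divide less_imp_le intro!: always_eventually\<close>)
  then have "riesz_kernel s x y = liminf (\<lambda>n. riesz_kernel s (X n) y)" for y
    using lim_imp_Liminf[OF _ tendsto_riesz_kernel[OF s]] by fastforce
  then have "potential s M x = (\<integral>\<^sup>+y. liminf (\<lambda>n. riesz_kernel s (X n) y) \<partial>M)"
    by (simp add: potential_def)
  also have "\<dots> \<le> liminf (\<lambda>n. potential s M (X n))"
    unfolding potential_def by (rule nn_integral_liminf) measurable
  also have "\<dots> \<le> c"
    using X(2) by (intro Liminf_le) auto
  finally show False using c by simp
qed

lemma nn_integral_powr_near_0:
  assumes b: "0 < \<beta>" "\<beta> < (1::real)"
  defines "g \<equiv> \<lambda>u::real. if \<bar>u\<bar> \<le> 2 then if u = 0 then \<infinity> else ennreal (\<bar>u\<bar> powr (- \<beta>)) else 0"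
  shows "(\<integral>\<^sup>+u. g u \<partial>lborel) < \<infinity>"
proof -
  have half: "(\<integral>\<^sup>+u. ennreal (indicator {0..2} u * u powr (- \<beta>)) \<partial>lborel) < \<infinity>" (is "?I < _")
  proof -
    have "((\<lambda>u::real. u powr (- \<beta>)) has_integral (2 powr (- \<beta> + 1) / (- \<beta> + 1))) {0..2}"
      using b by (intro has_integral_powr_from_0) auto
    from nn_integral_has_integral_lborel[OF _ _ has_integral_restrict_UNIV[THEN iffD2, OF this]]
    have "(\<integral>\<^sup>+u. ennreal (if u \<in> {0..2} then u powr (- \<beta>) else 0) \<partial>lborel) = ennreal (2 powr (- \<beta> + 1) / (- \<beta> + 1))"
      by simp
    moreover have "(\<integral>\<^sup>+u. ennreal (if u \<in> {0..2} then u powr (- \<beta>) else 0) \<partial>lborel) = ?I"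
      by (intro nn_integral_cong) (auto simp: indicator_def)
    ultimately show ?thesis
      by (metis ennreal_less_top infinity_ennreal_def)
  qed
  have "AE u in lborel. g u = ennreal (indicator {0..2} u * u powr (- \<beta>)) + ennreal (indicator {0..2} (- u) * (- u) powr (- \<beta>))"
    using AE_lborel_singleton[of "0::real"]
    by eventually_elim (auto simp: g_def indicator_def)
  then have "(\<integral>\<^sup>+u. g u \<partial>lborel) = (\<integral>\<^sup>+u. ennreal (indicator {0..2} u * u powr (- \<beta>)) + ennreal (indicator {0..2} (- u) * (- u) powr (- \<beta>)) \<partial>lborel)"
    by (rule nn_integral_cong_AE)
  also have "\<dots> = ?I + (\<integral>\<^sup>+u. ennreal (indicator {0..2} (- u) * (- u) powr (- \<beta>)) \<partial>lborel)"
    by (subst nn_integral_add) auto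
  also have "(\<integral>\<^sup>+u. ennreal (indicator {0..2} (- u) * (- u) powr (- \<beta>)) \<partial>lborel) = ?I"
    by (subst (2) nn_integral_real_affine[where c="-1" and t=0]) auto
  finally show ?thesis using half by simp
qed

lemma prod_mono_ennreal:
  fixes f g :: "'b \<Rightarrow> ennreal"
  shows "(\<And>i. i \<in> I \<Longrightarrow> f i \<le> g i) \<Longrightarrow> prod f I \<le> prod g I"
  by (induction I rule: infinite_finite_induct) (auto intro: mult_mono)

text \<open>Local integrability below the dimension, without polar coordinates: with
  \<open>\<beta> = s / DIM('a)\<close> the kernel is a product of \<open>DIM('a)\<close> factors
  \<open>norm (y - x) powr (- \<beta>)\<close>, each at most the same power of the modulus of one
  coordinate. The integral splits into one-dimensional ones, convergent since
  \<open>\<beta> < 1\<close>.\<close>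

lemma nn_integral_riesz_kernel_bounded:
  fixes s :: real
  assumes s: "0 < s" "s < DIM('a::euclidean_space)"
  shows "\<exists>C<\<infinity>. \<forall>x\<in>cball (0::'a) 1. (\<integral>\<^sup>+y\<in>cball 0 1. riesz_kernel s x y \<partial>lborel) \<le> C"
proof -
  define \<beta> where "\<beta> = s / DIM('a)"
  have b: "0 < \<beta>" "\<beta> < 1" using s by (simp_all add: \<beta>_def)
  define g where "g = (\<lambda>u::real. if \<bar>u\<bar> \<le> 2 then if u = 0 then \<infinity> else ennreal (\<bar>u\<bar> powr (- \<beta>)) else 0)"
  have [measurable]: "g \<in> borel_measurable borel" unfolding g_def by measurable
  define C where "C = (\<Prod>b\<in>(Basis::'a set). \<integral>\<^sup>+u. g u \<partial>lborel)"
  have "C < \<infinity>"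
    using nn_integral_powr_near_0[OF b] by (simp add: C_def g_def power_less_top_ennreal)
  moreover have "(\<integral>\<^sup>+y\<in>cball 0 1. riesz_kernel s x y \<partial>lborel) \<le> C" if x: "x \<in> cball (0::'a) 1" for x
  proof -
    have "riesz_kernel s x y * indicator (cball 0 1) y \<le> (\<Prod>b\<in>Basis. g ((y - x) \<bullet> b))" for y
    proof (cases "y \<in> cball 0 1 \<and> x \<noteq> y")
      case True
      \<comment> \<open>Both points lie in the unit ball; this is the origin of the cutoff at 2 in
        \<open>g\<close>.\<close>
      have nyx: "norm (y - x) \<le> 2"
        using True x norm_triangle_ineq4[of y x] by simp
      have "riesz_kernel s x y * indicator (cball 0 1) y = ennreal (norm (y - x) powr (- s))"
        using True by (simp add: riesz_kernel_def dist_norm norm_minus_commute)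
      also have "norm (y - x) powr (- s) = (\<Prod>b\<in>(Basis::'a set). norm (y - x) powr (- \<beta>))"
      proof -
        have "norm (y - x) powr (- \<beta>) > 0" using True by auto
        from powr_realpow[OF this, of "DIM('a)"] show ?thesis by (simp add: \<beta>_def powr_powr)
      qed
      also have "ennreal \<dots> = (\<Prod>b\<in>(Basis::'a set). ennreal (norm (y - x) powr (- \<beta>)))"
        by (rule prod_ennreal[symmetric]) simp
      also have "\<dots> \<le> (\<Prod>b\<in>Basis. g ((y - x) \<bullet> b))"
      proof (rule prod_mono_ennreal)
        fix b :: 'a assume "b \<in> Basis"
        then have "\<bar>(y - x) \<bullet> b\<bar> \<le> norm (y - x)" by (rule Basis_le_norm)
        then show "ennreal (norm (y - x) powr (- \<beta>)) \<le> g ((y - x) \<bullet> b)"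
          using nyx b by (auto simp: g_def intro!: ennreal_leI powr_mono2')
      qed
      finally show ?thesis .
    next
      case False
      then show ?thesis
        by (cases "x = y") (auto simp: riesz_kernel_def g_def top_power_ennreal)
    qed
    then have "(\<integral>\<^sup>+y\<in>cball 0 1. riesz_kernel s x y \<partial>lborel) \<le> (\<integral>\<^sup>+y. (\<Prod>b\<in>Basis. g ((y - x) \<bullet> b)) \<partial>lborel)"
      by (intro nn_integral_mono)
    also have "\<dots> = (\<integral>\<^sup>+z. (\<Prod>b\<in>Basis. g (z \<bullet> b)) \<partial>(lborel :: 'a measure))"
      by (subst lborel_affine[of 1 x]) (simp_all add: nn_integral_density nn_integral_distr)
    also have "\<dots> = C"
      unfolding C_def by (subst nn_integral_lborel_prod) simp_all
    finally show ?thesis .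
  qed
  ultimately show ?thesis by blast
qed

lemma potential_uniform_measure:
  fixes M :: "'a::euclidean_space measure"
  assumes "A \<in> sets M" and [measurable_cong]: "sets M = sets borel"
  shows "potential s (uniform_measure M A) x = (\<integral>\<^sup>+y\<in>A. riesz_kernel s x y \<partial>M) / emeasure M A"
  unfolding potential_def using assms(1) by (subst nn_integral_uniform_measure) auto

text \<open>Normalized Lebesgue measure on \<open>A\<close> thus has finite mutual energy with every
  probability measure on the ball, which makes it an admissible competitor.\<close>

lemma potential_uniform_lborel_bounded:
  fixes A :: "'a::euclidean_space set" and s :: real
  assumes s: "0 < s" "s < DIM('a)" and A: "A \<in> sets borel" "A \<subseteq> cball 0 1" "emeasure lborel A > 0"
  shows "\<exists>B<\<infinity>. \<forall>x\<in>cball 0 1. potential s (uniform_measure lborel A) x \<le> B"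
proof -
  obtain C where C: "C < \<infinity>" "\<And>x. x \<in> cball (0::'a) 1 \<Longrightarrow> (\<integral>\<^sup>+y\<in>cball 0 1. riesz_kernel s x y \<partial>lborel) \<le> C"
    using nn_integral_riesz_kernel_bounded[OF s] by blast
  show ?thesis
  proof (intro exI[of _ "C / emeasure lborel A"] conjI ballI)
    show "C / emeasure lborel A < \<infinity>" using C(1) A(3) by (auto simp: ennreal_divide_eq_top_iff less_top[symmetric])
    fix x :: 'a assume x: "x \<in> cball 0 1"
    have "(\<integral>\<^sup>+y\<in>A. riesz_kernel s x y \<partial>lborel) \<le> (\<integral>\<^sup>+y\<in>cball 0 1. riesz_kernel s x y \<partial>lborel)"
      using A(2) by (intro nn_integral_mono) (auto simp: indicator_def)
    also have "\<dots> \<le> C" using C x by simp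
    finally show "potential s (uniform_measure lborel A) x \<le> C / emeasure lborel A"
      using A by (subst potential_uniform_measure) (auto intro: divide_right_mono_ennreal)
  qed
qed

lemma uniform_lborel_test_measure:
  fixes A :: "'a::euclidean_space set"
  assumes A: "A \<in> sets borel" "A \<subseteq> cball 0 1" "emeasure lborel A > 0"
  shows "prob_space (uniform_measure lborel A)" "emeasure (uniform_measure lborel A) (cball 0 1) = 1"
    "AE x in uniform_measure lborel A. x \<in> A"
proof -
  have fA: "emeasure lborel A < \<infinity>"
    using emeasure_mono[OF A(2), of lborel] emeasure_lborel_cball_finite[of "0::'a" 1]
    by (auto intro: le_less_trans)
  show p: "prob_space (uniform_measure lborel A)"
    using A fA by (auto intro!: prob_space_uniform_measure)
  show AE: "AE x in uniform_measure lborel A. x \<in> A"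
    by (rule AE_uniform_measureI) (use A in auto)
  show "emeasure (uniform_measure lborel A) (cball 0 1) = 1"
    using AE A(2) by (intro prob_space.emeasure_eq_1_AE[OF p]) (auto elim!: eventually_mono)
qed

section \<open>First-order conditions for a minimizer\<close>

locale weighted_minimizer =
  fixes s :: real and h :: "'a::euclidean_space \<Rightarrow> ennreal" and \<nu> :: "'a measure"
  assumes s_pos: "0 < s" and s_less: "s < DIM('a)"
    and h_measurable [measurable]: "h \<in> borel_measurable borel"
    and prob: "prob_space \<nu>" and sets_nu [measurable_cong]: "sets \<nu> = sets borel"
    and conc: "emeasure \<nu> (cball 0 1) = 1"
    and energy_finite: "mutual_energy s \<nu> \<nu> < \<infinity>" and field_finite: "(\<integral>\<^sup>+x. h x \<partial>\<nu>) < \<infinity>"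
    and minimal: "\<And>M. prob_space M \<Longrightarrow> sets M = sets borel \<Longrightarrow> emeasure M (cball 0 1) = 1 \<Longrightarrow>
      mutual_energy s \<nu> \<nu> + 2 * (\<integral>\<^sup>+x. h x \<partial>\<nu>) \<le> mutual_energy s M M + 2 * (\<integral>\<^sup>+x. h x \<partial>M)"
begin

sublocale prob_space \<nu> by (rule prob)

lemma measurable_potential_nu [measurable]: "potential s \<nu> \<in> borel_measurable borel"
  using sigma_finite_measure_axioms sets_nu by (rule measurable_potential)

definition total_potential :: "'a \<Rightarrow> ennreal" where
  "total_potential x = potential s \<nu> x + h x"

lemma measurable_total_potential [measurable]: "total_potential \<in> borel_measurable borel"
  unfolding total_potential_def[abs_def] by measurable

text \<open>The constant \<open>F\<close> of the overview. The field enters once here but twice in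
  the weighted energy: differentiating the quadratic part produces a common factor 2.\<close>

definition robin :: ennreal where
  "robin = (\<integral>\<^sup>+x. total_potential x \<partial>\<nu>)"

lemma robin_eq: "robin = mutual_energy s \<nu> \<nu> + (\<integral>\<^sup>+x. h x \<partial>\<nu>)"
  unfolding robin_def total_potential_def mutual_energy_potential by (rule nn_integral_add) auto

lemma robin_finite: "robin < \<infinity>"
  using energy_finite field_finite by (simp add: robin_eq)

text \<open>The derivative of the weighted energy at \<nu> in the direction of \<open>M\<close>
  cannot be negative. The finiteness assumptions allow the expansion along
  \<open>mixture t \<nu> M\<close> to be compared in real arithmetic.\<close>

lemma variation:
  assumes M: "prob_space M" "sets M = sets borel" "emeasure M (cball 0 1) = 1"
    and fin: "mutual_energy s M M < \<infinity>" "mutual_energy s \<nu> M < \<infinity>" "(\<integral>\<^sup>+x. h x \<partial>M) < \<infinity>"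
  shows "robin \<le> (\<integral>\<^sup>+x. total_potential x \<partial>M)"
proof -
  interpret M: prob_space M by fact
  note [measurable_cong] = M(2)
  obtain I where I: "mutual_energy s \<nu> \<nu> = ennreal I" "0 \<le> I"
    using energy_finite by (auto simp: less_top_ennreal)
  obtain I' where I': "mutual_energy s M M = ennreal I'" "0 \<le> I'"
    using fin by (auto simp: less_top_ennreal)
  obtain J where J: "mutual_energy s \<nu> M = ennreal J" "0 \<le> J"
    using fin by (auto simp: less_top_ennreal)
  obtain P where P: "(\<integral>\<^sup>+x. h x \<partial>\<nu>) = ennreal P" "0 \<le> P"
    using field_finite by (auto simp: less_top_ennreal)
  obtain P' where P': "(\<integral>\<^sup>+x. h x \<partial>M) = ennreal P'" "0 \<le> P'"
    using fin by (auto simp: less_top_ennreal)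
  have ineq: "I + 2 * P \<le> (1 - t) * ((1 - t) * I + t * J) + t * ((1 - t) * J + t * I') + 2 * ((1 - t) * P + t * P')"
    if t: "0 \<le> t" "t \<le> 1" for t
  proof -
    note mix = t prob sets_nu M(1,2)
    let ?N = "mixture t \<nu> M"
    have "emeasure ?N (cball 0 1) = (\<integral>\<^sup>+x. indicator (cball 0 1) x \<partial>?N)"
      using sets_mixture[OF mix] by (simp add: nn_integral_indicator)
    also have "\<dots> = ennreal (1 - t) * 1 + ennreal t * 1"
    proof -
      have ind: "(indicator (cball (0::'a) 1) :: 'a \<Rightarrow> ennreal) \<in> borel_measurable borel"
        by (rule borel_measurable_indicator) simp
      show ?thesis
        unfolding nn_integral_mixture[OF mix ind] using conc M(3) by (simp add: sets_nu M(2))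
    qed
    also have "\<dots> = 1" using t by (simp flip: ennreal_plus)
    finally have "mutual_energy s \<nu> \<nu> + 2 * (\<integral>\<^sup>+x. h x \<partial>\<nu>) \<le> mutual_energy s ?N ?N + 2 * (\<integral>\<^sup>+x. h x \<partial>?N)"
      using sets_mixture[OF mix] prob_space_mixture[OF mix] by (intro minimal) auto
    then have "ennreal I + ennreal 2 * ennreal P \<le>
      ennreal (1 - t) * (ennreal (1 - t) * ennreal I + ennreal t * ennreal J) +
      ennreal t * (ennreal (1 - t) * ennreal J + ennreal t * ennreal I') +
      ennreal 2 * (ennreal (1 - t) * ennreal P + ennreal t * ennreal P')"
      unfolding mutual_energy_mixture[OF mix] nn_integral_mixture[OF mix h_measurable] I I' J P P' by simp
    then have "ennreal (I + 2 * P) \<le> ennreal ((1 - t) * ((1 - t) * I + t * J) + t * ((1 - t) * J + t * I') + 2 * ((1 - t) * P + t * P'))"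
      using t I(2) I'(2) J(2) P(2) P'(2)
      by (simp add: ennreal_mult'[symmetric] ennreal_plus[symmetric] del: ennreal_plus ennreal_numeral ennreal_le_iff)
    then show ?thesis
      using t I I' J P P' by (subst (asm) ennreal_le_iff) auto
  qed
  have "I + P \<le> J + P'"
  proof (rule ccontr)
    assume neg: "\<not> I + P \<le> J + P'"
    \<comment> \<open>Along the mixture the energy changes by
      \<open>t * (t * (I - 2 * J + I') - 2 * e)\<close>. The choice of \<open>t\<close> makes
      \<open>t * (I - 2 * J + I')\<close> at most \<open>e\<close>, hence the change
      negative.\<close>
    define e where "e = I + P - (J + P')"
    define c where "c = \<bar>I - 2 * J + I'\<bar> + 1"
    define t where "t = min 1 (e / c)"
    have e: "e > 0" using neg by (simp add: e_def)
    have c: "c > 0" by (simp add: c_def)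
    have t: "0 < t" "t \<le> 1" "t * c \<le> e"
      using e c by (auto simp: t_def min_def field_simps)
    have "(1 - t) * ((1 - t) * I + t * J) + t * ((1 - t) * J + t * I') + 2 * ((1 - t) * P + t * P') - (I + 2 * P)
       = t * (t * (I - 2 * J + I') - 2 * e)"
      by (simp add: e_def algebra_simps)
    then have "t * (t * (I - 2 * J + I') - 2 * e) \<ge> 0"
      using ineq[of t] t by linarith
    then have "2 * e \<le> t * (I - 2 * J + I')"
      using t by (simp add: zero_le_mult_iff)
    also have "\<dots> \<le> t * c" using t by (intro mult_left_mono) (auto simp: c_def)
    finally show False using t e by linarith
  qed
  then have "robin \<le> mutual_energy s \<nu> M + (\<integral>\<^sup>+x. h x \<partial>M)"
    using I J P P' by (simp add: robin_eq ennreal_leI flip: ennreal_plus)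
  also have "mutual_energy s \<nu> M = mutual_energy s M \<nu>"
    by (rule mutual_energy_commute) (use M sets_nu sigma_finite_measure_axioms M.sigma_finite_measure_axioms in auto)
  also have "\<dots> + (\<integral>\<^sup>+x. h x \<partial>M) = (\<integral>\<^sup>+x. total_potential x \<partial>M)"
    unfolding total_potential_def mutual_energy_potential by (rule nn_integral_add[symmetric]) auto
  finally show ?thesis .
qed

text \<open>Otherwise normalized Lebesgue measure on \<open>A\<close> would be a competitor for
  which the integral of \<open>total_potential\<close> is strictly below \<open>robin\<close>,
  against \<open>variation\<close>.\<close>

lemma lborel_test:
  assumes A: "A \<in> sets borel" "A \<subseteq> cball 0 1" "emeasure lborel A > 0"
  shows "\<exists>x\<in>A. robin \<le> total_potential x"
proof (rule ccontr)
  assume "\<not> ?thesis"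
  then have less: "\<And>x. x \<in> A \<Longrightarrow> total_potential x < robin" by auto
  define M where "M = uniform_measure lborel A"
  note test = uniform_lborel_test_measure[OF A, folded M_def]
  have M: "prob_space M" "sets M = sets borel"
    using test by (simp_all add: M_def)
  note [measurable_cong] = M(2)
  interpret M: prob_space M by (rule M)
  note concM = test(2) and AE = test(3)
  obtain B where B: "B < \<infinity>" and pot: "\<And>x. x \<in> cball 0 1 \<Longrightarrow> potential s M x \<le> B"
    using potential_uniform_lborel_bounded[OF s_pos s_less A] unfolding M_def by blast
  have pot_int: "(\<integral>\<^sup>+x. potential s M x \<partial>L) < \<infinity>"
    if L: "prob_space L" "sets L = sets borel" "emeasure L (cball 0 1) = 1" for L
  proof -
    interpret L: prob_space L by fact
    have "AE x in L. x \<in> cball 0 1"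
      using L by (intro L.AE_prob_1) (auto simp: L.emeasure_eq_measure)
    then have "AE x in L. potential s M x \<le> B"
      by eventually_elim (rule pot)
    then have "(\<integral>\<^sup>+x. potential s M x \<partial>L) \<le> (\<integral>\<^sup>+x. B \<partial>L)"
      by (rule nn_integral_mono_AE)
    then show ?thesis using B by (simp add: L.emeasure_space_1 less_top[symmetric] top_unique[symmetric])
  qed
  \<comment> \<open>Finiteness of the field on \<open>A\<close> comes for free: it is a summand of
    \<open>total_potential\<close>, which is below \<open>robin\<close> there.\<close>
  have AEh: "AE x in M. h x \<le> robin"
    using AE
  proof eventually_elim
    case (elim x)
    have "h x \<le> total_potential x" by (simp add: total_potential_def)
    then show ?case using less[OF elim] by (meson less_imp_le order_trans)
  qed
  have "(\<integral>\<^sup>+x. h x \<partial>M) \<le> (\<integral>\<^sup>+x. robin \<partial>M)"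
    using AEh by (rule nn_integral_mono_AE)
  then have "(\<integral>\<^sup>+x. h x \<partial>M) < \<infinity>"
    using robin_finite by (simp add: M.emeasure_space_1)
  then have ge: "robin \<le> (\<integral>\<^sup>+x. total_potential x \<partial>M)"
    using pot_int[OF M concM] pot_int[OF prob sets_nu conc]
    by (intro variation M concM) (simp_all add: mutual_energy_potential)
  have AEl: "AE x in M. total_potential x < robin"
    using AE by eventually_elim (rule less)
  then have AEle: "AE x in M. total_potential x \<le> robin"
    by eventually_elim simp
  have "(\<integral>\<^sup>+x. total_potential x \<partial>M) < (\<integral>\<^sup>+x. robin \<partial>M)"
  proof (rule nn_integral_less)
    have "(\<integral>\<^sup>+x. total_potential x \<partial>M) \<le> (\<integral>\<^sup>+x. robin \<partial>M)"
      using AEle by (rule nn_integral_mono_AE)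
    then show "(\<integral>\<^sup>+x. total_potential x \<partial>M) \<noteq> \<infinity>"
      using robin_finite by (auto simp: M.emeasure_space_1)
    show "\<not> (AE x in M. robin \<le> total_potential x)"
    proof
      assume "AE x in M. robin \<le> total_potential x"
      with AEl have "AE x in M. False" by eventually_elim simp
      then show False by (simp add: eventually_False ae_filter_eq_bot_iff M.emeasure_space_1)
    qed
  qed (use AEle in auto)
  then show False using ge by (simp add: M.emeasure_space_1)
qed

text \<open>The competitor is \<nu> conditioned on \<open>B\<close>; its energy is at most that of
  \<nu> divided by \<open>b^2\<close>, hence finite.\<close>

lemma restriction_test:
  assumes B[measurable]: "B \<in> sets borel"
  shows "robin * emeasure \<nu> B \<le> (\<integral>\<^sup>+x\<in>B. total_potential x \<partial>\<nu>)"
proof (cases "emeasure \<nu> B = 0")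
  case False
  define M where "M = uniform_measure \<nu> B"
  define b where "b = emeasure \<nu> B"
  have b: "b \<noteq> 0" "b < \<infinity>" using False emeasure_finite[of B] by (auto simp: b_def less_top[symmetric])
  have M: "prob_space M" "sets M = sets borel"
    unfolding M_def using False sets_nu by (auto intro!: prob_space_uniform_measure)
  interpret M: prob_space M by (rule M)
  note [measurable_cong] = M(2)
  have int_M: "(\<integral>\<^sup>+x. f x \<partial>M) = (\<integral>\<^sup>+x\<in>B. f x \<partial>\<nu>) / b" if "f \<in> borel_measurable borel" for f
    unfolding M_def b_def using that sets_nu by (subst nn_integral_uniform_measure) auto
  have int_le: "(\<integral>\<^sup>+x. f x \<partial>M) \<le> (\<integral>\<^sup>+x. f x \<partial>\<nu>) / b" if "f \<in> borel_measurable borel" for f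
    unfolding int_M[OF that]
    by (intro divide_right_mono_ennreal nn_integral_mono) (auto simp: indicator_def)
  have fin_div: "x / b < \<infinity>" if "x < \<infinity>" for x
    using that b by (simp add: ennreal_divide_eq_top_iff less_top[symmetric])
  have "AE x in \<nu>. x \<in> cball 0 1"
    using conc by (intro AE_prob_1) (simp add: emeasure_eq_measure)
  then have "AE x in M. x \<in> cball 0 1"
    unfolding M_def using False sets_nu emeasure_finite[of B]
    by (subst AE_uniform_measure) (auto elim!: eventually_mono simp: less_top[symmetric])
  then have conc: "emeasure M (cball 0 1) = 1"
    by (intro M.emeasure_eq_1_AE) auto
  have pot_le: "potential s M x \<le> potential s \<nu> x / b" for x
    unfolding potential_def by (rule int_le) measurable
  have [measurable]: "potential s M \<in> borel_measurable borel"
    using M.sigma_finite_measure_axioms M(2) by (rule measurable_potential)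
  have nuM: "mutual_energy s \<nu> M \<le> mutual_energy s \<nu> \<nu> / b"
    unfolding mutual_energy_potential using pot_le
    by (subst nn_integral_divide[symmetric]) (auto intro!: nn_integral_mono)
  have "mutual_energy s M M \<le> mutual_energy s \<nu> M / b"
    unfolding mutual_energy_potential by (rule int_le) measurable
  moreover have "mutual_energy s \<nu> M / b < \<infinity>"
    using nuM fin_div[OF energy_finite] by (intro fin_div) (rule le_less_trans)
  moreover have "(\<integral>\<^sup>+x. h x \<partial>M) < \<infinity>"
    using int_le[OF h_measurable] fin_div[OF field_finite] by (rule le_less_trans)
  ultimately have "robin \<le> (\<integral>\<^sup>+x. total_potential x \<partial>M)"
    using nuM fin_div[OF energy_finite] by (intro variation M conc) (auto intro: le_less_trans)
  also have "\<dots> = (\<integral>\<^sup>+x\<in>B. total_potential x \<partial>\<nu>) / b"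
    by (rule int_M) measurable
  finally have "robin * b \<le> (\<integral>\<^sup>+x\<in>B. total_potential x \<partial>\<nu>) / b * b"
    by (rule mult_right_mono) simp
  also have "\<dots> = (\<integral>\<^sup>+x\<in>B. total_potential x \<partial>\<nu>)"
    using b by (subst ennreal_divide_times, subst ennreal_times_divide, subst ennreal_mult_divide_eq) auto
  finally show ?thesis by (simp add: b_def)
qed simp

text \<open>By semicontinuity an excess at \<open>x\<close> persists on a neighbourhood
  \<open>G\<close>, which has positive mass. On the complement of \<open>G\<close> the average is at
  least \<open>robin\<close> by \<open>restriction_test\<close>, so the overall average would exceed
  its own value \<open>robin\<close>.\<close>

lemma total_potential_le_on_support:
  assumes x: "x \<in> measure_support \<nu>" "x \<in> cball 0 1" and lsc: "lower_semicontinuous_on (cball 0 1) h"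
  shows "total_potential x \<le> robin"
proof (rule ccontr)
  assume "\<not> ?thesis"
  then have gt: "robin < potential s \<nu> x + h x" by (simp add: total_potential_def)
  \<comment> \<open>Lower bounds for the two summands whose sum is still above \<open>robin\<close>.
    A summand equal to 0 admits no strict lower bound, hence the alternatives \<open>u = 0\<close>
    and \<open>v = 0\<close>.\<close>
  obtain u v where uv: "u < potential s \<nu> x \<or> u = 0" "v < h x \<or> v = 0" "robin < u + v" "u < \<infinity>" "v < \<infinity>"
  proof (cases "potential s \<nu> x = \<infinity> \<or> h x = \<infinity>")
    case True
    have "robin < robin + 1" using robin_finite by (simp add: less_top_ennreal) (metis ennreal_add_left_cancel_less add_0_right zero_less_one ennreal_less_top infinity_ennreal_def)
    then show thesis
      using True robin_finite that[of "robin + 1" 0] that[of 0 "robin + 1"] by auto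
  next
    case False
    then obtain a b where a: "potential s \<nu> x = ennreal a" "0 \<le> a" and b: "h x = ennreal b" "0 \<le> b"
      by (cases "potential s \<nu> x"; cases "h x") auto
    obtain R where R: "robin = ennreal R" "0 \<le> R" using robin_finite by (auto simp: less_top_ennreal)
    define \<delta> where "\<delta> = (a + b - R) / 4"
    have \<delta>: "\<delta> > 0" using gt a b R by (simp add: \<delta>_def ennreal_less_iff flip: ennreal_plus)
    have "robin < ennreal (max 0 (a - \<delta>)) + ennreal (max 0 (b - \<delta>))"
    proof -
      have "R < max 0 (a - \<delta>) + max 0 (b - \<delta>)"
        using \<delta> by (simp add: \<delta>_def max_def field_simps)
      then show ?thesis
        using R by (simp only: ennreal_less_iff ennreal_plus[symmetric] max.cobounded1)
    qed
    moreover have "ennreal (max 0 (r - \<delta>)) < ennreal r \<or> ennreal (max 0 (r - \<delta>)) = 0" if "0 \<le> r" for r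
      using \<delta> that by (cases "r - \<delta> \<le> 0") (simp_all only: max_def ennreal_less_iff, auto simp: ennreal_less_iff)
    ultimately show thesis
      using that[of "ennreal (max 0 (a - \<delta>))" "ennreal (max 0 (b - \<delta>))"] a b
      by (simp only: ennreal_less_top infinity_ennreal_def simp_thms)
  qed
  define c where "c = u + v"
  have "eventually (\<lambda>z. u \<le> potential s \<nu> z) (nhds x)"
    using uv(1)
  proof
    assume "u < potential s \<nu> x"
    from potential_lsc[OF s_pos sets_nu this] show ?thesis by eventually_elim simp
  qed simp
  moreover have "eventually (\<lambda>z. z \<in> cball 0 1 \<longrightarrow> v \<le> h z) (nhds x)"
    using uv(2)
  proof
    assume v: "v < h x"
    then have "eventually (\<lambda>z. v < h z) (at x within cball 0 1)"
      using lsc x(2) unfolding lower_semicontinuous_on_def by blast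
    then have "eventually (\<lambda>z. z \<noteq> x \<longrightarrow> z \<in> cball 0 1 \<longrightarrow> v < h z) (nhds x)"
      by (simp add: eventually_at_filter)
    then show ?thesis by eventually_elim (use v in auto)
  qed simp
  ultimately have "eventually (\<lambda>z. z \<in> cball 0 1 \<longrightarrow> c \<le> total_potential z) (nhds x)"
    by eventually_elim (auto simp: total_potential_def c_def intro: add_mono)
  then obtain G where G: "open G" "x \<in> G" "\<And>z. z \<in> G \<Longrightarrow> z \<in> cball 0 1 \<Longrightarrow> c \<le> total_potential z"
    unfolding eventually_nhds by auto
  have [measurable]: "G \<in> sets borel" using G by simp
  have "emeasure \<nu> G > 0" using x(1) G by (simp add: measure_support_def)
  then have g: "0 < prob G" by (simp add: emeasure_eq_measure)
  obtain C where C: "c = ennreal C" "0 \<le> C" using uv by (auto simp: c_def less_top_ennreal simp flip: ennreal_plus)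
  obtain R where R: "robin = ennreal R" "0 \<le> R" using robin_finite by (auto simp: less_top_ennreal)
  have CR: "R < C" using uv(3) C R by (simp add: c_def[symmetric] ennreal_less_iff)
  have "AE z in \<nu>. z \<in> cball 0 1"
    using conc by (intro AE_prob_1) (simp add: emeasure_eq_measure)
  then have "(\<integral>\<^sup>+z. c * indicator G z \<partial>\<nu>) \<le> (\<integral>\<^sup>+z\<in>G. total_potential z \<partial>\<nu>)"
    using G(3) by (intro nn_integral_mono_AE) (auto elim!: eventually_mono simp: indicator_def)
  then have 1: "c * emeasure \<nu> G \<le> (\<integral>\<^sup>+z\<in>G. total_potential z \<partial>\<nu>)"
    by (simp add: nn_integral_cmult_indicator sets_nu)
  have 2: "robin * emeasure \<nu> (- G) \<le> (\<integral>\<^sup>+z\<in>- G. total_potential z \<partial>\<nu>)"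
    by (rule restriction_test) simp
  have "robin = (\<integral>\<^sup>+z. total_potential z * indicator G z + total_potential z * indicator (- G) z \<partial>\<nu>)"
    unfolding robin_def by (intro nn_integral_cong) (auto simp: indicator_def)
  also have "\<dots> = (\<integral>\<^sup>+z\<in>G. total_potential z \<partial>\<nu>) + (\<integral>\<^sup>+z\<in>- G. total_potential z \<partial>\<nu>)"
    by (rule nn_integral_add) auto
  finally have "c * emeasure \<nu> G + robin * emeasure \<nu> (- G) \<le> robin"
    using add_mono[OF 1 2] by simp
  moreover have "prob (- G) = 1 - prob G"
    using prob_compl[of G] sets_nu by (simp add: Compl_eq_Diff_UNIV sets_eq_imp_space_eq)
  ultimately have "C * prob G + R * (1 - prob G) \<le> R"
    using C R by (simp add: emeasure_eq_measure flip: ennreal_mult ennreal_plus)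
  then have "(C - R) * prob G \<le> 0" by (simp add: algebra_simps)
  then show False using g CR by (simp add: mult_le_0_iff)
qed

end

section \<open>Radial potentials away from the support\<close>

lemma has_real_derivative_integral:
  fixes \<phi> \<phi>' :: "real \<Rightarrow> 'b \<Rightarrow> real"
  assumes M: "finite_measure M" and t0: "t0 \<in> {a<..<b}"
    and [measurable]: "\<And>t. \<phi> t \<in> borel_measurable M" "\<phi>' t0 \<in> borel_measurable M"
    and int: "\<And>t. t \<in> {a<..<b} \<Longrightarrow> integrable M (\<phi> t)"
    and deriv: "AE y in M. \<forall>t\<in>{a<..<b}. ((\<lambda>t. \<phi> t y) has_real_derivative \<phi>' t y) (at t) \<and> \<bar>\<phi>' t y\<bar> \<le> C"
  shows "((\<lambda>t. \<integral>y. \<phi> t y \<partial>M) has_real_derivative (\<integral>y. \<phi>' t0 y \<partial>M)) (at t0)"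
proof -
  interpret finite_measure M by fact
  let ?T = "{a<..<b}"
  have "((\<lambda>t. \<integral>y. \<phi> t y \<partial>M) has_real_derivative (\<integral>y. \<phi>' t0 y \<partial>M)) (at t0 within ?T)"
    unfolding has_field_derivative_iff tendsto_at_iff_sequentially
  proof (intro allI impI)
    fix X :: "nat \<Rightarrow> real"
    assume X: "\<forall>i. X i \<in> ?T - {t0}" "X \<longlonglongrightarrow> t0"
    have "(\<lambda>i. \<integral>y. (\<phi> (X i) y - \<phi> t0 y) / (X i - t0) \<partial>M) \<longlonglongrightarrow> (\<integral>y. \<phi>' t0 y \<partial>M)"
    proof (rule integral_dominated_convergence[where w="\<lambda>_. C"])
      show "AE y in M. (\<lambda>i. (\<phi> (X i) y - \<phi> t0 y) / (X i - t0)) \<longlonglongrightarrow> \<phi>' t0 y"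
        using deriv
      proof eventually_elim
        case (elim y)
        then have "((\<lambda>t. \<phi> t y) has_real_derivative \<phi>' t0 y) (at t0 within ?T)"
          using t0 by (auto intro: has_field_derivative_at_within)
        then show ?case
          using X unfolding has_field_derivative_iff tendsto_at_iff_sequentially by (auto simp: comp_def)
      qed
      show "AE y in M. norm ((\<phi> (X i) y - \<phi> t0 y) / (X i - t0)) \<le> C" for i
        using deriv
      proof eventually_elim
        case (elim y)
        \<comment> \<open>The mean value inequality bounds all difference quotients by the constant
          \<open>C\<close>, which is integrable since the measure is finite.\<close>
        have "norm (\<phi> (X i) y - \<phi> t0 y) \<le> C * norm (X i - t0)"
        proof (rule field_differentiable_bound[of ?T])
          show "((\<lambda>t. \<phi> t y) has_field_derivative \<phi>' t y) (at t within ?T)" if "t \<in> ?T" for t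
            using elim that by (auto intro: has_field_derivative_at_within)
        qed (use elim X t0 in auto)
        then show ?case using X by (simp add: divide_simps abs_mult)
      qed
    qed auto
    then show "((\<lambda>t. ((\<integral>y. \<phi> t y \<partial>M) - (\<integral>y. \<phi> t0 y \<partial>M)) / (t - t0)) \<circ> X) \<longlonglongrightarrow> (\<integral>y. \<phi>' t0 y \<partial>M)"
      using X int t0 by (simp add: comp_def)
  qed
  then show ?thesis using t0 by (simp add: at_within_open[of t0 ?T])
qed

text \<open>The squared norm is a quadratic polynomial in \<open>t\<close>, so the kernel is
  differentiated as a power of that polynomial with half the exponent.\<close>

lemma norm_powr_line_deriv:
  fixes w v :: "'a::real_inner"
  assumes v: "norm v = 1" and w: "w + t *\<^sub>R v \<noteq> 0"
  shows "((\<lambda>t. norm (w + t *\<^sub>R v) powr (- p)) has_real_derivative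
    - p * (((w + t *\<^sub>R v) \<bullet> v) * norm (w + t *\<^sub>R v) powr (- p - 2))) (at t)"
proof -
  have sq: "(norm (w + u *\<^sub>R v))\<^sup>2 = w \<bullet> w + 2 * u * (w \<bullet> v) + u\<^sup>2" for u
  proof -
    have "v \<bullet> v = 1" using v by (simp add: dot_square_norm)
    then show ?thesis
      unfolding power2_norm_eq_inner
      by (simp add: inner_add_left inner_add_right inner_commute[of v w] power2_eq_square algebra_simps)
  qed
  have eq: "norm (w + u *\<^sub>R v) powr q = (w \<bullet> w + 2 * u * (w \<bullet> v) + u\<^sup>2) powr (q / 2)" for u q
    unfolding sq[symmetric] by (cases "w + u *\<^sub>R v = 0") (auto simp: powr_powr simp flip: powr_numeral)
  have pos: "w \<bullet> w + 2 * t * (w \<bullet> v) + t\<^sup>2 > 0"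
    unfolding sq[symmetric] using w by simp
  have "((\<lambda>t. (w \<bullet> w + 2 * t * (w \<bullet> v) + t\<^sup>2) powr (- p / 2)) has_real_derivative
     (- p / 2) * (w \<bullet> w + 2 * t * (w \<bullet> v) + t\<^sup>2) powr (- p / 2 - 1) * (2 * (w \<bullet> v) + 2 * t)) (at t)"
    using pos by (auto intro!: derivative_eq_intros)
  then show ?thesis
    unfolding eq
  proof (rule DERIV_cong)
    have lin: "(w + t *\<^sub>R v) \<bullet> v = w \<bullet> v + t"
      using v by (simp add: inner_add_left dot_square_norm)
    show "- p / 2 * (w \<bullet> w + 2 * t * (w \<bullet> v) + t\<^sup>2) powr (- p / 2 - 1) * (2 * (w \<bullet> v) + 2 * t) =
      - p * ((w + t *\<^sub>R v) \<bullet> v * (w \<bullet> w + 2 * t * (w \<bullet> v) + t\<^sup>2) powr ((- p - 2) / 2))"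
      unfolding lin by (simp add: diff_divide_distrib)
  qed
qed

lemma inner_norm_powr_line_deriv:
  fixes w v :: "'a::real_inner"
  assumes v: "norm v = 1" and w: "w + t *\<^sub>R v \<noteq> 0"
  shows "((\<lambda>t. ((w + t *\<^sub>R v) \<bullet> v) * norm (w + t *\<^sub>R v) powr (- p)) has_real_derivative
    norm (w + t *\<^sub>R v) powr (- p) - p * ((w + t *\<^sub>R v) \<bullet> v)\<^sup>2 * norm (w + t *\<^sub>R v) powr (- p - 2)) (at t)"
proof -
  have lin: "(w + t *\<^sub>R v) \<bullet> v = w \<bullet> v + t" for t
    using v by (simp add: inner_add_left dot_square_norm)
  show ?thesis
    unfolding lin
    by (rule DERIV_cong[OF DERIV_mult[OF DERIV_add[OF DERIV_const DERIV_ident] norm_powr_line_deriv[OF assms]]])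
      (unfold lin, simp add: power2_eq_square algebra_simps)
qed

text \<open>Cauchy-Schwarz bounds for the terms in the first and second derivatives of the kernel;
  they provide dominating constants once the distance is bounded below.\<close>

lemma mult_powr_norm_le:
  fixes w v :: "'a::real_inner"
  assumes v: "norm v = 1" and w: "w \<noteq> 0"
  shows "\<bar>(w \<bullet> v) * norm w powr (- p - 2)\<bar> \<le> norm w powr (- p - 1)"
    and "(w \<bullet> v)\<^sup>2 * norm w powr (- p - 4) \<le> norm w powr (- p - 2)"
proof -
  have cs: "\<bar>w \<bullet> v\<bar> \<le> norm w" using Cauchy_Schwarz_ineq2[of w v] v by simp
  have e: "1 + (- p - 2) = - p - 1" by simp
  have e1: "norm w * norm w powr (- p - 2) = norm w powr (- p - 1)"
    using w powr_add[of "norm w" 1 "- p - 2", unfolded e] by simp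
  show "\<bar>(w \<bullet> v) * norm w powr (- p - 2)\<bar> \<le> norm w powr (- p - 1)"
    using cs unfolding e1[symmetric] by (simp add: abs_mult mult_right_mono)
  have e': "2 + (- p - 4) = - p - 2" by simp
  have e2: "(norm w)\<^sup>2 * norm w powr (- p - 4) = norm w powr (- p - 2)"
    using w powr_add[of "norm w" 2 "- p - 4", unfolded e'] by simp
  have "(w \<bullet> v)\<^sup>2 \<le> (norm w)\<^sup>2" using cs by (metis abs_le_square_iff abs_norm_cancel)
  then show "(w \<bullet> v)\<^sup>2 * norm w powr (- p - 4) \<le> norm w powr (- p - 2)"
    unfolding e2[symmetric] by (simp add: mult_right_mono)
qed

context
  fixes M :: "'a::euclidean_space measure" and x v :: 'a and a b \<delta> p t0 :: real
  assumes M: "finite_measure M" "sets M = sets borel"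
    and v: "norm v = 1" and \<delta>: "\<delta> > 0" and p: "p > 0" and t0: "t0 \<in> {a<..<b}"
    and sep: "AE y in M. \<forall>t\<in>{a<..<b}. \<delta> \<le> norm (x + t *\<^sub>R v - y)"
begin

interpretation finite_measure M by (rule M)

lemma powr_le_sep:
  assumes "\<delta> \<le> n" "q > 0"
  shows "n powr (- q) \<le> \<delta> powr (- q)"
  using assms \<delta> by (intro powr_mono2') auto

lemma integrable_line_powr:
  assumes t: "t \<in> {a<..<b}" and q: "q > 0"
  shows "integrable M (\<lambda>y. norm (x + t *\<^sub>R v - y) powr (- q))"
proof (rule integrable_const_bound[where B="\<delta> powr (- q)"])
  note [measurable_cong] = M(2)
  show "(\<lambda>y. norm (x + t *\<^sub>R v - y) powr (- q)) \<in> borel_measurable M" by measurable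
  show "AE y in M. norm (norm (x + t *\<^sub>R v - y) powr (- q)) \<le> \<delta> powr (- q)"
    using sep by eventually_elim (use t q powr_le_sep in auto)
qed

lemma integrable_line_inner:
  assumes t: "t \<in> {a<..<b}"
  shows "integrable M (\<lambda>y. ((x + t *\<^sub>R v - y) \<bullet> v) * norm (x + t *\<^sub>R v - y) powr (- p - 2))"
proof (rule integrable_const_bound[where B="\<delta> powr (- (p + 1))"])
  note [measurable_cong] = M(2)
  show "(\<lambda>y. ((x + t *\<^sub>R v - y) \<bullet> v) * norm (x + t *\<^sub>R v - y) powr (- p - 2)) \<in> borel_measurable M" by measurable
  show "AE y in M. norm (((x + t *\<^sub>R v - y) \<bullet> v) * norm (x + t *\<^sub>R v - y) powr (- p - 2)) \<le> \<delta> powr (- (p + 1))"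
    using sep
  proof eventually_elim
    case (elim y)
    then have *: "\<delta> \<le> norm (x + t *\<^sub>R v - y)" using t by auto
    then have "x + t *\<^sub>R v - y \<noteq> 0" using \<delta> by auto
    from mult_powr_norm_le(1)[OF v this, of p] powr_le_sep[OF *, of "p + 1"] p show ?case by simp
  qed
qed

lemma integrable_line_inner_sq:
  assumes t: "t \<in> {a<..<b}" and u: "norm u = 1"
  shows "integrable M (\<lambda>y. ((x + t *\<^sub>R v - y) \<bullet> u)\<^sup>2 * norm (x + t *\<^sub>R v - y) powr (- p - 4))"
proof (rule integrable_const_bound[where B="\<delta> powr (- (p + 2))"])
  note [measurable_cong] = M(2)
  show "(\<lambda>y. ((x + t *\<^sub>R v - y) \<bullet> u)\<^sup>2 * norm (x + t *\<^sub>R v - y) powr (- p - 4)) \<in> borel_measurable M" by measurable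
  show "AE y in M. norm (((x + t *\<^sub>R v - y) \<bullet> u)\<^sup>2 * norm (x + t *\<^sub>R v - y) powr (- p - 4)) \<le> \<delta> powr (- (p + 2))"
    using sep
  proof eventually_elim
    case (elim y)
    then have *: "\<delta> \<le> norm (x + t *\<^sub>R v - y)" using t by auto
    then have "x + t *\<^sub>R v - y \<noteq> 0" using \<delta> by auto
    from mult_powr_norm_le(2)[OF u this, of p] powr_le_sep[OF *, of "p + 2"] p show ?case by simp
  qed
qed

lemma line_integral_deriv1:
  "((\<lambda>t. \<integral>y. norm (x + t *\<^sub>R v - y) powr (- p) \<partial>M) has_real_derivative
    (\<integral>y. - p * (((x + t0 *\<^sub>R v - y) \<bullet> v) * norm (x + t0 *\<^sub>R v - y) powr (- p - 2)) \<partial>M)) (at t0)"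
proof (rule has_real_derivative_integral[OF M(1) t0, where C="p * \<delta> powr (- (p + 1))"
      and \<phi>'="\<lambda>t y. - p * (((x + t *\<^sub>R v - y) \<bullet> v) * norm (x + t *\<^sub>R v - y) powr (- p - 2))"])
  note [measurable_cong] = M(2)
  show "(\<lambda>y. norm (x + t *\<^sub>R v - y) powr (- p)) \<in> borel_measurable M" for t by measurable
  show "(\<lambda>y. - p * (((x + t0 *\<^sub>R v - y) \<bullet> v) * norm (x + t0 *\<^sub>R v - y) powr (- p - 2))) \<in> borel_measurable M" by measurable
  show "AE y in M. \<forall>t\<in>{a<..<b}. ((\<lambda>t. norm (x + t *\<^sub>R v - y) powr (- p)) has_real_derivative
      - p * (((x + t *\<^sub>R v - y) \<bullet> v) * norm (x + t *\<^sub>R v - y) powr (- p - 2))) (at t) \<and>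
      \<bar>- p * (((x + t *\<^sub>R v - y) \<bullet> v) * norm (x + t *\<^sub>R v - y) powr (- p - 2))\<bar> \<le> p * \<delta> powr (- (p + 1))"
    using sep
  proof eventually_elim
    case (elim y)
    show ?case
    proof (intro ballI conjI)
      fix t assume t: "t \<in> {a<..<b}"
      then have *: "\<delta> \<le> norm (x + t *\<^sub>R v - y)" using elim by auto
      have w: "(x - y) + t *\<^sub>R v \<noteq> 0" and eq: "\<And>t. x + t *\<^sub>R v - y = (x - y) + t *\<^sub>R v"
        using * \<delta> by (auto simp: algebra_simps)
      show "((\<lambda>t. norm (x + t *\<^sub>R v - y) powr (- p)) has_real_derivative
        - p * (((x + t *\<^sub>R v - y) \<bullet> v) * norm (x + t *\<^sub>R v - y) powr (- p - 2))) (at t)"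
        unfolding eq by (rule norm_powr_line_deriv[OF v w])
      have "\<bar>((x + t *\<^sub>R v - y) \<bullet> v) * norm (x + t *\<^sub>R v - y) powr (- p - 2)\<bar> \<le> \<delta> powr (- (p + 1))"
        using mult_powr_norm_le(1)[OF v w, of p] powr_le_sep[OF *, of "p + 1"] p unfolding eq by simp
      then show "\<bar>- p * (((x + t *\<^sub>R v - y) \<bullet> v) * norm (x + t *\<^sub>R v - y) powr (- p - 2))\<bar> \<le> p * \<delta> powr (- (p + 1))"
        using p by (simp add: abs_mult mult_left_mono)
    qed
  qed
qed (rule integrable_line_powr[OF _ p])

lemma line_integral_deriv2:
  "((\<lambda>t. \<integral>y. ((x + t *\<^sub>R v - y) \<bullet> v) * norm (x + t *\<^sub>R v - y) powr (- p - 2) \<partial>M) has_real_derivative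
    (\<integral>y. norm (x + t0 *\<^sub>R v - y) powr (- p - 2) -
      (p + 2) * (((x + t0 *\<^sub>R v - y) \<bullet> v)\<^sup>2 * norm (x + t0 *\<^sub>R v - y) powr (- p - 4)) \<partial>M)) (at t0)"
proof (rule has_real_derivative_integral[OF M(1) t0, where C="(p + 3) * \<delta> powr (- (p + 2))"
      and \<phi>'="\<lambda>t y. norm (x + t *\<^sub>R v - y) powr (- p - 2) -
        (p + 2) * (((x + t *\<^sub>R v - y) \<bullet> v)\<^sup>2 * norm (x + t *\<^sub>R v - y) powr (- p - 4))"])
  note [measurable_cong] = M(2)
  show "(\<lambda>y. ((x + t *\<^sub>R v - y) \<bullet> v) * norm (x + t *\<^sub>R v - y) powr (- p - 2)) \<in> borel_measurable M" for t by measurable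
  show "(\<lambda>y. norm (x + t0 *\<^sub>R v - y) powr (- p - 2) -
        (p + 2) * (((x + t0 *\<^sub>R v - y) \<bullet> v)\<^sup>2 * norm (x + t0 *\<^sub>R v - y) powr (- p - 4))) \<in> borel_measurable M" by measurable
  show "AE y in M. \<forall>t\<in>{a<..<b}. ((\<lambda>t. ((x + t *\<^sub>R v - y) \<bullet> v) * norm (x + t *\<^sub>R v - y) powr (- p - 2)) has_real_derivative
      norm (x + t *\<^sub>R v - y) powr (- p - 2) -
        (p + 2) * (((x + t *\<^sub>R v - y) \<bullet> v)\<^sup>2 * norm (x + t *\<^sub>R v - y) powr (- p - 4))) (at t) \<and>
      \<bar>norm (x + t *\<^sub>R v - y) powr (- p - 2) -
        (p + 2) * (((x + t *\<^sub>R v - y) \<bullet> v)\<^sup>2 * norm (x + t *\<^sub>R v - y) powr (- p - 4))\<bar> \<le> (p + 3) * \<delta> powr (- (p + 2))"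
    using sep
  proof eventually_elim
    case (elim y)
    show ?case
    proof (intro ballI conjI)
      fix t assume t: "t \<in> {a<..<b}"
      then have *: "\<delta> \<le> norm (x + t *\<^sub>R v - y)" using elim by auto
      have w: "(x - y) + t *\<^sub>R v \<noteq> 0" and eq: "\<And>t. x + t *\<^sub>R v - y = (x - y) + t *\<^sub>R v"
        using * \<delta> by (auto simp: algebra_simps)
      show "((\<lambda>t. ((x + t *\<^sub>R v - y) \<bullet> v) * norm (x + t *\<^sub>R v - y) powr (- p - 2)) has_real_derivative
        norm (x + t *\<^sub>R v - y) powr (- p - 2) -
        (p + 2) * (((x + t *\<^sub>R v - y) \<bullet> v)\<^sup>2 * norm (x + t *\<^sub>R v - y) powr (- p - 4))) (at t)"
        unfolding eq using inner_norm_powr_line_deriv[OF v w, of "p + 2"] by (simp add: algebra_simps)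
      define n where "n = norm (x + t *\<^sub>R v - y) powr (- p - 2)"
      define m where "m = ((x + t *\<^sub>R v - y) \<bullet> v)\<^sup>2 * norm (x + t *\<^sub>R v - y) powr (- p - 4)"
      have nm: "0 \<le> m" "m \<le> n" "n \<le> \<delta> powr (- (p + 2))"
        using mult_powr_norm_le(2)[OF v w, of p] powr_le_sep[OF *, of "p + 2"] p
        unfolding eq n_def m_def by (auto simp: eq)
      have "\<bar>n - (p + 2) * m\<bar> \<le> n + (p + 2) * m"
        using nm p by (auto simp: abs_le_iff)
      also have "\<dots> \<le> (p + 3) * n" using mult_left_mono[OF nm(2), of "p + 2"] p by (simp add: algebra_simps)
      also have "\<dots> \<le> (p + 3) * \<delta> powr (- (p + 2))" using nm p by (intro mult_left_mono) auto
      finally show "\<bar>norm (x + t *\<^sub>R v - y) powr (- p - 2) -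
        (p + 2) * (((x + t *\<^sub>R v - y) \<bullet> v)\<^sup>2 * norm (x + t *\<^sub>R v - y) powr (- p - 4))\<bar> \<le> (p + 3) * \<delta> powr (- (p + 2))"
        unfolding n_def m_def .
    qed
  qed
qed (rule integrable_line_inner)

end

section \<open>Rotation-invariant measures and their radial potentials\<close>

lemma orthogonal_transformation_measurable:
  fixes T :: "'a::euclidean_space \<Rightarrow> 'a"
  shows "orthogonal_transformation T \<Longrightarrow> T \<in> borel \<rightarrow>\<^sub>M borel"
  by (intro borel_measurable_continuous_onI linear_continuous_on)
    (simp add: orthogonal_transformation_linear linear_conv_bounded_linear[symmetric])

locale orth_invariant_measure = finite_measure M for M :: "(real ^ 'n) measure" +
  assumes sets_M [measurable_cong]: "sets M = sets borel"
    and invariant: "orthogonal_transformation T \<Longrightarrow> distr M borel T = M"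
begin

lemma integral_orthogonal:
  fixes g :: "real ^ 'n \<Rightarrow> real"
  assumes T: "orthogonal_transformation T" and [measurable]: "g \<in> borel_measurable borel"
  shows "(\<integral>y. g (T y) \<partial>M) = (\<integral>y. g y \<partial>M)"
proof -
  note [measurable] = orthogonal_transformation_measurable[OF T]
  have "(\<integral>y. g y \<partial>M) = (\<integral>y. g y \<partial>distr M borel T)"
    by (simp add: invariant[OF T])
  also have "\<dots> = (\<integral>y. g (T y) \<partial>M)"
    by (rule integral_distr) auto
  finally show ?thesis by simp
qed

definition axis0 :: "real ^ 'n" where "axis0 = (SOME e. e \<in> Basis)"

lemma axis0 [simp]: "axis0 \<in> Basis" "norm axis0 = 1"
  unfolding axis0_def using SOME_Basis by auto

text \<open>The exponent \<open>p\<close> is kept free because second derivatives at exponent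
  \<open>s\<close> involve the exponent \<open>s + 2\<close>; the \<open>W\<close> of the overview
  is \<open>radial (s + 2)\<close>.\<close>

definition radial :: "real \<Rightarrow> real \<Rightarrow> real" where
  "radial p r = (\<integral>y. norm (r *\<^sub>R axis0 - y) powr (- p) \<partial>M)"

lemma radial_norm: "(\<integral>y. norm (x - y) powr (- p) \<partial>M) = radial p (norm x)"
proof -
  obtain T where T: "orthogonal_transformation T" "T (norm x *\<^sub>R axis0) = x"
    by (rule orthogonal_transformation_exists[of "norm x *\<^sub>R axis0" x]) auto
  have "radial p (norm x) = (\<integral>y. norm (x - T y) powr (- p) \<partial>M)"
  proof -
    have "norm (x - T y) = norm (norm x *\<^sub>R axis0 - y)" for y
      using T by (metis orthogonal_transformation linear_diff)
    then show ?thesis by (simp add: radial_def)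
  qed
  also have "\<dots> = (\<integral>y. norm (x - y) powr (- p) \<partial>M)"
    by (rule integral_orthogonal[OF T(1)]) measurable
  finally show ?thesis by simp
qed

text \<open>Given by an integral rather than as a derivative, and likewise \<open>radial2\<close>,
  so that both are total; they are the derivatives of \<open>radial\<close> at radii kept away from
  the mass by \<open>separated\<close>.\<close>

definition radial1 :: "real \<Rightarrow> real \<Rightarrow> real" where
  "radial1 p r = - p * (\<integral>y. ((r *\<^sub>R axis0 - y) \<bullet> axis0) * norm (r *\<^sub>R axis0 - y) powr (- p - 2) \<partial>M)"

definition radial2 :: "real \<Rightarrow> real \<Rightarrow> real" where
  "radial2 p r = - p * radial (p + 2) r +
    p * (p + 2) * (\<integral>y. ((r *\<^sub>R axis0 - y) \<bullet> axis0)\<^sup>2 * norm (r *\<^sub>R axis0 - y) powr (- p - 4) \<partial>M)"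

definition separated :: "real \<Rightarrow> real \<Rightarrow> real \<Rightarrow> bool" where
  "separated a b \<delta> \<longleftrightarrow> \<delta> > 0 \<and> (AE y in M. \<forall>t\<in>{a<..<b}. \<delta> \<le> norm (t *\<^sub>R axis0 - y))"

lemma radial_deriv:
  assumes sep: "separated a b \<delta>" and r: "r \<in> {a<..<b}" and p: "p > 0"
  shows "(radial p has_real_derivative radial1 p r) (at r)"
    and "(radial1 p has_real_derivative radial2 p r) (at r)"
proof -
  have \<delta>: "\<delta> > 0" and sep': "AE y in M. \<forall>t\<in>{a<..<b}. \<delta> \<le> norm (0 + t *\<^sub>R axis0 - y)"
    using sep by (auto simp: separated_def)
  note line = finite_measure_axioms sets_M axis0(2) \<delta> p r sep'
  show "(radial p has_real_derivative radial1 p r) (at r)"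
    using line_integral_deriv1[OF line] by (simp add: radial_def[abs_def] radial1_def)
  have "(\<integral>y. norm (0 + r *\<^sub>R axis0 - y) powr (- p - 2) -
      (p + 2) * (((0 + r *\<^sub>R axis0 - y) \<bullet> axis0)\<^sup>2 * norm (0 + r *\<^sub>R axis0 - y) powr (- p - 4)) \<partial>M)
     = radial (p + 2) r - (p + 2) * (\<integral>y. ((r *\<^sub>R axis0 - y) \<bullet> axis0)\<^sup>2 * norm (r *\<^sub>R axis0 - y) powr (- p - 4) \<partial>M)"
    using integrable_line_powr[OF line r, of "p + 2"] integrable_line_inner_sq[OF line r axis0(2)] p
    by (subst Bochner_Integration.integral_diff) (simp_all add: radial_def algebra_simps)
  note val = this
  have "((\<lambda>r. - p * (\<integral>y. ((0 + r *\<^sub>R axis0 - y) \<bullet> axis0) * norm (0 + r *\<^sub>R axis0 - y) powr (- p - 2) \<partial>M)) has_real_derivative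
    - p * (radial (p + 2) r - (p + 2) * (\<integral>y. ((r *\<^sub>R axis0 - y) \<bullet> axis0)\<^sup>2 * norm (r *\<^sub>R axis0 - y) powr (- p - 4) \<partial>M))) (at r)"
    unfolding val[symmetric] by (rule DERIV_cmult) (rule line_integral_deriv2[OF line])
  then show "(radial1 p has_real_derivative radial2 p r) (at r)"
    unfolding radial1_def[abs_def] add_0
    by (rule DERIV_cong) (simp add: radial2_def right_diff_distrib)
qed

text \<open>Moving from \<open>r *\<^sub>R axis0\<close> by \<open>h\<close> in a tangential
  direction changes the radius to \<open>sqrt (r^2 + h^2)\<close>, so the tangential second
  derivative of a radial function \<open>f\<close> at \<open>h = 0\<close> is
  \<open>f'(r) / r\<close>. Differentiating under the integral instead gives the right-hand
  side.\<close>

lemma tangential_identity: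
  assumes sep: "separated a b \<delta>" and r: "r \<in> {a<..<b}" "0 \<le> a" and p: "p > 0"
    and u: "u \<in> Basis" "u \<noteq> axis0"
  shows "radial1 p r / r = - p * radial (p + 2) r +
    p * (p + 2) * (\<integral>y. (y \<bullet> u)\<^sup>2 * norm (r *\<^sub>R axis0 - y) powr (- p - 4) \<partial>M)"
proof -
  have \<delta>: "\<delta> > 0" and sep': "AE y in M. \<forall>t\<in>{a<..<b}. \<delta> \<le> norm (t *\<^sub>R axis0 - y)"
    using sep by (auto simp: separated_def)
  have r0: "r > 0" using r by auto
  have un: "norm u = 1" "axis0 \<bullet> u = 0" using u by (auto simp: inner_Basis)
  \<comment> \<open>The bound \<open>\<delta> / 2\<close> keeps the displaced point at distance
    \<open>\<delta> / 2\<close> from the mass, and \<open>b - r\<close> keeps its radius below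
    \<open>b\<close>, as \<open>\<rho> h \<le> r + \<bar>h\<bar>\<close>.\<close>
  define \<eta> where "\<eta> = min (\<delta> / 2) (min (r - a) (b - r))"
  have \<eta>: "\<eta> > 0" "\<eta> \<le> \<delta> / 2" "\<eta> \<le> r - a" "\<eta> \<le> b - r" using \<delta> r by (auto simp: \<eta>_def min_def)
  define \<rho> where "\<rho> h = sqrt (r\<^sup>2 + h\<^sup>2)" for h
  have norm_rho: "norm (r *\<^sub>R axis0 + h *\<^sub>R u) = \<rho> h" for h
  proof -
    have "u \<bullet> u = 1" "axis0 \<bullet> axis0 = 1" "u \<bullet> axis0 = 0"
      using un axis0(2) by (simp_all only: dot_square_norm inner_commute[of u axis0]) simp_all
    then show ?thesis
      using un(2) by (simp add: norm_eq_sqrt_inner \<rho>_def inner_add_left inner_add_right power2_eq_square)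
  qed
  have \<rho>_ge: "r \<le> \<rho> h" for h
    using r0 by (simp add: \<rho>_def real_le_rsqrt)
  have \<rho>_le: "\<rho> h \<le> r + \<bar>h\<bar>" for h
    unfolding norm_rho[symmetric] using norm_triangle_ineq[of "r *\<^sub>R axis0" "h *\<^sub>R u"] r0 un by simp
  have \<rho>_in: "\<rho> h \<in> {a<..<b}" if "h \<in> {-\<eta><..<\<eta>}" for h
    using \<rho>_ge[of h] \<rho>_le[of h] that \<eta> r by auto
  have sep_u: "AE y in M. \<forall>h\<in>{-\<eta><..<\<eta>}. \<delta> / 2 \<le> norm (r *\<^sub>R axis0 + h *\<^sub>R u - y)"
    using sep'
  proof eventually_elim
    case (elim y)
    show ?case
    proof
      fix h assume h: "h \<in> {-\<eta><..<\<eta>}"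
      have "\<delta> \<le> norm (r *\<^sub>R axis0 - y)" using elim r by auto
      also have "\<dots> \<le> norm (r *\<^sub>R axis0 + h *\<^sub>R u - y) + norm (h *\<^sub>R u)"
        using norm_triangle_ineq4[of "r *\<^sub>R axis0 + h *\<^sub>R u - y" "h *\<^sub>R u"] by (simp add: algebra_simps)
      finally show "\<delta> / 2 \<le> norm (r *\<^sub>R axis0 + h *\<^sub>R u - y)"
        using h \<eta> un by auto
    qed
  qed
  define H where "H h = (\<integral>y. ((r *\<^sub>R axis0 + h *\<^sub>R u - y) \<bullet> u) * norm (r *\<^sub>R axis0 + h *\<^sub>R u - y) powr (- p - 2) \<partial>M)" for h
  have d2: "\<delta> / 2 > 0" using \<delta> by simp
  have line: "finite_measure M" "sets M = sets borel" "norm u = 1" "\<delta> / 2 > 0" "p > 0"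
    using finite_measure_axioms sets_M un d2 p by auto
  have H_eq: "- p * H h = radial1 p (\<rho> h) * (h / \<rho> h)" if h: "h \<in> {-\<eta><..<\<eta>}" for h
  proof -
    have 1: "((\<lambda>h. \<integral>y. norm (r *\<^sub>R axis0 + h *\<^sub>R u - y) powr (- p) \<partial>M) has_real_derivative - p * H h) (at h)"
      using line_integral_deriv1[OF line h sep_u] by (simp add: H_def)
    have "r\<^sup>2 + h\<^sup>2 > 0" using r0 by (simp add: sum_power2_gt_zero_iff)
    then have "(\<rho> has_real_derivative h / \<rho> h) (at h)"
      unfolding \<rho>_def[abs_def]
      by (intro DERIV_cong[OF DERIV_chain2[OF DERIV_real_sqrt]] derivative_eq_intros refl) (auto simp: field_simps)
    with radial_deriv(1)[OF sep \<rho>_in[OF h] p]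
    have "((\<lambda>h. radial p (\<rho> h)) has_real_derivative radial1 p (\<rho> h) * (h / \<rho> h)) (at h)"
      by (rule DERIV_chain2)
    then have 2: "((\<lambda>h. \<integral>y. norm (r *\<^sub>R axis0 + h *\<^sub>R u - y) powr (- p) \<partial>M) has_real_derivative radial1 p (\<rho> h) * (h / \<rho> h)) (at h)"
      unfolding radial_norm norm_rho .
    show ?thesis using DERIV_unique[OF 1 2] .
  qed
  have z: "0 \<in> {-\<eta><..<\<eta>}" using \<eta> by simp
  have H0: "H 0 = 0" using H_eq[OF z] p by simp
  define T where "T = (\<integral>y. norm (r *\<^sub>R axis0 + 0 *\<^sub>R u - y) powr (- p - 2) -
      (p + 2) * (((r *\<^sub>R axis0 + 0 *\<^sub>R u - y) \<bullet> u)\<^sup>2 * norm (r *\<^sub>R axis0 + 0 *\<^sub>R u - y) powr (- p - 4)) \<partial>M)"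
  have T: "T = radial (p + 2) r - (p + 2) * (\<integral>y. (y \<bullet> u)\<^sup>2 * norm (r *\<^sub>R axis0 - y) powr (- p - 4) \<partial>M)"
  proof -
    have *: "((r *\<^sub>R axis0 + 0 *\<^sub>R u - y) \<bullet> u)\<^sup>2 = (y \<bullet> u)\<^sup>2" for y
      using un by (simp add: inner_diff_left)
    have q: "- (p + 2) = - p - 2" by simp
    have 1: "integrable M (\<lambda>y. norm (r *\<^sub>R axis0 - y) powr (- p - 2))"
      using integrable_line_powr[OF line z sep_u z, of "p + 2"] p unfolding q by simp
    have 2: "integrable M (\<lambda>y. (y \<bullet> u)\<^sup>2 * norm (r *\<^sub>R axis0 - y) powr (- p - 4))"
      using integrable_line_inner_sq[OF line z sep_u z un(1)] unfolding * by simp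
    show ?thesis
      unfolding T_def *[unfolded scaleR_zero_left add_0_right] scaleR_zero_left add_0_right radial_def q
      unfolding *[unfolded scaleR_zero_left add_0_right] using 1 2 by (subst Bochner_Integration.integral_diff) auto
  qed
  have "(H has_real_derivative T) (at 0)"
    unfolding H_def[abs_def] T_def by (rule line_integral_deriv2[OF line z sep_u])
  \<comment> \<open>As \<open>H 0 = 0\<close>, this is a difference quotient of \<open>H\<close>;
    its limit is read off twice, so \<open>radial1 p (\<rho> h) * (h / \<rho> h)\<close> need not be
    differentiated.\<close>
  then have "((\<lambda>h. H h / h) \<longlongrightarrow> T) (at 0)"
    by (simp add: has_field_derivative_iff H0)
  then have "((\<lambda>h. - p * (H h / h)) \<longlongrightarrow> - p * T) (at 0)"
    by (intro tendsto_intros)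
  moreover have "eventually (\<lambda>h. - p * (H h / h) = radial1 p (\<rho> h) / \<rho> h) (at 0)"
  proof -
    have "eventually (\<lambda>h. h \<in> {-\<eta><..<\<eta>}) (at 0)"
      using eventually_at_in_open'[of "{-\<eta><..<\<eta>}" 0] z by simp
    moreover have "eventually (\<lambda>h. h \<noteq> 0) (at (0::real))" by (simp add: eventually_at_filter)
    ultimately show ?thesis
    proof eventually_elim
      case (elim h)
      then have "- p * (H h / h) = radial1 p (\<rho> h) * (h / \<rho> h) / h"
        using H_eq[of h] by (metis times_divide_eq_right)
      then show ?case using elim by simp
    qed
  qed
  ultimately have "((\<lambda>h. radial1 p (\<rho> h) / \<rho> h) \<longlongrightarrow> - p * T) (at 0)"
    by (rule Lim_transform_eventually)
  moreover have "((\<lambda>h. radial1 p (\<rho> h) / \<rho> h) \<longlongrightarrow> radial1 p r / r) (at 0)"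
  proof -
    have \<rho>0: "\<rho> 0 = r" using r0 by (simp add: \<rho>_def)
    have c: "isCont \<rho> 0" unfolding \<rho>_def[abs_def] by (intro continuous_intros)
    have "isCont (radial1 p) (\<rho> 0)"
      unfolding \<rho>0 using radial_deriv(2)[OF sep r(1) p] by (rule DERIV_isCont)
    from isCont_o2[OF c this] have "isCont (\<lambda>h. radial1 p (\<rho> h)) 0" .
    then have "isCont (\<lambda>h. radial1 p (\<rho> h) / \<rho> h) 0"
      using c r0 \<rho>0 by (intro continuous_intros) auto
    then show ?thesis unfolding isCont_def \<rho>0 .
  qed
  ultimately have "radial1 p r / r = - p * T"
    by (rule LIM_unique[symmetric])
  then show ?thesis unfolding T by (simp add: right_diff_distrib)
qed

text \<open>The Laplacian of \<open>norm x powr (- p)\<close> integrated over the measure: one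
  radial second derivative plus \<open>CARD('n) - 1\<close> equal tangential ones. The squares of
  the coordinates add up to the squared norm, which lowers the exponent \<open>p + 4\<close> to
  \<open>p + 2\<close>.\<close>

lemma radial_laplacian:
  assumes sep: "separated a b \<delta>" and r: "r \<in> {a<..<b}" "0 \<le> a" and p: "p > 0"
  shows "radial2 p r + (real CARD('n) - 1) / r * radial1 p r = p * (p + 2 - real CARD('n)) * radial (p + 2) r"
proof -
  have \<delta>: "\<delta> > 0" and sep': "AE y in M. \<forall>t\<in>{a<..<b}. \<delta> \<le> norm (0 + t *\<^sub>R axis0 - y)"
    using sep by (auto simp: separated_def)
  note line = finite_measure_axioms sets_M axis0(2) \<delta> p r(1) sep'
  let ?I = "\<lambda>u. \<integral>y. ((r *\<^sub>R axis0 - y) \<bullet> u)\<^sup>2 * norm (r *\<^sub>R axis0 - y) powr (- p - 4) \<partial>M"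
  have int: "integrable M (\<lambda>y. ((r *\<^sub>R axis0 - y) \<bullet> u)\<^sup>2 * norm (r *\<^sub>R axis0 - y) powr (- p - 4))" if "u \<in> Basis" for u
    using integrable_line_inner_sq[OF line r(1), of u] that by simp
  have tang: "radial1 p r / r = - p * radial (p + 2) r + p * (p + 2) * ?I u" if "u \<in> Basis - {axis0}" for u
  proof -
    have "axis0 \<bullet> u = 0" using that by (auto simp: inner_Basis)
    then show ?thesis
      using tangential_identity[OF sep r p, of u] that by (simp add: inner_diff_left)
  qed
  have "(real CARD('n) - 1) / r * radial1 p r = (\<Sum>u\<in>Basis - {axis0}. radial1 p r / r)"
    by (simp add: of_nat_diff Suc_leI)
  also have "\<dots> = (\<Sum>u\<in>Basis - {axis0}. - p * radial (p + 2) r + p * (p + 2) * ?I u)"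
    by (rule sum.cong) (use tang in auto)
  also have "\<dots> = (real CARD('n) - 1) * (- p * radial (p + 2) r) + p * (p + 2) * (\<Sum>u\<in>Basis - {axis0}. ?I u)"
    by (simp add: sum_subtractf sum_distrib_left of_nat_diff Suc_leI)
  finally have 1: "(real CARD('n) - 1) / r * radial1 p r =
    (real CARD('n) - 1) * (- p * radial (p + 2) r) + p * (p + 2) * (\<Sum>u\<in>Basis - {axis0}. ?I u)" .
  have "?I axis0 + (\<Sum>u\<in>Basis - {axis0}. ?I u) = (\<Sum>u\<in>Basis. ?I u)"
    by (subst (2) sum.remove[of _ axis0]) auto
  also have "\<dots> = (\<integral>y. (\<Sum>u\<in>Basis. ((r *\<^sub>R axis0 - y) \<bullet> u)\<^sup>2 * norm (r *\<^sub>R axis0 - y) powr (- p - 4)) \<partial>M)"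
    by (rule Bochner_Integration.integral_sum[symmetric]) (rule int)
  also have "\<dots> = radial (p + 2) r"
    unfolding radial_def
  proof (rule Bochner_Integration.integral_cong[OF refl])
    fix y :: "real ^ 'n"
    let ?w = "r *\<^sub>R axis0 - y"
    have "(\<Sum>u\<in>Basis. (?w \<bullet> u)\<^sup>2 * norm ?w powr (- p - 4)) = (norm ?w)\<^sup>2 * norm ?w powr (- p - 4)"
      unfolding power2_norm_eq_inner euclidean_inner[of ?w ?w] by (simp add: sum_distrib_right power2_eq_square)
    also have "\<dots> = norm ?w powr (- (p + 2))"
    proof -
      have e: "2 + (- p - 4) = - (p + 2)" by simp
      show ?thesis using powr_add[of "norm ?w" 2 "- p - 4", unfolded e] by (cases "?w = 0") auto
    qed
    finally show "(\<Sum>u\<in>Basis. (?w \<bullet> u)\<^sup>2 * norm ?w powr (- p - 4)) = norm ?w powr (- (p + 2))" .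
  qed
  finally have 2: "(\<Sum>u\<in>Basis - {axis0}. ?I u) = radial (p + 2) r - ?I axis0" by simp
  show ?thesis
    unfolding 1 2 radial2_def by (simp add: algebra_simps)
qed

lemma radial_pos:
  assumes "measure M UNIV > 0" and sep: "separated a b \<delta>" and r: "r \<in> {a<..<b}" and p: "p > 0"
  shows "radial p r > 0"
proof -
  have \<delta>: "\<delta> > 0" and sep': "AE y in M. \<forall>t\<in>{a<..<b}. \<delta> \<le> norm (0 + t *\<^sub>R axis0 - y)"
    using sep by (auto simp: separated_def)
  note line = finite_measure_axioms sets_M axis0(2) \<delta> p r sep'
  have int: "integrable M (\<lambda>y. norm (r *\<^sub>R axis0 - y) powr (- p))"
    using integrable_line_powr[OF line r p] by simp
  have "radial p r \<noteq> 0"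
  proof
    assume "radial p r = 0"
    then have "AE y in M. norm (r *\<^sub>R axis0 - y) powr (- p) = 0"
      unfolding radial_def by (subst (asm) integral_nonneg_eq_0_iff_AE[OF int]) auto
    with sep' have "AE y in M. False"
      by eventually_elim (use \<delta> r in force)
    then show False
      using assms(1) sets_eq_imp_space_eq[OF sets_M]
      by (simp add: eventually_False ae_filter_eq_bot_iff measure_def)
  qed
  moreover have "radial p r \<ge> 0" unfolding radial_def by (intro integral_nonneg_AE) auto
  ultimately show ?thesis by linarith
qed

end

section \<open>Potentials inside a ball free of mass\<close>

locale outer_measure = orth_invariant_measure M for M :: "(real ^ 'n) measure" +
  fixes R :: real
  assumes R: "R > 0" and outer: "AE y in M. R \<le> norm y"
begin

text \<open>The interval is symmetric about 0, so the centre is an interior point and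
  \<open>radial\<close> is differentiable there; the monotonicity arguments below start at
  0.\<close>

lemma separated_outer:
  assumes "0 < r" "r < R"
  shows "separated (- r) r (R - r)"
  unfolding separated_def
proof (intro conjI)
  show "AE y in M. \<forall>t\<in>{- r<..<r}. R - r \<le> norm (t *\<^sub>R axis0 - y)"
    using outer
  proof eventually_elim
    case (elim y)
    show ?case
    proof
      fix t assume t: "t \<in> {- r<..<r}"
      have "norm y - norm (t *\<^sub>R axis0) \<le> norm (t *\<^sub>R axis0 - y)"
        by (metis norm_minus_commute norm_triangle_ineq2)
      then show "R - r \<le> norm (t *\<^sub>R axis0 - y)" using elim t by auto
    qed
  qed
qed (use assms in auto)

lemma outer_interval:
  assumes "0 \<le> r" "r < R"
  obtains r' where "r < r'" "r' < R" "separated (- r') r' (R - r')" "r \<in> {- r'<..<r'}"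
proof -
  obtain r' where "r < r'" "r' < R" using assms dense by blast
  then show thesis using separated_outer[of r'] that[of r'] assms by auto
qed

lemma separated_mono: "separated a b \<delta> \<Longrightarrow> a \<le> a' \<Longrightarrow> b' \<le> b \<Longrightarrow> separated a' b' \<delta>"
  unfolding separated_def by (elim conjE) (auto elim!: eventually_mono)

lemma outer_facts:
  assumes r: "0 \<le> r" "r < R" and p: "p > 0"
  shows "(radial p has_real_derivative radial1 p r) (at r)"
    and "(radial1 p has_real_derivative radial2 p r) (at r)"
    and "0 < r \<Longrightarrow> radial2 p r + (real CARD('n) - 1) / r * radial1 p r = p * (p + 2 - real CARD('n)) * radial (p + 2) r"
    and "0 \<le> radial p r"
    and "measure M UNIV > 0 \<Longrightarrow> radial p r > 0"
proof -
  obtain r' where r': "r < r'" "r' < R" "separated (- r') r' (R - r')" "r \<in> {- r'<..<r'}"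
    using outer_interval[OF r] .
  show "(radial p has_real_derivative radial1 p r) (at r)"
    and "(radial1 p has_real_derivative radial2 p r) (at r)"
    using radial_deriv[OF r'(3,4) p] by auto
  \<comment> \<open>The Laplace identity divides by \<open>r\<close> and requires a nonnegative left
    end, hence the passage to the subinterval starting at 0.\<close>
  show "radial2 p r + (real CARD('n) - 1) / r * radial1 p r = p * (p + 2 - real CARD('n)) * radial (p + 2) r" if "0 < r"
    using that r' p by (intro radial_laplacian[of 0 r' "R - r'"] separated_mono[OF r'(3)]) auto
  show "0 \<le> radial p r" unfolding radial_def by (intro integral_nonneg_AE) auto
  show "radial p r > 0" if "measure M UNIV > 0"
    using radial_pos[OF that r'(3,4) p] .
qed

text \<open>The Laplace identity in divergence form: the factor \<open>r ^ (CARD('n) - 1)\<close>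
  absorbs the first-order term.\<close>

lemma outer_weighted_deriv:
  assumes r: "0 < r" "r < R" and p: "p > 0"
  shows "((\<lambda>r. r ^ (CARD('n) - 1) * radial1 p r) has_real_derivative
    r ^ (CARD('n) - 1) * (p * (p + 2 - real CARD('n)) * radial (p + 2) r)) (at r)"
proof -
  obtain k where k: "CARD('n) = Suc k" by (cases "CARD('n)") auto
  have "((\<lambda>r. r ^ k * radial1 p r) has_real_derivative (real k * r ^ (k - 1)) * radial1 p r + radial2 p r * r ^ k) (at r)"
    using outer_facts(2)[of r p] r p by (auto intro!: derivative_eq_intros)
  moreover have "(real k * r ^ (k - 1)) * radial1 p r + radial2 p r * r ^ k =
      r ^ k * (radial2 p r + real k / r * radial1 p r)"
  proof (cases k)
    case (Suc j)
    then show ?thesis using r by (simp add: field_simps)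
  qed (simp)
  moreover have "radial2 p r + real k / r * radial1 p r = p * (p + 2 - real CARD('n)) * radial (p + 2) r"
    using outer_facts(3)[of r p] r p k by simp
  ultimately show ?thesis using k by simp
qed

text \<open>The flux \<open>r ^ (CARD('n) - 1) * radial1 p r\<close> is nondecreasing and vanishes
  at 0, where the power is 0 because \<open>CARD('n) \<ge> 2\<close>.\<close>

lemma outer_radial1_nonneg_pos:
  assumes N: "CARD('n) \<ge> 2" and r: "0 < r" "r < R" and p: "p > 0" "p + 2 \<ge> real CARD('n)"
  shows "radial1 p r \<ge> 0"
proof -
  let ?g = "\<lambda>r. r ^ (CARD('n) - 1) * radial1 p r"
  have "?g 0 \<le> ?g r"
  proof (rule DERIV_nonneg_imp_increasing_open[where f="?g"])
    show "\<exists>y. (?g has_real_derivative y) (at t) \<and> 0 \<le> y" if "0 < t" "t < r" for t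
    proof (intro exI conjI)
      show "(?g has_real_derivative t ^ (CARD('n) - 1) * (p * (p + 2 - real CARD('n)) * radial (p + 2) t)) (at t)"
        using that r p by (intro outer_weighted_deriv) auto
      show "0 \<le> t ^ (CARD('n) - 1) * (p * (p + 2 - real CARD('n)) * radial (p + 2) t)"
        using outer_facts(4)[of t "p + 2"] that r p by simp
    qed
    have "isCont (radial1 p) t" if "t \<in> {0..r}" for t
      using outer_facts(2)[of t p] that r p by (auto intro: DERIV_isCont)
    then show "continuous_on {0..r} ?g"
      by (intro continuous_intros continuous_at_imp_continuous_on) auto
  qed (use r in auto)
  moreover have z: "(0::real) ^ (CARD('n) - 1) = 0" using N by (simp add: zero_power)
  ultimately have "0 \<le> r ^ (CARD('n) - 1) * radial1 p r" by (simp only: z mult_zero_left)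
  moreover have "0 < r ^ (CARD('n) - 1)" using r by simp
  ultimately show ?thesis by (metis zero_le_mult_iff not_le)
qed

lemma outer_radial2_ge:
  assumes N: "CARD('n) \<ge> 2" and r: "0 < r" "r < R" and p: "p > 0" "p + 2 \<ge> real CARD('n)"
  shows "radial2 p r \<ge> p * (p + 2 - real CARD('n)) / real CARD('n) * radial (p + 2) r"
proof -
  define n where "n = real CARD('n)"
  define c where "c = p * (p + 2 - n)"
  have n: "n \<ge> 2" and c: "c \<ge> 0" using N p by (auto simp: n_def c_def)
  let ?k = "CARD('n) - 1"
  \<comment> \<open>In the derivative of \<open>h\<close> the two terms
    \<open>c * t ^ (CARD('n) - 1) * radial (p + 2) t\<close> cancel. What remains is a nonnegative
    multiple of \<open>radial1 (p + 2) t\<close>, and the previous lemma applies with exponent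
    \<open>p + 2\<close>.\<close>
  define h where "h = (\<lambda>t. c / n * t ^ CARD('n) * radial (p + 2) t - t ^ ?k * radial1 p t)"
  have "h 0 \<le> h r"
  proof (rule DERIV_nonneg_imp_increasing_open[where f=h])
    show "\<exists>y. (h has_real_derivative y) (at t) \<and> 0 \<le> y" if t: "0 < t" "t < r" for t
    proof (intro exI conjI)
      have 1: "((\<lambda>t. c / n * t ^ CARD('n) * radial (p + 2) t) has_real_derivative
        c * t ^ ?k * radial (p + 2) t + c / n * t ^ CARD('n) * radial1 (p + 2) t) (at t)"
      proof (rule DERIV_cong[OF DERIV_mult[OF DERIV_cmult[OF DERIV_pow] outer_facts(1)[of t "p + 2"]]])
        show "c / n * (real CARD('n) * t ^ (CARD('n) - Suc 0)) * radial (p + 2) t + radial1 (p + 2) t * (c / n * t ^ CARD('n)) =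
          c * t ^ ?k * radial (p + 2) t + c / n * t ^ CARD('n) * radial1 (p + 2) t"
          using n unfolding n_def[symmetric] by simp
      qed (use t r p in auto)
      show "(h has_real_derivative (c * t ^ ?k * radial (p + 2) t + c / n * t ^ CARD('n) * radial1 (p + 2) t)
          - t ^ ?k * (c * radial (p + 2) t)) (at t)"
        unfolding h_def c_def n_def
        by (rule DERIV_diff[OF 1[unfolded c_def n_def] outer_weighted_deriv]) (use t r p in auto)
      have "0 \<le> radial1 (p + 2) t"
        using t r p N by (intro outer_radial1_nonneg_pos) auto
      then show "0 \<le> (c * t ^ ?k * radial (p + 2) t + c / n * t ^ CARD('n) * radial1 (p + 2) t) - t ^ ?k * (c * radial (p + 2) t)"
        using c n t by simp
    qed
    have "isCont (radial1 p) t" "isCont (radial (p + 2)) t" if "t \<in> {0..r}" for t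
      using outer_facts(2)[of t p] outer_facts(1)[of t "p + 2"] that r p by (auto intro: DERIV_isCont)
    then show "continuous_on {0..r} h"
      unfolding h_def by (intro continuous_intros continuous_at_imp_continuous_on) auto
  qed (use r in auto)
  moreover have "h 0 = 0"
  proof -
    have z: "(0::real) ^ (CARD('n) - 1) = 0" "(0::real) ^ CARD('n) = 0" using N by (simp_all add: zero_power)
    show ?thesis unfolding h_def z by simp
  qed
  moreover have "r ^ CARD('n) = r ^ ?k * r"
    using power_Suc2[of r "CARD('n) - 1"] by (simp del: power_Suc)
  ultimately have "0 \<le> r ^ ?k * (c / n * r * radial (p + 2) r - radial1 p r)"
    by (simp add: h_def algebra_simps)
  moreover have "0 < r ^ ?k" using r by simp
  ultimately have "radial1 p r \<le> c / n * r * radial (p + 2) r"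
    by (metis zero_le_mult_iff not_le diff_ge_0_iff_ge)
  \<comment> \<open>In the Laplace identity the first-order term uses up at most the fraction
    \<open>(n - 1) / n\<close> of the right-hand side; the fraction \<open>1 / n\<close> is left for
    \<open>radial2\<close>.\<close>
  then have "(n - 1) / r * radial1 p r \<le> (n - 1) / r * (c / n * r * radial (p + 2) r)"
    using r n by (intro mult_left_mono) auto
  also have "\<dots> = c * radial (p + 2) r - c / n * radial (p + 2) r"
    using r n by (simp add: field_simps)
  finally show ?thesis
    using outer_facts(3)[of r p] r p unfolding c_def n_def by linarith
qed

end

section \<open>Potentials outside a ball carrying all the mass\<close>

locale inner_measure = orth_invariant_measure M for M :: "(real ^ 'n) measure" +
  fixes R :: real
  assumes R: "R \<ge> 0" and inner: "AE y in M. norm y \<le> R"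
begin

lemma separated_inner:
  assumes "R < r"
  shows "separated r (r + 2) (r - R)"
  unfolding separated_def
proof (intro conjI)
  show "AE y in M. \<forall>t\<in>{r<..<r + 2}. r - R \<le> norm (t *\<^sub>R axis0 - y)"
    using inner
  proof eventually_elim
    case (elim y)
    show ?case
    proof
      fix t assume t: "t \<in> {r<..<r + 2}"
      have "norm (t *\<^sub>R axis0) - norm y \<le> norm (t *\<^sub>R axis0 - y)"
        by (rule norm_triangle_ineq2)
      then show "r - R \<le> norm (t *\<^sub>R axis0 - y)" using elim t R assms by auto
    qed
  qed
qed (use assms in auto)

text \<open>Almost every mass point has axis component at most \<open>R < r\<close>, so moving
  outwards increases its distance. Hence \<open>radial1 p r \<le> 0\<close>, and dropping this term
  from the Laplace identity bounds \<open>radial2\<close> from below.\<close>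

lemma inner_facts:
  assumes r: "R < r" and p: "p > 0"
  shows "(radial p has_real_derivative radial1 p r) (at r)"
    and "(radial1 p has_real_derivative radial2 p r) (at r)"
    and "radial2 p r + (real CARD('n) - 1) / r * radial1 p r = p * (p + 2 - real CARD('n)) * radial (p + 2) r"
    and "radial1 p r \<le> 0"
    and "radial2 p r \<ge> p * (p + 2 - real CARD('n)) * radial (p + 2) r"
    and "0 \<le> radial p r"
    and "measure M UNIV > 0 \<Longrightarrow> radial p r > 0"
proof -
  \<comment> \<open>A left end above \<open>R\<close> that puts \<open>r\<close> into the window of
    length 2 of \<open>separated_inner\<close>; the length itself is arbitrary.\<close>
  define r' where "r' = max ((R + r) / 2) (r - 1)"
  have r': "R < r'" "r \<in> {r'<..<r' + 2}" "0 \<le> r'" using r R by (auto simp: r'_def less_max_iff_disj le_max_iff_disj)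
  note sep = separated_inner[OF r'(1)]
  show "(radial p has_real_derivative radial1 p r) (at r)"
    and "(radial1 p has_real_derivative radial2 p r) (at r)"
    using radial_deriv[OF sep r'(2) p] by auto
  show lap: "radial2 p r + (real CARD('n) - 1) / r * radial1 p r = p * (p + 2 - real CARD('n)) * radial (p + 2) r"
    by (rule radial_laplacian[OF sep r'(2,3) p])
  have "0 \<le> (\<integral>y. ((r *\<^sub>R axis0 - y) \<bullet> axis0) * norm (r *\<^sub>R axis0 - y) powr (- p - 2) \<partial>M)"
  proof (rule integral_nonneg_AE)
    show "AE y in M. 0 \<le> ((r *\<^sub>R axis0 - y) \<bullet> axis0) * norm (r *\<^sub>R axis0 - y) powr (- p - 2)"
      using inner
    proof eventually_elim
      case (elim y)
      have "y \<bullet> axis0 \<le> norm y" using norm_cauchy_schwarz[of y axis0] by simp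
      then have "0 \<le> (r *\<^sub>R axis0 - y) \<bullet> axis0" using elim r by (simp add: inner_diff_left)
      then show ?case by simp
    qed
  qed
  then show r1: "radial1 p r \<le> 0"
    using p by (simp add: radial1_def)
  have "(real CARD('n) - 1) / r * radial1 p r \<le> 0"
    using r1 r R by (intro mult_nonneg_nonpos divide_nonneg_pos) (auto simp: Suc_leI)
  then show "radial2 p r \<ge> p * (p + 2 - real CARD('n)) * radial (p + 2) r"
    using lap by linarith
  show "0 \<le> radial p r" unfolding radial_def by (intro integral_nonneg_AE) auto
  show "radial p r > 0" if "measure M UNIV > 0"
    using radial_pos[OF that sep r'(2) p] .
qed

end

section \<open>Potentials in gaps of the support\<close>

text \<open>Derivatives are demanded in the open interval only, since at the ends of a gap only
  continuity will be known. The first derivative is compared at two mean value points, one on either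
  side of \<open>x\<close>.\<close>

lemma strictly_convex_ineq:
  fixes f :: "real \<Rightarrow> real"
  assumes ab: "a < x" "x < b" and cont: "continuous_on {a..b} f"
    and d1: "\<And>t. a < t \<Longrightarrow> t < b \<Longrightarrow> (f has_real_derivative f1 t) (at t)"
    and d2: "\<And>t. a < t \<Longrightarrow> t < b \<Longrightarrow> (f1 has_real_derivative f2 t) (at t)"
    and pos: "\<And>t. a < t \<Longrightarrow> t < b \<Longrightarrow> 0 < f2 t"
  shows "f x < ((b - x) * f a + (x - a) * f b) / (b - a)"
proof -
  have diff: "f differentiable (at t)" if "a < t" "t < b" for t
    using d1[OF that] unfolding real_differentiable_def by blast
  obtain \<xi> where \<xi>: "a < \<xi>" "\<xi> < x" "f x - f a = (x - a) * f1 \<xi>"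
  proof -
    have "\<exists>l z. a < z \<and> z < x \<and> (f has_real_derivative l) (at z) \<and> f x - f a = (x - a) * l"
      using ab by (intro MVT continuous_on_subset[OF cont]) (use ab in \<open>auto intro: diff\<close>)
    then obtain l z where z: "a < z" "z < x" "(f has_real_derivative l) (at z)" "f x - f a = (x - a) * l" by blast
    moreover have "l = f1 z" using DERIV_unique[OF z(3) d1] z ab by simp
    ultimately show thesis using that by simp
  qed
  obtain \<zeta> where \<zeta>: "x < \<zeta>" "\<zeta> < b" "f b - f x = (b - x) * f1 \<zeta>"
  proof -
    have "\<exists>l z. x < z \<and> z < b \<and> (f has_real_derivative l) (at z) \<and> f b - f x = (b - x) * l"
      using ab by (intro MVT continuous_on_subset[OF cont]) (use ab in \<open>auto intro: diff\<close>)
    then obtain l z where z: "x < z" "z < b" "(f has_real_derivative l) (at z)" "f b - f x = (b - x) * l" by blast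
    moreover have "l = f1 z" using DERIV_unique[OF z(3) d1] z ab by simp
    ultimately show thesis using that by simp
  qed
  have "f1 \<xi> < f1 \<zeta>"
  proof (rule DERIV_pos_imp_increasing[where f=f1])
    show "\<xi> < \<zeta>" using \<xi> \<zeta> by simp
    show "\<exists>y. (f1 has_real_derivative y) (at t) \<and> 0 < y" if "\<xi> \<le> t" "t \<le> \<zeta>" for t
      using d2[of t] pos[of t] that \<xi> \<zeta> by auto
  qed
  then have "(b - x) * (x - a) * f1 \<xi> < (b - x) * (x - a) * f1 \<zeta>"
    using ab by (intro mult_strict_left_mono) auto
  then have "(b - x) * (f x - f a) < (x - a) * (f b - f x)"
    unfolding \<xi>(3) \<zeta>(3) by (simp add: mult_ac)
  then have "f x * (b - a) < (b - x) * f a + (x - a) * f b"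
    by (simp add: algebra_simps)
  then show ?thesis using ab by (simp add: pos_less_divide_eq)
qed

context orth_invariant_measure
begin

text \<open>A set described through the norm is itself invariant; this permits splitting the measure
  at a gap into two of the same kind.\<close>

lemma orth_invariant_restrict:
  assumes [measurable]: "Measurable.pred borel P"
  shows "orth_invariant_measure (density M (indicator {y. P (norm y)}))"
proof -
  let ?S = "{y :: real ^ 'n. P (norm y)}"
  have [measurable]: "?S \<in> sets borel" by measurable
  interpret D: finite_measure "density M (indicator ?S)"
    using emeasure_finite[of ?S] sets_M sets_eq_imp_space_eq[OF sets_M]
    by (intro finite_measureI) (simp add: emeasure_density)
  show ?thesis
  proof
    show "sets (density M (indicator ?S)) = sets borel" by (simp add: sets_M)
    fix T :: "real ^ 'n \<Rightarrow> real ^ 'n" assume T: "orthogonal_transformation T"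
    note [measurable] = orthogonal_transformation_measurable[OF T]
    show "distr (density M (indicator ?S)) borel T = density M (indicator ?S)"
    proof (rule measure_eqI)
      fix A assume "A \<in> sets (distr (density M (indicator ?S)) borel T)"
      then have [measurable]: "A \<in> sets borel" by simp
      have "emeasure (distr (density M (indicator ?S)) borel T) A = (\<integral>\<^sup>+y. indicator A y \<partial>distr (density M (indicator ?S)) borel T)"
        by simp
      also have "\<dots> = (\<integral>\<^sup>+y. indicator A (T y) \<partial>density M (indicator ?S))"
        by (rule nn_integral_distr) measurable
      also have "\<dots> = (\<integral>\<^sup>+y. indicator ?S y * indicator A (T y) \<partial>M)"
        by (rule nn_integral_density) measurable
      also have "\<dots> = (\<integral>\<^sup>+y. indicator ?S (T y) * indicator A (T y) \<partial>M)"
        using T by (intro nn_integral_cong) (simp add: orthogonal_transformation indicator_def)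
      also have "\<dots> = (\<integral>\<^sup>+y. indicator ?S y * indicator A y \<partial>distr M borel T)"
        by (rule nn_integral_distr[symmetric]) measurable
      also have "\<dots> = emeasure (density M (indicator ?S)) A"
        unfolding invariant[OF T] by (rule emeasure_density[symmetric]) (auto simp: sets_M)
      finally show "emeasure (distr (density M (indicator ?S)) borel T) A = emeasure (density M (indicator ?S)) A" .
    qed (simp add: sets_M)
  qed
qed

lemma integrable_radial:
  assumes "separated a b \<delta>" "r \<in> {a<..<b}" "p > 0"
  shows "integrable M (\<lambda>y. norm (r *\<^sub>R axis0 - y) powr (- p))"
proof -
  have \<delta>: "\<delta> > 0" and sep': "AE y in M. \<forall>t\<in>{a<..<b}. \<delta> \<le> norm (0 + t *\<^sub>R axis0 - y)"
    using assms by (auto simp: separated_def)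
  from integrable_line_powr[OF finite_measure_axioms sets_M axis0(2) \<delta> assms(3,2) sep' assms(2,3)]
  show ?thesis by simp
qed

lemma potential_radial:
  assumes "AE y in M. y \<noteq> r *\<^sub>R axis0" "integrable M (\<lambda>y. norm (r *\<^sub>R axis0 - y) powr (- s))"
  shows "potential s M (r *\<^sub>R axis0) = ennreal (radial s r)"
proof -
  have "potential s M (r *\<^sub>R axis0) = (\<integral>\<^sup>+y. ennreal (norm (r *\<^sub>R axis0 - y) powr (- s)) \<partial>M)"
    unfolding potential_def using assms(1)
    by (intro nn_integral_cong_AE) (auto elim!: eventually_mono simp: riesz_kernel_def dist_norm)
  also have "\<dots> = ennreal (radial s r)"
    unfolding radial_def by (rule nn_integral_eq_integral[OF assms(2)]) auto
  finally show ?thesis .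
qed

lemma potential_radial_sep:
  assumes "separated a b \<delta>" "r \<in> {a<..<b}" "s > 0"
  shows "potential s M (r *\<^sub>R axis0) = ennreal (radial s r)"
proof (rule potential_radial)
  have "AE y in M. \<forall>t\<in>{a<..<b}. \<delta> \<le> norm (t *\<^sub>R axis0 - y)" "\<delta> > 0"
    using assms by (auto simp: separated_def)
  then show "AE y in M. y \<noteq> r *\<^sub>R axis0"
    by (auto elim!: eventually_mono dest!: bspec[OF _ assms(2)])
qed (rule integrable_radial[OF assms])

text \<open>The link from extended to real potentials at points of the support: finiteness excludes
  an atom at \<open>x\<close> and gives integrability of the kernel.\<close>

lemma potential_finite:
  assumes "potential s M x < \<infinity>"
  shows "AE y in M. y \<noteq> x" "integrable M (\<lambda>y. norm (x - y) powr (- s))"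
proof -
  have "AE y in M. riesz_kernel s x y \<noteq> \<infinity>"
    using assms unfolding potential_def by (intro nn_integral_noteq_infinite) auto
  then show ae: "AE y in M. y \<noteq> x"
    by eventually_elim (auto simp: riesz_kernel_def)
  have "(\<integral>\<^sup>+y. ennreal (norm (x - y) powr (- s)) \<partial>M) = potential s M x"
    unfolding potential_def using ae
    by (intro nn_integral_cong_AE) (auto elim!: eventually_mono simp: riesz_kernel_def dist_norm)
  then show "integrable M (\<lambda>y. norm (x - y) powr (- s))"
    using assms by (intro integrableI_bounded) auto
qed

lemma potential_radial_finite:
  assumes "potential s M (r *\<^sub>R axis0) < \<infinity>"
  shows "potential s M (r *\<^sub>R axis0) = ennreal (radial s r)"
  using potential_radial potential_finite[OF assms] by blast

text \<open>At the boundary of the support the kernel is dominated, since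
  \<open>|r\<^sub>0 e - y| \<le> |r e - y| + |r - r\<^sub>0| \<le> 2 |r e - y|\<close>.\<close>

lemma radial_tendsto_boundary:
  assumes fin: "potential s M (r0 *\<^sub>R axis0) < \<infinity>" and s: "s > 0"
    and T: "AE y in M. \<forall>r\<in>T. \<bar>r - r0\<bar> \<le> norm (r *\<^sub>R axis0 - y)"
  shows "(radial s \<longlongrightarrow> radial s r0) (at r0 within T)"
  unfolding tendsto_at_iff_sequentially
proof (intro allI impI)
  fix X assume X: "\<forall>i. X i \<in> T - {r0}" "X \<longlonglongrightarrow> r0"
  note ae = potential_finite(1)[OF fin] and int = potential_finite(2)[OF fin]
  have "(\<lambda>i. \<integral>y. norm (X i *\<^sub>R axis0 - y) powr (- s) \<partial>M) \<longlonglongrightarrow> (\<integral>y. norm (r0 *\<^sub>R axis0 - y) powr (- s) \<partial>M)"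
  proof (rule integral_dominated_convergence[where w="\<lambda>y. 2 powr s * norm (r0 *\<^sub>R axis0 - y) powr (- s)"])
    show "integrable M (\<lambda>y. 2 powr s * norm (r0 *\<^sub>R axis0 - y) powr (- s))" using int by simp
    show "AE y in M. (\<lambda>i. norm (X i *\<^sub>R axis0 - y) powr (- s)) \<longlonglongrightarrow> norm (r0 *\<^sub>R axis0 - y) powr (- s)"
      using ae
    proof eventually_elim
      case (elim y)
      then show ?case
        by (intro tendsto_powr tendsto_norm tendsto_diff tendsto_scaleR X(2) tendsto_const) auto
    qed
    show "AE y in M. norm (norm (X i *\<^sub>R axis0 - y) powr (- s)) \<le> 2 powr s * norm (r0 *\<^sub>R axis0 - y) powr (- s)" for i
      using ae T
    proof eventually_elim
      case (elim y)
      have "norm (r0 *\<^sub>R axis0 - y) \<le> norm (X i *\<^sub>R axis0 - y) + norm ((r0 - X i) *\<^sub>R axis0)"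
        using norm_triangle_ineq[of "X i *\<^sub>R axis0 - y" "(r0 - X i) *\<^sub>R axis0"] by (simp add: algebra_simps)
      also have "norm ((r0 - X i) *\<^sub>R axis0) = \<bar>X i - r0\<bar>" by simp
      also have "\<dots> \<le> norm (X i *\<^sub>R axis0 - y)"
        using elim X(1) by simp
      finally have "norm (r0 *\<^sub>R axis0 - y) / 2 \<le> norm (X i *\<^sub>R axis0 - y)" by simp
      then have "norm (X i *\<^sub>R axis0 - y) powr (- s) \<le> (norm (r0 *\<^sub>R axis0 - y) / 2) powr (- s)"
        using elim s by (intro powr_mono2') auto
      also have "\<dots> = 2 powr s * norm (r0 *\<^sub>R axis0 - y) powr (- s)"
        by (simp add: powr_divide powr_minus divide_simps)
      finally show ?case by simp
    qed
  qed measurable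
  then show "(radial s \<circ> X) \<longlonglongrightarrow> radial s r0" by (simp add: comp_def radial_def)
qed

lemma norm_scaleR_axis0_diff: "\<bar>\<bar>r\<bar> - norm y\<bar> \<le> norm (r *\<^sub>R axis0 - y)"
  using norm_triangle_ineq3[of "r *\<^sub>R axis0" y] by simp

text \<open>The domination hypothesis in terms of radii: it suffices that \<open>r\<close> is at
  least as close to \<open>r0\<close> as to every radius allowed by \<open>P\<close>.\<close>

lemma radial_tendsto_boundary':
  assumes fin: "potential s M (r0 *\<^sub>R axis0) < \<infinity>" and s: "s > 0"
    and P: "AE y in M. P (norm y)" and T: "\<And>r \<rho>. r \<in> T \<Longrightarrow> P \<rho> \<Longrightarrow> 0 \<le> r \<and> \<bar>r - r0\<bar> \<le> \<bar>r - \<rho>\<bar>"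
  shows "(radial s \<longlongrightarrow> radial s r0) (at r0 within T)"
proof (rule radial_tendsto_boundary[OF fin s])
  show "AE y in M. \<forall>r\<in>T. \<bar>r - r0\<bar> \<le> norm (r *\<^sub>R axis0 - y)"
    using P
  proof eventually_elim
    case (elim y)
    show ?case
    proof
      fix r assume "r \<in> T"
      then have "0 \<le> r" "\<bar>r - r0\<bar> \<le> \<bar>r - norm y\<bar>" using T elim by auto
      then show "\<bar>r - r0\<bar> \<le> norm (r *\<^sub>R axis0 - y)"
        using norm_scaleR_axis0_diff[of r y] by simp
    qed
  qed
qed

lemma gap_split:
  assumes gap: "AE y in M. norm y \<le> r1 \<or> r2 \<le> norm y" and r12: "0 \<le> r1" "r1 < r2"
  defines "N1 \<equiv> density M (indicator {y. norm y \<le> r1})" and "N2 \<equiv> density M (indicator {y. \<not> norm y \<le> r1})"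
  shows "inner_measure N1 r1" "outer_measure N2 r2"
    and "\<And>r p. r1 < r \<Longrightarrow> r < r2 \<Longrightarrow> p > 0 \<Longrightarrow> radial p r =
      orth_invariant_measure.radial N1 p r + orth_invariant_measure.radial N2 p r"
    and "measure M UNIV = measure N1 UNIV + measure N2 UNIV"
    and "\<And>r. r1 < r \<Longrightarrow> r < r2 \<Longrightarrow> \<exists>a b \<delta>. separated a b \<delta> \<and> r \<in> {a<..<b}"
proof -
  have m1[measurable]: "{y :: real ^ 'n. norm y \<le> r1} \<in> sets borel" "{y :: real ^ 'n. \<not> norm y \<le> r1} \<in> sets borel"
    by measurable
  interpret N1: orth_invariant_measure N1 unfolding N1_def by (rule orth_invariant_restrict) measurable
  interpret N2: orth_invariant_measure N2 unfolding N2_def by (rule orth_invariant_restrict) measurable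
  show "inner_measure N1 r1"
  proof
    show "AE y in N1. norm y \<le> r1"
      unfolding N1_def by (subst AE_density) (auto simp: indicator_def sets_M)
  qed (use r12 in auto)
  show "outer_measure N2 r2"
  proof
    show "AE y in N2. r2 \<le> norm y"
      unfolding N2_def using gap by (subst AE_density) (auto elim!: eventually_mono simp: indicator_def sets_M)
  qed (use r12 in auto)
  show sep: "\<exists>a b \<delta>. separated a b \<delta> \<and> r \<in> {a<..<b}" if r: "r1 < r" "r < r2" for r
  proof -
    define \<delta> where "\<delta> = min (r - r1) (r2 - r) / 2"
    have \<delta>: "\<delta> > 0" "\<delta> \<le> (r - r1) / 2" "\<delta> \<le> (r2 - r) / 2" using r by (auto simp: \<delta>_def min_def)
    have "separated (r - \<delta>) (r + \<delta>) \<delta>"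
      unfolding separated_def
    proof (intro conjI \<delta>(1))
      show "AE y in M. \<forall>t\<in>{r - \<delta><..<r + \<delta>}. \<delta> \<le> norm (t *\<^sub>R axis0 - y)"
        using gap
      proof eventually_elim
        case (elim y)
        show ?case
        proof
          fix t assume t: "t \<in> {r - \<delta><..<r + \<delta>}"
          then have "t > 0" using \<delta> r r12 by auto
          then show "\<delta> \<le> norm (t *\<^sub>R axis0 - y)"
            using norm_scaleR_axis0_diff[of t y] elim t \<delta> by auto
        qed
      qed
    qed
    then show ?thesis using \<delta> by (intro exI conjI) auto
  qed
  show "radial p r = N1.radial p r + N2.radial p r" if r: "r1 < r" "r < r2" and p: "p > 0" for r p
  proof -
    obtain a b \<delta> where "separated a b \<delta>" "r \<in> {a<..<b}" using sep[OF r] by blast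
    from integrable_radial[OF this p] have int: "integrable M (\<lambda>y. norm (r *\<^sub>R axis0 - y) powr (- p))" .
    let ?f = "\<lambda>y. norm (r *\<^sub>R axis0 - y) powr (- p)"
    have "N1.radial p r = (\<integral>y. indicator {y. norm y \<le> r1} y *\<^sub>R ?f y \<partial>M)"
      unfolding N1.radial_def unfolding N1_def ennreal_indicator[symmetric] by (subst integral_density) auto
    moreover have "N2.radial p r = (\<integral>y. indicator {y. \<not> norm y \<le> r1} y *\<^sub>R ?f y \<partial>M)"
      unfolding N2.radial_def unfolding N2_def ennreal_indicator[symmetric] by (subst integral_density) auto
    moreover have "(\<integral>y. indicator {y. norm y \<le> r1} y *\<^sub>R ?f y \<partial>M) + (\<integral>y. indicator {y. \<not> norm y \<le> r1} y *\<^sub>R ?f y \<partial>M)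
      = (\<integral>y. indicator {y. norm y \<le> r1} y *\<^sub>R ?f y + indicator {y. \<not> norm y \<le> r1} y *\<^sub>R ?f y \<partial>M)"
      using int by (intro Bochner_Integration.integral_add[symmetric] integrable_mult_indicator) (auto simp: sets_M)
    moreover have "\<dots> = radial p r"
      unfolding radial_def by (intro Bochner_Integration.integral_cong) (auto simp: indicator_def)
    ultimately show ?thesis by simp
  qed
  have "emeasure N1 UNIV = emeasure M {y. norm y \<le> r1}" "emeasure N2 UNIV = emeasure M {y. \<not> norm y \<le> r1}"
    unfolding N1_def N2_def using sets_M m1 by (simp_all add: emeasure_density)
  then have "measure N1 UNIV = measure M {y. norm y \<le> r1}" "measure N2 UNIV = measure M {y. \<not> norm y \<le> r1}"
    by (simp_all add: measure_def)
  moreover have "measure M ({y. norm y \<le> r1} \<union> {y. \<not> norm y \<le> r1}) = measure M {y. norm y \<le> r1} + measure M {y. \<not> norm y \<le> r1}"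
    using m1 sets_M by (intro finite_measure_Union) auto
  moreover have "{y. norm y \<le> r1} \<union> {y. \<not> norm y \<le> r1} = (UNIV :: (real ^ 'n) set)" by auto
  ultimately show "measure M UNIV = measure N1 UNIV + measure N2 UNIV" by simp
qed

text \<open>Both parts of the measure contribute a nonnegative second derivative, and one of them a
  positive one because the total mass is positive. Finiteness at \<open>r1\<close> and
  \<open>r2\<close> gives continuity up to the ends.\<close>

lemma potential_gap:
  assumes gap: "AE y in M. norm y \<le> r1 \<or> r2 \<le> norm y" and r12: "0 \<le> r1" "r1 < r" "r < r2"
    and N: "CARD('n) \<ge> 2" and s: "s > 0" "s + 2 > real CARD('n)"
    and mass: "measure M UNIV > 0"
    and fin: "potential s M (r1 *\<^sub>R axis0) < \<infinity>" "potential s M (r2 *\<^sub>R axis0) < \<infinity>"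
  shows "potential s M (r *\<^sub>R axis0) = ennreal (radial s r)"
    and "radial s r < ((r2 - r) * radial s r1 + (r - r1) * radial s r2) / (r2 - r1)"
proof -
  have r1r2: "r1 < r2" using r12 by simp
  note split = gap_split[OF gap r12(1) r1r2]
  interpret I: inner_measure "density M (indicator {y. norm y \<le> r1})" r1 by (rule split(1))
  interpret O: outer_measure "density M (indicator {y. \<not> norm y \<le> r1})" r2 by (rule split(2))
  define c where "c = s * (s + 2 - real CARD('n))"
  have c: "c > 0" using s by (simp add: c_def)
  obtain a b \<delta> where "separated a b \<delta>" "r \<in> {a<..<b}" using split(5)[OF r12(2,3)] by blast
  from potential_radial_sep[OF this s(1)] show "potential s M (r *\<^sub>R axis0) = ennreal (radial s r)" .
  have ev: "eventually (\<lambda>u. I.radial s u + O.radial s u = radial s u) (nhds t)" if "r1 < t" "t < r2" for t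
    using eventually_nhds_in_open[of "{r1<..<r2}" t] that
    by (auto elim!: eventually_mono simp: split(3)[OF _ _ s(1)])
  have d1: "(radial s has_real_derivative I.radial1 s t + O.radial1 s t) (at t)" if t: "r1 < t" "t < r2" for t
  proof -
    have "((\<lambda>u. I.radial s u + O.radial s u) has_real_derivative I.radial1 s t + O.radial1 s t) (at t)"
      using t r12 s by (intro DERIV_add I.inner_facts O.outer_facts) auto
    then show ?thesis using ev[OF t] by (subst (asm) DERIV_cong_ev[OF refl _ refl]) auto
  qed
  have d2: "((\<lambda>u. I.radial1 s u + O.radial1 s u) has_real_derivative I.radial2 s t + O.radial2 s t) (at t)"
    if t: "r1 < t" "t < r2" for t
    using t r12 s by (intro DERIV_add I.inner_facts O.outer_facts) auto
  have pos: "0 < I.radial2 s t + O.radial2 s t" if t: "r1 < t" "t < r2" for t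
  proof -
    have i: "c * I.radial (s + 2) t \<le> I.radial2 s t"
      using I.inner_facts(5)[OF t(1) s(1)] by (simp add: c_def)
    have o: "c / real CARD('n) * O.radial (s + 2) t \<le> O.radial2 s t"
      using O.outer_radial2_ge[of t s] t r12 s N by (simp add: c_def)
    have nn: "0 \<le> I.radial (s + 2) t" "0 \<le> O.radial (s + 2) t"
      using I.inner_facts(6)[OF t(1)] O.outer_facts(4)[of t] t r12 s by auto
    have "0 < I.radial (s + 2) t \<or> 0 < O.radial (s + 2) t"
      using I.inner_facts(7)[OF t(1), of "s + 2"] O.outer_facts(5)[of t "s + 2"] t r12 s mass split(4) by argo
    then have "0 < c * I.radial (s + 2) t + c / real CARD('n) * O.radial (s + 2) t"
      using nn c N by (auto intro: add_pos_nonneg add_nonneg_pos)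
    then show ?thesis using i o by linarith
  qed
  have cont: "continuous_on {r1..r2} (radial s)"
    unfolding continuous_on_def
  proof
    fix t assume "t \<in> {r1..r2}"
    then consider "r1 < t" "t < r2" | "t = r1" | "t = r2" by force
    then show "(radial s \<longlongrightarrow> radial s t) (at t within {r1..r2})"
    proof cases
      case 1
      show ?thesis
        using DERIV_isCont[OF d1[OF 1]] unfolding isCont_def by (rule tendsto_within_subset) simp
    next
      case 2
      \<comment> \<open>Domination towards \<open>r1\<close> holds only on the half of the gap
        nearer to \<open>r1\<close>; beyond the midpoint mass at radius \<open>r2\<close> may be
        closer.\<close>
      define m where "m = (r1 + r2) / 2"
      have m: "r1 < m" "m < r2" using r12 by (auto simp: m_def)
      have "(radial s \<longlongrightarrow> radial s r1) (at r1 within {r1..m})"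
        by (rule radial_tendsto_boundary'[OF fin(1) s(1) gap]) (use r12 in \<open>auto simp: m_def\<close>)
      then show ?thesis unfolding 2
        by (subst (asm) at_within_Icc_at_right, use m in simp, subst at_within_Icc_at_right, use r12 in auto)
    next
      case 3
      define m where "m = (r1 + r2) / 2"
      have m: "r1 < m" "m < r2" using r12 by (auto simp: m_def)
      have "(radial s \<longlongrightarrow> radial s r2) (at r2 within {m..r2})"
        by (rule radial_tendsto_boundary'[OF fin(2) s(1) gap]) (use r12 in \<open>auto simp: m_def\<close>)
      then show ?thesis unfolding 3
        by (subst (asm) at_within_Icc_at_left, use m in simp, subst at_within_Icc_at_left, use r12 in auto)
    qed
  qed
  show "radial s r < ((r2 - r) * radial s r1 + (r - r1) * radial s r2) / (r2 - r1)"
    using r12 by (intro strictly_convex_ineq[OF _ _ cont d1 d2 pos]) auto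
qed

end

section \<open>Strict monotonicity beyond the extreme radii\<close>

lemma (in inner_measure) potential_strict_decreasing:
  assumes r: "R < r" and s: "s > 0" "s + 2 > real CARD('n)" and mass: "measure M UNIV > 0"
    and fin: "potential s M (R *\<^sub>R axis0) < \<infinity>"
  shows "potential s M (r *\<^sub>R axis0) < potential s M (R *\<^sub>R axis0)"
proof -
  have neg: "radial1 s t < 0" if t: "R < t" for t
  proof -
    have "radial2 s t > 0" if "R < t" for t
    proof -
      have "0 < s * (s + 2 - real CARD('n)) * radial (s + 2) t"
        using inner_facts(7)[OF that _ mass, of "s + 2"] s by simp
      then show ?thesis using inner_facts(5)[OF that s(1)] by linarith
    qed
    note r2 = this
    \<comment> \<open>Strictness comes from convexity: \<open>radial1 s\<close> increases strictly
      and is still nonpositive at \<open>t + 1\<close>.\<close>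
    have "radial1 s t < radial1 s (t + 1)"
    proof (rule DERIV_pos_imp_increasing[where f="radial1 s"])
      show "\<exists>y. (radial1 s has_real_derivative y) (at u) \<and> 0 < y" if "t \<le> u" "u \<le> t + 1" for u
        using inner_facts(2)[of u s] r2[of u] that t s by auto
    qed simp
    moreover have "radial1 s (t + 1) \<le> 0"
      using inner_facts(4)[of "t + 1" s] t s by simp
    ultimately show ?thesis by simp
  qed
  have sep: "\<exists>a b \<delta>. separated a b \<delta> \<and> t \<in> {a<..<b}" if "R < t" for t
  proof -
    define r' where "r' = max ((R + t) / 2) (t - 1)"
    have r': "R < r'" "t \<in> {r'<..<r' + 2}" using that by (auto simp: r'_def less_max_iff_disj)
    show ?thesis using separated_inner[OF r'(1)] r'(2) by blast
  qed
  have lim: "(radial s \<longlongrightarrow> radial s R) (at R within {R..r})"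
    by (rule radial_tendsto_boundary'[OF fin s(1) inner]) (use R in auto)
  have "radial s r < radial s R"
  proof (rule DERIV_neg_imp_decreasing_open[OF r, where f="radial s"])
    show "\<exists>y. (radial s has_real_derivative y) (at t) \<and> y < 0" if "R < t" "t < r" for t
      using inner_facts(1)[OF that(1) s(1)] neg[OF that(1)] by blast
    show "continuous_on {R..r} (radial s)"
      unfolding continuous_on_def
    proof
      fix t assume "t \<in> {R..r}"
      then consider "t = R" | "R < t" by force
      then show "(radial s \<longlongrightarrow> radial s t) (at t within {R..r})"
      proof cases
        case 2
        show ?thesis
          using DERIV_isCont[OF inner_facts(1)[OF 2 s(1)]]
          unfolding isCont_def by (rule tendsto_within_subset) simp
      qed (use lim in simp)
    qed
  qed
  moreover have "potential s M (r *\<^sub>R axis0) = ennreal (radial s r)"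
    using sep[OF r] potential_radial_sep s by blast
  moreover have "0 \<le> radial s r" using inner_facts(6)[OF r s(1)] .
  ultimately show ?thesis
    using potential_radial_finite[OF fin] by (simp add: ennreal_less_iff)
qed

lemma (in outer_measure) potential_strict_increasing:
  assumes r: "0 \<le> r" "r < R" and N: "CARD('n) \<ge> 2" and s: "s > 0" "s + 2 > real CARD('n)" and mass: "measure M UNIV > 0"
    and fin: "potential s M (R *\<^sub>R axis0) < \<infinity>"
  shows "potential s M (r *\<^sub>R axis0) < potential s M (R *\<^sub>R axis0)"
proof -
  have pos: "radial1 s t > 0" if t: "0 < t" "t < R" for t
  proof -
    have "radial2 s t > 0" if "0 < t" "t < R" for t
    proof -
      have "0 < s * (s + 2 - real CARD('n)) / real CARD('n) * radial (s + 2) t"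
        using outer_facts(5)[of t "s + 2"] that mass s N by simp
      then show ?thesis using outer_radial2_ge[of t s] that s N by linarith
    qed
    note r2 = this
    \<comment> \<open>The mirror argument: \<open>radial1 s\<close> is already nonnegative at
      \<open>t / 2\<close> and increases strictly up to \<open>t\<close>.\<close>
    have "radial1 s (t / 2) < radial1 s t"
    proof (rule DERIV_pos_imp_increasing[where f="radial1 s"])
      show "\<exists>y. (radial1 s has_real_derivative y) (at u) \<and> 0 < y" if "t / 2 \<le> u" "u \<le> t" for u
        using outer_facts(2)[of u s] r2[of u] that t s by auto
    qed (use t in simp)
    moreover have "radial1 s (t / 2) \<ge> 0"
      using outer_radial1_nonneg_pos[of "t / 2" s] t s N by simp
    ultimately show ?thesis by simp
  qed
  have lim: "(radial s \<longlongrightarrow> radial s R) (at R within {r..R})"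
    by (rule radial_tendsto_boundary'[OF fin s(1) outer]) (use r in auto)
  have "radial s r < radial s R"
  proof (rule DERIV_pos_imp_increasing_open[OF r(2), where f="radial s"])
    show "\<exists>y. (radial s has_real_derivative y) (at t) \<and> 0 < y" if "r < t" "t < R" for t
      using outer_facts(1)[of t s] pos[of t] that r s by auto
    show "continuous_on {r..R} (radial s)"
      unfolding continuous_on_def
    proof
      fix t assume t: "t \<in> {r..R}"
      then consider "t = R" | "t < R" by force
      then show "(radial s \<longlongrightarrow> radial s t) (at t within {r..R})"
      proof cases
        case 2
        then show ?thesis
          using DERIV_isCont[OF outer_facts(1)[OF _ 2 s(1)]] t r
          unfolding isCont_def by (auto intro: tendsto_within_subset)
      qed (use lim in simp)
    qed
  qed
  moreover have "potential s M (r *\<^sub>R axis0) = ennreal (radial s r)"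
    by (rule outer_interval[OF r]) (rule potential_radial_sep[OF _ _ s(1)])
  moreover have "0 \<le> radial s r" using outer_facts(4)[OF r s(1)] .
  ultimately show ?thesis
    using potential_radial_finite[OF fin] by (simp add: ennreal_less_iff)
qed

section \<open>Measures on a sphere\<close>

lemma power_diff_le:
  fixes x y :: real
  assumes "0 \<le> y" "y \<le> x"
  shows "x ^ n - y ^ n \<le> (x - y) * (real n * x ^ (n - 1))"
proof -
  have "x ^ n - y ^ n = (x - y) * (\<Sum>i<n. y ^ (n - Suc i) * x ^ i)"
    by (rule power_diff_sumr2)
  also have "\<dots> \<le> (x - y) * (\<Sum>i<n. x ^ (n - 1))"
  proof (intro mult_left_mono sum_mono)
    fix i assume "i \<in> {..<n}"
    then have "x ^ (n - 1) = x ^ (n - Suc i) * x ^ i" by (simp flip: power_add)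
    moreover have "y ^ (n - Suc i) * x ^ i \<le> x ^ (n - Suc i) * x ^ i"
      using assms by (intro mult_right_mono power_mono) auto
    ultimately show "y ^ (n - Suc i) * x ^ i \<le> x ^ (n - 1)" by simp
  qed (use assms in simp)
  finally show ?thesis by simp
qed

text \<open>With \<open>Y\<close> the component of a point \<open>y\<close> of the sphere along the
  axis, both sides are squared distances; this is the algebra of inversion in the sphere of radius
  \<open>a\<close>.\<close>

lemma kelvin_algebra:
  fixes a r Y :: real
  assumes "a > 0" "r > 0"
  shows "(r / a)\<^sup>2 * ((a\<^sup>2 / r)\<^sup>2 - 2 * (a\<^sup>2 / r) * Y + a\<^sup>2) = r\<^sup>2 - 2 * r * Y + a\<^sup>2"
proof -
  have 1: "(r / a)\<^sup>2 * (a\<^sup>2 / r) = r" "r * (a\<^sup>2 / r) = a\<^sup>2" "(r / a)\<^sup>2 * a\<^sup>2 = r\<^sup>2"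
    using assms by (simp_all add: power2_eq_square)
  have *: "(r / a)\<^sup>2 * (q\<^sup>2 - 2 * q * Y + a\<^sup>2) = ((r / a)\<^sup>2 * q) * q - 2 * ((r / a)\<^sup>2 * q) * Y + (r / a)\<^sup>2 * a\<^sup>2" for q
    by (simp add: distrib_left right_diff_distrib power2_eq_square mult_ac)
  show ?thesis unfolding * 1 by simp
qed

lemma norm_axis_diff_sq:
  fixes e y :: "'a::real_inner"
  assumes "norm e = 1" "norm y = a"
  shows "(norm (r *\<^sub>R e - y))\<^sup>2 = r\<^sup>2 - 2 * r * (y \<bullet> e) + a\<^sup>2"
proof -
  have "e \<bullet> e = 1" "y \<bullet> y = a\<^sup>2" using assms by (simp_all add: dot_square_norm)
  then show ?thesis
    unfolding power2_norm_eq_inner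
    by (simp add: inner_diff_left inner_diff_right inner_commute[of e y] power2_eq_square right_diff_distrib)
qed
locale sphere_measure = orth_invariant_measure M for M :: "(real ^ 'n) measure" +
  fixes a s :: real
  assumes a: "a > 0" and sphere: "AE y in M. norm y = a" and mass: "measure M UNIV > 0"
    and s: "s > 0" "s + 2 > real CARD('n)"
    and fin: "potential s M (a *\<^sub>R axis0) < \<infinity>"
begin

lemma emeasure_ball_norm_eq:
  fixes v w :: "real ^ 'n"
  assumes "norm v = norm w"
  shows "emeasure M (ball v r) = emeasure M (ball w r)"
proof -
  obtain T where T: "orthogonal_transformation T" "T v = w"
    using orthogonal_transformation_exists[OF assms] .
  note [measurable] = orthogonal_transformation_measurable[OF T(1)]
  have "T -` ball w r \<inter> space M = ball v r"
    using T sets_eq_imp_space_eq[OF sets_M]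
    by (auto simp: dist_norm orthogonal_transformation linear_diff[symmetric])
  moreover have "emeasure (distr M borel T) (ball w r) = emeasure M (T -` ball w r \<inter> space M)"
    by (rule emeasure_distr) auto
  ultimately show ?thesis unfolding invariant[OF T(1)] by simp
qed

text \<open>The mass of a cap, by double counting of the pairs \<open>(y, z)\<close> with \<open>|y| = a\<close> and \<open>|z - y| < h\<close>:
  the points \<open>z\<close> fill a shell of volume \<open>O(h)\<close>.\<close>

lemma cap_mass:
  assumes h: "0 < h" "h \<le> a"
  shows "measure M UNIV * h ^ (CARD('n) - 1) \<le>
    2 * real CARD('n) * (2 * a) ^ (CARD('n) - 1) * measure M (ball (a *\<^sub>R axis0) (2 * h))"
proof -
  let ?N = "CARD('n)"
  define V where "V = unit_ball_vol (real ?N)"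
  have V: "V > 0" by (simp add: V_def)
  define S where "S = ball (0 :: real ^ 'n) (a + h) - cball 0 (a - h)"
  define \<beta> where "\<beta> = measure M (ball (a *\<^sub>R axis0) (2 * h))"
  have [measurable]: "S \<in> sets borel" by (simp add: S_def)
  interpret P: pair_sigma_finite M "lborel :: (real ^ 'n) measure" ..
  have Npos: "?N > 0" by simp
  have vol_ball: "emeasure lborel (ball c r :: (real ^ 'n) set) = ennreal (V * r ^ ?N)" if "r \<ge> 0" for c r
    using that by (simp add: emeasure_ball V_def)
  have vol_cball: "emeasure lborel (cball c r :: (real ^ 'n) set) = ennreal (V * r ^ ?N)" if "r \<ge> 0" for c r
    using that by (simp add: emeasure_cball V_def)
  have volS: "emeasure lborel S \<le> ennreal (V * (2 * h * (real ?N * (2 * a) ^ (?N - 1))))"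
  proof -
    have "emeasure lborel S = ennreal (V * (a + h) ^ ?N) - ennreal (V * (a - h) ^ ?N)"
      unfolding S_def using h a by (subst emeasure_Diff) (auto simp: vol_ball vol_cball)
    also have "\<dots> = ennreal (V * ((a + h) ^ ?N - (a - h) ^ ?N))"
      using h V by (simp add: ennreal_minus right_diff_distrib)
    also have "\<dots> \<le> ennreal (V * (2 * h * (real ?N * (2 * a) ^ (?N - 1))))"
    proof (intro ennreal_leI mult_left_mono)
      have "(a + h) ^ ?N - (a - h) ^ ?N \<le> ((a + h) - (a - h)) * (real ?N * (a + h) ^ (?N - 1))"
        using h by (intro power_diff_le) auto
      also have "\<dots> \<le> 2 * h * (real ?N * (2 * a) ^ (?N - 1))"
        using h by (intro mult_mono power_mono) auto
      finally show "(a + h) ^ ?N - (a - h) ^ ?N \<le> 2 * h * (real ?N * (2 * a) ^ (?N - 1))" .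
    qed (use V in simp)
    finally show ?thesis .
  qed
  have "ennreal (V * h ^ ?N) * emeasure M UNIV = (\<integral>\<^sup>+y. ennreal (V * h ^ ?N) \<partial>M)"
    using sets_eq_imp_space_eq[OF sets_M] by simp
  also have "\<dots> \<le> (\<integral>\<^sup>+y. \<integral>\<^sup>+z. indicator S z * indicator (ball z h) y \<partial>lborel \<partial>M)"
  proof (rule nn_integral_mono_AE, use sphere in eventually_elim)
    case (elim y)
    have sub: "ball y h \<subseteq> S"
    proof
      fix z assume "z \<in> ball y h"
      then have "\<bar>norm z - norm y\<bar> < h"
        using norm_triangle_ineq3[of z y] by (simp add: dist_norm norm_minus_commute)
      then show "z \<in> S" using elim by (auto simp: S_def)
    qed
    have "ennreal (V * h ^ ?N) = emeasure lborel (ball y h)" using h by (simp add: vol_ball)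
    also have "\<dots> = (\<integral>\<^sup>+z. indicator (ball y h) z \<partial>lborel)" by simp
    also have "\<dots> \<le> (\<integral>\<^sup>+z. indicator S z * indicator (ball z h) y \<partial>lborel)"
    proof (rule nn_integral_mono)
      fix z
      show "indicator (ball y h) z \<le> (indicator S z * indicator (ball z h) y :: ennreal)"
        using sub by (cases "z \<in> ball y h") (auto simp: dist_commute)
    qed
    finally show ?case .
  qed
  also have "\<dots> = (\<integral>\<^sup>+z. \<integral>\<^sup>+y. indicator S z * indicator (ball z h) y \<partial>M \<partial>lborel)"
  proof (rule P.Fubini'[symmetric])
    have "(\<lambda>x. indicator S (snd x) * indicator {x. dist (snd x) (fst x) < h} x :: ennreal)
        \<in> borel_measurable (M \<Otimes>\<^sub>M (lborel :: (real ^ 'n) measure))"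
      by measurable
    moreover have "indicator {x. dist (snd x) (fst x) < h} x = (indicator (ball (snd x) h) (fst x) :: ennreal)"
      for x :: "(real ^ 'n) \<times> (real ^ 'n)"
      by (auto simp: indicator_def)
    ultimately show "(\<lambda>(y, z). indicator S z * indicator (ball z h) y :: ennreal) \<in> borel_measurable (M \<Otimes>\<^sub>M lborel)"
      by (simp add: split_beta')
  qed
  also have "\<dots> = (\<integral>\<^sup>+z. indicator S z * emeasure M (ball z h) \<partial>lborel)"
    by (intro nn_integral_cong nn_integral_cmult_indicator) (simp add: sets_M)
  also have "\<dots> \<le> (\<integral>\<^sup>+z. ennreal \<beta> * indicator S z \<partial>lborel)"
  proof (rule nn_integral_mono)
    fix z :: "real ^ 'n"
    show "indicator S z * emeasure M (ball z h) \<le> ennreal \<beta> * indicator S z"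
    proof (cases "z \<in> S")
      case True
      then have z: "\<bar>norm z - a\<bar> < h" "norm z > 0"
        using h by (auto simp: S_def abs_less_iff)
      \<comment> \<open>The radial projection of \<open>z\<close> to the sphere. Passing from
        \<open>z\<close> to \<open>w\<close> doubles the radius of the ball, and by invariance all
        balls centred on the sphere with that radius have the same mass.\<close>
      define w where "w = (a / norm z) *\<^sub>R z"
      have nw: "norm w = a" using z a by (simp add: w_def)
      have "z - w = (1 - a / norm z) *\<^sub>R z" by (simp add: w_def scaleR_left_diff_distrib)
      then have "norm (z - w) = \<bar>1 - a / norm z\<bar> * norm z" by simp
      also have "\<dots> = \<bar>(1 - a / norm z) * norm z\<bar>" by (simp add: abs_mult)
      also have "\<dots> = \<bar>norm z - a\<bar>" using z by (simp add: left_diff_distrib)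
      finally have zw: "dist z w < h" using z by (simp add: dist_norm)
      have "ball z h \<subseteq> ball w (2 * h)"
      proof
        fix y assume "y \<in> ball z h"
        then show "y \<in> ball w (2 * h)"
          using zw dist_triangle[of w y z] by (simp add: dist_commute)
      qed
      then have "emeasure M (ball z h) \<le> emeasure M (ball w (2 * h))"
        by (intro emeasure_mono) (auto simp: sets_M)
      also have "\<dots> = ennreal \<beta>"
        using emeasure_ball_norm_eq[of w "a *\<^sub>R axis0" "2 * h"] nw a by (simp add: \<beta>_def emeasure_eq_measure)
      finally show ?thesis using True by simp
    qed simp
  qed
  also have "\<dots> = ennreal \<beta> * emeasure lborel S" by (simp add: nn_integral_cmult_indicator)
  also have "\<dots> \<le> ennreal \<beta> * ennreal (V * (2 * h * (real ?N * (2 * a) ^ (?N - 1))))"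
    using volS by (rule mult_left_mono) simp
  finally have "ennreal (V * h ^ ?N * measure M UNIV) \<le> ennreal (\<beta> * (V * (2 * h * (real ?N * (2 * a) ^ (?N - 1)))))"
  proof -
    assume *: "ennreal (V * h ^ ?N) * emeasure M UNIV \<le> ennreal \<beta> * ennreal (V * (2 * h * (real ?N * (2 * a) ^ (?N - 1))))"
    have "0 \<le> V * h ^ ?N" "0 \<le> \<beta>" using V h by (simp_all add: \<beta>_def)
    with * show ?thesis
      unfolding emeasure_eq_measure by (simp only: ennreal_mult'[symmetric])
  qed
  then have "V * h ^ ?N * measure M UNIV \<le> \<beta> * (V * (2 * h * (real ?N * (2 * a) ^ (?N - 1))))"
    by (subst (asm) ennreal_le_iff) (use V h a in \<open>simp_all add: \<beta>_def\<close>)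
  moreover have "h ^ ?N = h * h ^ (?N - 1)" using Npos 
    using power_Suc[of h "CARD('n) - 1"] by (simp del: power_Suc)
  ultimately have "(V * h) * (measure M UNIV * h ^ (?N - 1)) \<le> (V * h) * (2 * real ?N * (2 * a) ^ (?N - 1) * \<beta>)"
    by (simp add: mult_ac)
  then show ?thesis using V h by (simp add: \<beta>_def)
qed

lemma sphere_inner: "inner_measure M a"
  using a sphere by unfold_locales (auto elim!: eventually_mono)

interpretation I: inner_measure M a by (rule sphere_inner)

text \<open>The factor \<open>1 - 2 powr (- s / 2)\<close> is the relative loss of the kernel where
  the squared distance doubles. The fraction is the lower bound for the mass of a cap of radius
  \<open>h\<close>, from \<open>cap_mass\<close> at \<open>h / 2\<close>, with
  \<open>h ^ (CARD('n) - 1)\<close> taken out.\<close>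

definition cusp_const :: real where
  "cusp_const = (1 - 2 powr (- s / 2)) * (measure M UNIV / (2 * real CARD('n) * (2 * a) ^ (CARD('n) - 1) * 2 ^ (CARD('n) - 1)))"

lemma cusp_const_pos: "cusp_const > 0"
proof -
  have "2 powr (- s / 2) < (1::real)" using s by (simp add: powr_less_one)
  then show ?thesis using mass a by (simp add: cusp_const_def)
qed

text \<open>For \<open>y\<close> on the sphere at distance \<open>\<rho>\<close> from
  \<open>a *\<^sub>R axis0\<close>, the squared distance grows from \<open>\<rho>^2\<close> to at
  least \<open>\<rho>^2 + h^2\<close>. No kernel value increases, and for \<open>\<rho> < h\<close>
  it loses a fixed fraction of a value that is at least \<open>h powr (- s)\<close>. The cap of
  these points has mass at least of order \<open>h ^ (CARD('n) - 1)\<close>, whence the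
  exponent.\<close>

lemma radial_cusp_right:
  assumes h: "0 < h" "h \<le> 2 * a"
  shows "radial s (a + h) + cusp_const * h powr (real CARD('n) - 1 - s) \<le> radial s a"
proof -
  let ?N = "CARD('n)"
  let ?B = "ball (a *\<^sub>R axis0 :: real ^ 'n) h"
  define k where "k = (1 - 2 powr (- s / 2)) * h powr (- s)"
  have "2 powr (- s / 2) < (1::real)" using s by (simp add: powr_less_one)
  then have k: "k \<ge> 0" by (simp add: k_def)
  note ae = potential_finite(1)[OF fin] and int_a = potential_finite(2)[OF fin]
  have int_h: "integrable M (\<lambda>y. norm ((a + h) *\<^sub>R axis0 - y) powr (- s))"
  proof -
    define r' where "r' = max (a + h / 2) (a + h - 1)"
    have r': "a < r'" "a + h \<in> {r'<..<r' + 2}" using h by (auto simp: r'_def less_max_iff_disj)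
    show ?thesis by (rule integrable_radial[OF I.separated_inner[OF r'(1)] r'(2) s(1)])
  qed
  have "k * measure M ?B = (\<integral>y. k * indicator ?B y \<partial>M)"
    using sets_M by (simp add: measure_def)
  also have "\<dots> \<le> (\<integral>y. norm (a *\<^sub>R axis0 - y) powr (- s) - norm ((a + h) *\<^sub>R axis0 - y) powr (- s) \<partial>M)"
  proof (rule integral_mono_AE)
    show "integrable M (\<lambda>y. k * indicator ?B y)"
      using sets_M by (intro integrable_mult_right integrable_real_indicator) (auto simp: less_top[symmetric])
    show "integrable M (\<lambda>y. norm (a *\<^sub>R axis0 - y) powr (- s) - norm ((a + h) *\<^sub>R axis0 - y) powr (- s))"
      using int_a int_h by simp
    show "AE y in M. k * indicator ?B y \<le> norm (a *\<^sub>R axis0 - y) powr (- s) - norm ((a + h) *\<^sub>R axis0 - y) powr (- s)"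
      using ae sphere
    proof eventually_elim
      case (elim y)
      define \<rho> where "\<rho> = norm (a *\<^sub>R axis0 - y)"
      define \<rho>' where "\<rho>' = norm ((a + h) *\<^sub>R axis0 - y)"
      have \<rho>: "\<rho> > 0" using elim by (simp add: \<rho>_def)
      have ye: "y \<bullet> axis0 \<le> a" using norm_cauchy_schwarz[of y axis0] elim by simp
      have "\<rho>'\<^sup>2 = \<rho>\<^sup>2 + 2 * h * (a - y \<bullet> axis0) + h\<^sup>2"
        unfolding \<rho>_def \<rho>'_def norm_axis_diff_sq[OF axis0(2) elim(2)]
        by (simp add: power2_eq_square distrib_left distrib_right right_diff_distrib)
      then have \<rho>'2: "\<rho>'\<^sup>2 \<ge> \<rho>\<^sup>2 + h\<^sup>2" using ye h by simp
      have pw: "u powr (- s) = u\<^sup>2 powr (- s / 2)" if "u > 0" for u :: real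
        using that by (simp add: powr_powr flip: powr_numeral)
      have \<rho>'pos: "\<rho>' > 0"
      proof -
        have "0 < \<rho>\<^sup>2 + h\<^sup>2" using h by (simp add: add_nonneg_pos)
        then have "0 < \<rho>'\<^sup>2" using \<rho>'2 by linarith
        then show ?thesis by (simp add: \<rho>'_def)
      qed
      have le1: "\<rho>' powr (- s) \<le> (\<rho>\<^sup>2 + h\<^sup>2) powr (- s / 2)"
        unfolding pw[OF \<rho>'pos] using \<rho>'2 \<rho> s by (intro powr_mono2') (auto simp: add_pos_nonneg)
      show ?case
      proof (cases "y \<in> ?B")
        case True
        then have \<rho>h: "\<rho> < h" by (simp add: \<rho>_def dist_norm)
        have "(\<rho>\<^sup>2 + h\<^sup>2) powr (- s / 2) \<le> (2 * \<rho>\<^sup>2) powr (- s / 2)"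
          using \<rho> \<rho>h s by (intro powr_mono2') (auto intro: power_mono)
        also have "\<dots> = 2 powr (- s / 2) * \<rho> powr (- s)"
          using \<rho> by (simp add: powr_mult pw)
        finally have "\<rho>' powr (- s) \<le> 2 powr (- s / 2) * \<rho> powr (- s)" using le1 by simp
        then have "(1 - 2 powr (- s / 2)) * \<rho> powr (- s) \<le> \<rho> powr (- s) - \<rho>' powr (- s)"
          by (simp add: left_diff_distrib)
        moreover have "h powr (- s) \<le> \<rho> powr (- s)"
          using \<rho> \<rho>h s by (intro powr_mono2') auto
        then have "k \<le> (1 - 2 powr (- s / 2)) * \<rho> powr (- s)"
          unfolding k_def using s by (intro mult_left_mono) (auto simp: powr_less_one less_imp_le)
        ultimately show ?thesis using True by (simp add: \<rho>_def \<rho>'_def)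
      next
        case False
        have "(\<rho>\<^sup>2 + h\<^sup>2) powr (- s / 2) \<le> (\<rho>\<^sup>2) powr (- s / 2)"
          using \<rho> s by (intro powr_mono2') auto
        then have "\<rho>' powr (- s) \<le> \<rho> powr (- s)" using le1 pw[OF \<rho>] by simp
        then show ?thesis using False by (simp add: \<rho>_def \<rho>'_def)
      qed
    qed
  qed
  also have "\<dots> = radial s a - radial s (a + h)"
    unfolding radial_def using int_a int_h by (rule Bochner_Integration.integral_diff)
  finally have 1: "radial s (a + h) + k * measure M ?B \<le> radial s a" by simp
  have A: "2 * real ?N * (2 * a) ^ (?N - 1) > 0" using a by simp
  \<comment> \<open>The cap has radius \<open>h = 2 * (h / 2)\<close>; the condition
    \<open>h / 2 \<le> a\<close> is the origin of the assumption
    \<open>h \<le> 2 * a\<close>.\<close>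
  have "measure M UNIV * (h / 2) ^ (?N - 1) \<le> measure M ?B * (2 * real ?N * (2 * a) ^ (?N - 1))"
    using cap_mass[of "h / 2"] h by (simp add: mult.commute)
  then have "measure M UNIV * (h / 2) ^ (?N - 1) / (2 * real ?N * (2 * a) ^ (?N - 1)) \<le> measure M ?B"
    by (simp only: pos_divide_le_eq[OF A])
  moreover have "measure M UNIV / (2 * real ?N * (2 * a) ^ (?N - 1) * 2 ^ (?N - 1)) * h ^ (?N - 1) =
      measure M UNIV * (h / 2) ^ (?N - 1) / (2 * real ?N * (2 * a) ^ (?N - 1))"
    by (simp add: power_divide)
  ultimately have "measure M UNIV / (2 * real ?N * (2 * a) ^ (?N - 1) * 2 ^ (?N - 1)) * h ^ (?N - 1) \<le> measure M ?B"
    by (simp only:)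
  then have "k * (measure M UNIV / (2 * real ?N * (2 * a) ^ (?N - 1) * 2 ^ (?N - 1)) * h ^ (?N - 1)) \<le> k * measure M ?B"
    using k by (rule mult_left_mono)
  also have "k * (measure M UNIV / (2 * real ?N * (2 * a) ^ (?N - 1) * 2 ^ (?N - 1)) * h ^ (?N - 1)) =
      cusp_const * (h powr (- s) * h ^ (?N - 1))"
    by (simp add: k_def cusp_const_def)
  also have "h powr (- s) * h ^ (?N - 1) = h powr (real ?N - 1 - s)"
  proof -
    have "real (?N - 1) = real ?N - 1" by (simp add: of_nat_diff Suc_leI)
    then have "h ^ (?N - 1) = h powr (real ?N - 1)" using h powr_realpow[of h "?N - 1"] by simp
    then have "h powr (- s) * h ^ (?N - 1) = h powr (- s + (real ?N - 1))" by (simp only: powr_add)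
    moreover have "- s + (real ?N - 1) = real ?N - 1 - s" by simp
    ultimately show ?thesis by (simp only:)
  qed
  finally show ?thesis using 1 by simp
qed

text \<open>The cusp exponent is \<open>1 - e\<close> with \<open>e = s + 2 - real CARD('n)\<close>
  positive, so the cusp beats the linear term \<open>K * h\<close> as soon as
  \<open>h powr (- e) \<ge> K / cusp_const\<close>.\<close>

lemma radial_steep_right:
  assumes K: "K > 0"
  shows "\<exists>h0>0. \<forall>h. 0 < h \<and> h < h0 \<longrightarrow> radial s (a + h) + K * h \<le> radial s a"
proof -
  define e where "e = s + 2 - real CARD('n)"
  have e: "e > 0" using s by (simp add: e_def)
  define h0 where "h0 = min (2 * a) ((K / cusp_const) powr (- 1 / e))"
  have "K / cusp_const \<noteq> 0" using K cusp_const_pos by simp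
  then have h0: "h0 > 0" using a by (simp add: h0_def)
  show ?thesis
  proof (intro exI[of _ h0] conjI allI impI h0)
    fix h assume h: "0 < h \<and> h < h0"
    have "((K / cusp_const) powr (- 1 / e)) powr (- e) \<le> h powr (- e)"
      using h e by (intro powr_mono2') (auto simp: h0_def)
    then have "K / cusp_const \<le> h powr (- e)"
      using e K cusp_const_pos by (simp add: powr_powr)
    then have "K \<le> cusp_const * h powr (- e)"
      using cusp_const_pos by (simp add: pos_divide_le_eq mult.commute)
    then have "K * h \<le> cusp_const * h powr (- e) * h"
      using h by (intro mult_right_mono) auto
    also have "\<dots> = cusp_const * h powr (real CARD('n) - 1 - s)"
    proof -
      have eq: "real CARD('n) - 1 - s = - e + 1" by (simp add: e_def)
      show ?thesis unfolding eq using h powr_add[of h "- e" 1] by simp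
    qed
    finally show "radial s (a + h) + K * h \<le> radial s a"
      using radial_cusp_right[of h] h by (simp add: h0_def)
  qed
qed

text \<open>Inversion in the sphere of radius \<open>a\<close>: \<open>|r e - y| = (r/a) |(a\<^sup>2/r) e - y|\<close> for \<open>|y| = a\<close>.\<close>

lemma radial_inversion:
  assumes r: "r > 0"
  shows "radial s r = (r / a) powr (- s) * radial s (a\<^sup>2 / r)"
proof -
  have "radial s r = (\<integral>y. (r / a) powr (- s) * norm ((a\<^sup>2 / r) *\<^sub>R axis0 - y) powr (- s) \<partial>M)"
    unfolding radial_def
  proof (rule integral_cong_AE)
    show "AE y in M. norm (r *\<^sub>R axis0 - y) powr (- s) = (r / a) powr (- s) * norm ((a\<^sup>2 / r) *\<^sub>R axis0 - y) powr (- s)"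
      using sphere
    proof eventually_elim
      case (elim y)
      have "(norm (r *\<^sub>R axis0 - y))\<^sup>2 = r\<^sup>2 - 2 * r * (y \<bullet> axis0) + a\<^sup>2"
        by (rule norm_axis_diff_sq) (use elim in auto)
      moreover have "(r / a * norm ((a\<^sup>2 / r) *\<^sub>R axis0 - y))\<^sup>2 = r\<^sup>2 - 2 * r * (y \<bullet> axis0) + a\<^sup>2"
        unfolding power_mult_distrib norm_axis_diff_sq[OF axis0(2) elim] using a r by (rule kelvin_algebra)
      ultimately have "(norm (r *\<^sub>R axis0 - y))\<^sup>2 = (r / a * norm ((a\<^sup>2 / r) *\<^sub>R axis0 - y))\<^sup>2"
        by (rule trans[OF _ sym])
      then have "norm (r *\<^sub>R axis0 - y) = r / a * norm ((a\<^sup>2 / r) *\<^sub>R axis0 - y)"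
        by (rule power2_eq_imp_eq) (use a r in simp_all)
      then show ?case by (simp only: powr_mult)
    qed
  qed measurable
  then show ?thesis by (simp add: radial_def)
qed

text \<open>Inversion carries \<open>a - h\<close> to \<open>a + h'\<close> with
  \<open>h' \<ge> h\<close>, where the outer estimate applies. The factor
  \<open>((a - h) / a) powr (- s)\<close> costs only a linear amount, absorbed by asking for the
  larger slope \<open>K'\<close> outside.\<close>

lemma radial_steep_left:
  assumes K: "K > 0"
  shows "\<exists>h0>0. \<forall>h. 0 < h \<and> h < h0 \<longrightarrow> 0 < a - h \<and> radial s (a - h) + K * h \<le> radial s a"
proof -
  \<comment> \<open>A bound for the slope of \<open>((a - h) / a) powr (- s)\<close> in
    \<open>h\<close> for \<open>h < a / 2\<close>: its derivative contains
    \<open>(1 - h / a) powr (- s - 1)\<close>, which is at most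
    \<open>2 powr (s + 1)\<close>.\<close>
  define C where "C = s * 2 powr (s + 1) / a"
  have C: "C > 0" using s a by (simp add: C_def)
  have fa: "radial s a \<ge> 0" unfolding radial_def by (intro integral_nonneg_AE) auto
  define K' where "K' = K + C * radial s a"
  have K': "K' > 0" using K C fa by (simp add: K'_def add_pos_nonneg)
  obtain h0 where h0: "h0 > 0" "\<And>h. 0 < h \<Longrightarrow> h < h0 \<Longrightarrow> radial s (a + h) + K' * h \<le> radial s a"
    using radial_steep_right[OF K'] by blast
  \<comment> \<open>From \<open>h < a / 2\<close> follows \<open>h' \<le> 2 * h\<close>, and
    \<open>h < h0 / 2\<close> then puts \<open>h'\<close> below \<open>h0\<close>.\<close>
  define h1 where "h1 = min (a / 2) (h0 / 2)"
  have h1: "h1 > 0" using a h0 by (simp add: h1_def)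
  show ?thesis
  proof (intro exI[of _ h1] conjI allI impI h1)
    fix h assume h: "0 < h \<and> h < h1"
    then have ha: "h < a / 2" "h < h0 / 2" by (auto simp: h1_def)
    then show r: "0 < a - h" using a by simp
    define h' where "h' = a * h / (a - h)"
    have eq: "a\<^sup>2 / (a - h) = a + h'" using r by (simp add: h'_def add_divide_eq_iff power2_eq_square right_diff_distrib)
    have h'1: "h \<le> h'" using r h by (simp add: h'_def pos_le_divide_eq right_diff_distrib mult.commute)
    have h'2: "h' < h0"
    proof -
      have "h * (2 * h) \<le> h * a" using ha h by (intro mult_left_mono) auto
      then have "a * h \<le> 2 * h * (a - h)" by (simp add: right_diff_distrib mult_ac)
      then have "h' \<le> 2 * h" using r by (simp add: h'_def pos_divide_le_eq)
      then show ?thesis using ha by simp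
    qed
    define X where "X = radial s (a + h')"
    have X: "0 \<le> X" "X + K' * h' \<le> radial s a"
      using h0(2)[of h'] h h'1 h'2 unfolding X_def
      by (auto simp: radial_def intro!: integral_nonneg_AE)
    have ratio: "((a - h) / a) powr (- s) \<le> 1 + C * h"
    proof -
      define g where "g x = (1 - x) powr (- s)" for x :: real
      define x where "x = h / a"
      have x: "0 < x" "x < 1/2" using h ha a by (simp_all add: x_def pos_divide_less_eq)
      have "\<exists>z. 0 < z \<and> z < x \<and> g x - g 0 = (x - 0) * (s * (1 - z) powr (- s - 1))"
      proof (rule MVT2)
        fix z assume "0 \<le> z" "z \<le> x"
        then show "(g has_real_derivative s * (1 - z) powr (- s - 1)) (at z)"
          using x unfolding g_def[abs_def]
          by (intro DERIV_cong[OF DERIV_chain2[OF has_real_derivative_powr DERIV_diff[OF DERIV_const DERIV_ident]]]) auto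
      qed (use x in simp)
      then obtain z where z: "0 < z" "z < x" "g x - g 0 = x * (s * (1 - z) powr (- s - 1))" by auto
      have "(1 - z) powr (- s - 1) \<le> (1/2) powr (- s - 1)"
        using z x s by (intro powr_mono2') auto
      also have "(1/2) powr (- s - 1) = (2::real) powr (s + 1)"
      proof -
        have eq: "- s - 1 = - (s + 1)" by simp
        have "(1/2) powr (- s - 1) = 1 / (2::real) powr (- (s + 1))" unfolding eq by (subst powr_divide) auto
        also have "\<dots> = 2 powr (s + 1)" by (simp only: powr_minus divide_inverse inverse_inverse_eq mult_1)
        finally show ?thesis .
      qed
      finally have "x * (s * (1 - z) powr (- s - 1)) \<le> x * (s * 2 powr (s + 1))"
        using x s by (intro mult_left_mono) auto
      then have "g x \<le> 1 + C * h" using z by (simp add: g_def C_def x_def mult_ac)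
      moreover have "(a - h) / a = 1 - x" using a by (simp add: x_def diff_divide_distrib)
      ultimately show ?thesis by (simp add: g_def)
    qed
    have "radial s (a - h) = ((a - h) / a) powr (- s) * X"
      using radial_inversion[OF r] unfolding eq X_def .
    also have "\<dots> \<le> (1 + C * h) * X" using ratio X by (intro mult_right_mono) auto
    also have "\<dots> = X + (C * h) * X" by (simp add: algebra_simps)
    also have "\<dots> \<le> (radial s a - K' * h') + (C * h) * radial s a"
    proof (intro add_mono mult_left_mono)
      show "X \<le> radial s a"
      proof -
        have "0 \<le> K' * h'" using K' h'1 h by simp
        then show ?thesis using X by linarith
      qed
    qed (use X C h in auto)
    also have "\<dots> \<le> (radial s a - K' * h) + (C * h) * radial s a"
      using h'1 K' by simp
    also have "\<dots> = radial s a - K * h" by (simp add: K'_def algebra_simps)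
    finally show "radial s (a - h) + K * h \<le> radial s a" by simp
  qed
qed

end

section \<open>Radially symmetric minimizers\<close>

lemma riesz_kernel_isometry:
  assumes "dist (T x) (T y) = dist x y"
  shows "riesz_kernel s (T x) (T y) = riesz_kernel s x y"
proof -
  have "T x = T y \<longleftrightarrow> x = y" using assms by (metis dist_eq_0_iff)
  then show ?thesis by (simp add: riesz_kernel_def assms)
qed

lemma dist_orthogonal_transformation:
  "orthogonal_transformation T \<Longrightarrow> dist (T x) (T y) = dist x y"
  by (simp add: dist_norm orthogonal_transformation linear_diff[symmetric])

lemma mutual_energy_distr_isometry:
  fixes M :: "'a::euclidean_space measure" and T :: "'a \<Rightarrow> 'b::euclidean_space"
  assumes M: "prob_space M" "sets M = sets borel" and [measurable]: "T \<in> borel \<rightarrow>\<^sub>M borel"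
    and iso: "\<And>x y. dist (T x) (T y) = dist x y"
  shows "mutual_energy s (distr M borel T) (distr M borel T) = mutual_energy s M M"
proof -
  interpret prob_space M by fact
  note [measurable_cong] = M(2)
  have [measurable]: "T \<in> M \<rightarrow>\<^sub>M borel" by measurable
  interpret D: prob_space "distr M borel T" by (rule prob_space_distr) measurable
  note kernel = riesz_kernel_isometry[of T, OF iso]
  have pot: "potential s (distr M borel T) (T x) = potential s M x" for x
    unfolding potential_def by (subst nn_integral_distr) (auto simp: kernel)
  have [measurable]: "potential s (distr M borel T) \<in> borel_measurable borel"
    using D.sigma_finite_measure_axioms by (rule measurable_potential) simp
  show ?thesis
    unfolding mutual_energy_potential by (subst nn_integral_distr) (auto simp: pot)
qed

text \<open>Second countability replaces the possibly uncountable union of null open sets by a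
  countable union of basic ones.\<close>

lemma emeasure_outside_support:
  fixes M :: "'a::second_countable_topology measure"
  assumes M: "sets M = sets borel"
  shows "emeasure M (- measure_support M) = 0"
proof -
  obtain B :: "'a set set" where B: "countable B" "topological_basis B"
    using ex_countable_basis by blast
  have op: "open b" if "b \<in> B" for b using B(2) that by (rule topological_basis_open)
  define B0 where "B0 = {b \<in> B. emeasure M b = 0}"
  have "- measure_support M = \<Union>B0"
  proof (intro equalityI subsetI)
    fix x assume "x \<in> - measure_support M"
    then obtain U where U: "open U" "x \<in> U" "emeasure M U = 0"
      by (auto simp: measure_support_def not_less)
    obtain b where b: "b \<in> B" "x \<in> b" "b \<subseteq> U"
      using topological_basisE[OF B(2) U(1,2)] by blast
    then have "emeasure M b \<le> emeasure M U"
      using U(1) by (intro emeasure_mono) (auto simp: M)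
    then show "x \<in> \<Union>B0" using b U(3) by (auto simp: B0_def)
  next
    fix x assume "x \<in> \<Union>B0"
    then obtain b where "b \<in> B" "emeasure M b = 0" "x \<in> b" by (auto simp: B0_def)
    then show "x \<in> - measure_support M"
      using op[of b] by (auto simp: measure_support_def)
  qed
  moreover have "(\<Union>b\<in>B0. b) \<in> null_sets M"
    by (rule null_sets_UN') (use B(1) op in \<open>auto simp: B0_def M null_sets_def\<close>)
  ultimately show ?thesis by (simp add: null_setsD1)
qed

lemma closed_measure_support: "closed (measure_support M)"
proof -
  have "open (- measure_support M)"
  proof (rule Topological_Spaces.openI)
    fix x assume "x \<in> - measure_support M"
    then obtain U where "open U" "x \<in> U" "emeasure M U = 0"
      by (auto simp: measure_support_def not_less)
    then show "\<exists>T. open T \<and> x \<in> T \<and> T \<subseteq> - measure_support M"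
      by (auto simp: measure_support_def intro!: exI[of _ U])
  qed
  then show ?thesis by (simp add: closed_def)
qed

lemma AE_measure_support:
  fixes M :: "'a::second_countable_topology measure"
  assumes M: "sets M = sets borel"
  shows "AE x in M. x \<in> measure_support M"
  by (rule AE_I[of _ _ "- measure_support M"])
    (use emeasure_outside_support[OF M] closed_measure_support[of M] M in auto)

lemma measure_support_subset_closed:
  assumes N: "prob_space N" "sets N = sets borel" and C: "closed C" "emeasure N C = 1"
  shows "measure_support N \<subseteq> C"
proof
  interpret prob_space N by fact
  fix x assume x: "x \<in> measure_support N"
  have "C \<in> sets N" using C(1) N(2) by simp
  then have "emeasure N (- C) = 0"
    using C(2) prob_compl[of C] sets_eq_imp_space_eq[OF N(2)]
    by (simp add: emeasure_eq_measure Compl_eq_Diff_UNIV)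
  then show "x \<in> C"
    using x open_Compl[OF C(1)] unfolding measure_support_def
    by (metis (no_types, lifting) Compl_iff less_irrefl mem_Collect_eq)
qed

lemma open_shell:
  fixes \<alpha> \<beta> :: real
  assumes "0 \<le> \<alpha>" "\<alpha> < \<beta>" "\<beta> \<le> 1"
  defines "A \<equiv> {y :: 'a::euclidean_space. \<alpha> < norm y \<and> norm y < \<beta>}"
  shows "A \<in> sets borel" "A \<subseteq> cball 0 1" "emeasure lborel A > 0"
proof -
  have op: "open A" unfolding A_def by (intro open_Collect_conj open_Collect_less continuous_intros)
  obtain e :: 'a where "norm e = 1" using norm_Basis nonempty_Basis by blast
  then have "((\<alpha> + \<beta>) / 2) *\<^sub>R e \<in> A" using assms by (simp add: A_def)
  then obtain c r where c: "r > 0" "ball c r \<subseteq> A"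
    using op open_contains_ball by blast
  have "0 < emeasure lborel (ball c r)"
    using c(1) by (simp add: emeasure_ball)
  also have "\<dots> \<le> emeasure lborel A"
    using c(2) op by (intro emeasure_mono) auto
  finally show "emeasure lborel A > 0" .
  show "A \<in> sets borel" using op by simp
  show "A \<subseteq> cball 0 1" using assms by (auto simp: A_def)
qed

lemma ennreal_add_less_le_mono:
  fixes a b c d :: ennreal
  assumes "a < b" "c \<le> d" "d < \<infinity>"
  shows "a + c < b + d"
proof -
  have "a + c \<le> a + d" using assms(2) by (rule add_left_mono)
  also have "\<dots> < b + d"
    using assms(1,3) by (simp add: add.commute[of _ d] ennreal_add_left_cancel_less less_top[symmetric])
  finally show ?thesis .
qed

section \<open>The radii of the support of a minimizer\<close>

locale radial_minimizer = weighted_minimizer s h \<nu>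
  for s :: real and h :: "real ^ 'n \<Rightarrow> ennreal" and \<nu> :: "(real ^ 'n) measure" +
  fixes q :: "real \<Rightarrow> ennreal"
  assumes dim: "CARD('n) \<ge> 2" and s_gt: "s + 2 > real CARD('n)"
    and h_radial: "\<And>y. norm y \<le> 1 \<Longrightarrow> h y = q (norm y)"
    and h_outside: "\<And>y. norm y > 1 \<Longrightarrow> h y = 0"
    and h_lsc: "lower_semicontinuous_on (cball 0 1) h"
    and q_convex: "ennreal_convex_on {0..1} q"
    and q_finite: "\<exists>c\<in>{0..1}. \<exists>c'\<in>{0..1}. c \<noteq> c' \<and> q c < \<infinity> \<and> q c' < \<infinity>"
begin

lemma h_orthogonal: "orthogonal_transformation T \<Longrightarrow> h (T y) = h y"
  by (cases "norm y \<le> 1") (simp_all add: h_radial h_outside orthogonal_transformation)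

text \<open>The equal mixture of \<nu> and its image has the same field integral, so minimality
  bounds the energy of \<nu> by the mean of that energy and the mutual energy. Hence the mutual
  energy is at least the energy, and strict convexity identifies the two measures.\<close>

lemma minimizer_invariant:
  assumes T: "orthogonal_transformation T"
  shows "distr \<nu> borel T = \<nu>"
proof -
  note [measurable] = orthogonal_transformation_measurable[OF T]
  define N where "N = distr \<nu> borel T"
  have N: "prob_space N" "sets N = sets borel"
    unfolding N_def by (auto intro!: prob_space_distr)
  interpret N: prob_space N by (rule N)
  have energy: "mutual_energy s N N = mutual_energy s \<nu> \<nu>"
    unfolding N_def using prob sets_nu dist_orthogonal_transformation[OF T]
    by (intro mutual_energy_distr_isometry) auto
  have field: "(\<integral>\<^sup>+x. h x \<partial>N) = (\<integral>\<^sup>+x. h x \<partial>\<nu>)"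
    unfolding N_def by (subst nn_integral_distr) (auto simp: h_orthogonal[OF T])
  have cball: "(indicator (cball 0 1) :: real ^ 'n \<Rightarrow> ennreal) \<in> borel_measurable borel"
    by (rule borel_measurable_indicator) simp
  have Ncball: "emeasure N (cball 0 1) = 1"
  proof -
    have "T -` cball 0 1 \<inter> space \<nu> = cball 0 1"
      using T sets_eq_imp_space_eq[OF sets_nu] by (auto simp: orthogonal_transformation)
    then show ?thesis unfolding N_def using conc by (subst emeasure_distr) auto
  qed
  define c :: real where "c = 1/2"
  have half: "0 \<le> c" "c \<le> 1" "0 \<le> 1 - c" by (auto simp: c_def)
  note mix = half(1,2) prob sets_nu N
  let ?m = "mixture c \<nu> N"
  have h2: "ennreal (1 - c) + ennreal c = 1"
    using half by (subst ennreal_plus[symmetric]) auto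
  have "emeasure ?m (cball 0 1) = (\<integral>\<^sup>+x. indicator (cball 0 1) x \<partial>?m)"
    using sets_mixture[OF mix] by simp
  also have "\<dots> = 1"
    unfolding nn_integral_mixture[OF mix cball] using conc Ncball h2 by (simp add: sets_nu N(2))
  finally have "mutual_energy s \<nu> \<nu> + 2 * (\<integral>\<^sup>+x. h x \<partial>\<nu>) \<le> mutual_energy s ?m ?m + 2 * (\<integral>\<^sup>+x. h x \<partial>?m)"
    using sets_mixture[OF mix] prob_space_mixture[OF mix] by (intro minimal) auto
  also have "(\<integral>\<^sup>+x. h x \<partial>?m) = (\<integral>\<^sup>+x. h x \<partial>\<nu>)"
    unfolding nn_integral_mixture[OF mix h_measurable] field distrib_right[symmetric] h2 by simp
  \<comment> \<open>The field term cancels because its integral is finite.\<close>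
  finally have le: "mutual_energy s \<nu> \<nu> \<le> mutual_energy s ?m ?m"
    using field_finite by (simp add: ennreal_mult_eq_top_iff less_top[symmetric] add.commute[of _ "2 * _"])
  obtain I where I: "mutual_energy s \<nu> \<nu> = ennreal I" "0 \<le> I"
    using energy_finite by (auto simp: less_top_ennreal)
  have le2: "mutual_energy s \<nu> \<nu> + mutual_energy s N N \<le> 2 * mutual_energy s \<nu> N"
  proof (cases "mutual_energy s \<nu> N")
    case (real J)
    have "ennreal I \<le> ennreal (1 - c) * (ennreal (1 - c) * ennreal I + ennreal c * ennreal J) +
        ennreal c * (ennreal (1 - c) * ennreal J + ennreal c * ennreal I)"
      using le unfolding mutual_energy_mixture[OF mix] energy I(1) real(2) .
    then have "ennreal I \<le> ennreal ((1 - c) * ((1 - c) * I + c * J) + c * ((1 - c) * J + c * I))"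
      using I(2) real(1)
      using half
      by (simp only: ennreal_mult'[symmetric] ennreal_plus[symmetric] mult_nonneg_nonneg add_nonneg_nonneg)
    then have "I \<le> (1 - c) * ((1 - c) * I + c * J) + c * ((1 - c) * J + c * I)"
      using I(2) real(1) half by (subst (asm) ennreal_le_iff) auto
    then have "I \<le> J" by (simp add: c_def field_simps)
    then show ?thesis
      unfolding energy I(1) real(2) using I(2) real(1)
      unfolding mult_2 by (intro add_mono ennreal_leI)
  qed (simp add: ennreal_mult_top)
  have "\<nu> = N"
    using le2 energy energy_finite s_pos N sets_nu finite_measure_axioms N.finite_measure_axioms
    by (intro mutual_energy_eq_imp_eq[of \<nu> N s]) auto
  then show ?thesis by (simp add: N_def)
qed

sublocale orth: orth_invariant_measure \<nu>
  by unfold_locales (simp_all add: sets_nu minimizer_invariant)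

abbreviation e0 :: "real ^ 'n" where "e0 \<equiv> orth_invariant_measure.axis0"

lemma potential_orthogonal:
  assumes T: "orthogonal_transformation T"
  shows "potential s \<nu> (T x) = potential s \<nu> x"
proof -
  note [measurable] = orthogonal_transformation_measurable[OF T]
  note kernel = riesz_kernel_isometry[of T, OF dist_orthogonal_transformation[OF T]]
  have "potential s \<nu> (T x) = (\<integral>\<^sup>+y. riesz_kernel s (T x) y \<partial>distr \<nu> borel T)"
    unfolding minimizer_invariant[OF T] potential_def ..
  also have "\<dots> = potential s \<nu> x"
    unfolding potential_def by (subst nn_integral_distr) (auto simp: kernel)
  finally show ?thesis .
qed

lemma potential_norm: "potential s \<nu> x = potential s \<nu> (norm x *\<^sub>R e0)"
proof -
  obtain T where "orthogonal_transformation T" "T (norm x *\<^sub>R e0) = x"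
    by (rule orthogonal_transformation_exists[of "norm x *\<^sub>R e0" x]) auto
  then show ?thesis using potential_orthogonal by metis
qed

definition pot :: "real \<Rightarrow> ennreal" where
  "pot r = potential s \<nu> (r *\<^sub>R e0)"

lemma total_potential_radial: "norm x \<le> 1 \<Longrightarrow> total_potential x = pot (norm x) + q (norm x)"
  unfolding total_potential_def pot_def by (simp add: potential_norm[symmetric] h_radial)

definition radii :: "real set" where
  "radii = norm ` measure_support \<nu>"

lemma support_subset_cball: "measure_support \<nu> \<subseteq> cball 0 1"
  using prob sets_nu conc by (intro measure_support_subset_closed) auto

lemma compact_radii: "compact radii"
proof -
  have "compact (measure_support \<nu>)"
    using support_subset_cball closed_measure_support
    by (metis bounded_cball bounded_subset compact_eq_bounded_closed)
  then show ?thesis unfolding radii_def by (intro compact_continuous_image continuous_intros)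
qed

lemma radii_bounds: "r \<in> radii \<Longrightarrow> 0 \<le> r \<and> r \<le> 1"
  using support_subset_cball by (auto simp: radii_def)

lemma AE_radii: "AE y in \<nu>. norm y \<in> radii"
  using AE_measure_support[OF sets_nu] by eventually_elim (simp add: radii_def)

lemma radii_nonempty: "radii \<noteq> {}"
proof
  assume "radii = {}"
  then have "AE y in \<nu>. False" using AE_radii by simp
  then show False by (simp add: eventually_False ae_filter_eq_bot_iff emeasure_space_1)
qed

text \<open>By invariance, a neighbourhood of \<open>y\<close> has the same mass as its preimage
  under a rotation \<open>T\<close> taking a support point of equal norm to
  \<open>y\<close>.\<close>

lemma support_eq_radii: "measure_support \<nu> = {y. norm y \<in> radii}"
proof (intro equalityI subsetI)
  fix y :: "real ^ 'n" assume "y \<in> {y. norm y \<in> radii}"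
  then obtain x where x: "x \<in> measure_support \<nu>" "norm x = norm y" by (auto simp: radii_def)
  obtain T where T: "orthogonal_transformation T" "T x = y"
    using orthogonal_transformation_exists[OF x(2)] .
  note [measurable] = orthogonal_transformation_measurable[OF T(1)]
  show "y \<in> measure_support \<nu>"
    unfolding measure_support_def
  proof (intro CollectI allI impI)
    fix U assume U: "open U \<and> y \<in> U"
    have "continuous_on UNIV T"
      using T(1) by (intro linear_continuous_on) (simp add: orthogonal_transformation_linear linear_conv_bounded_linear[symmetric])
    then have "open (T -` U)" using U by (simp add: open_vimage)
    then have "emeasure \<nu> (T -` U) > 0" using x(1) U T(2) by (auto simp: measure_support_def)
    moreover have "emeasure (distr \<nu> borel T) U = emeasure \<nu> (T -` U \<inter> space \<nu>)"
      using U by (intro emeasure_distr) auto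
    ultimately show "emeasure \<nu> U > 0"
      unfolding minimizer_invariant[OF T(1)] using sets_eq_imp_space_eq[OF sets_nu] by simp
  qed
qed (auto simp: radii_def)

lemma pot_le_robin:
  assumes r: "r \<in> radii"
  shows "pot r + q r \<le> robin"
proof -
  have b: "0 \<le> r" "r \<le> 1" using radii_bounds[OF r] by auto
  then have n: "norm (r *\<^sub>R e0) = r" by simp
  then have "r *\<^sub>R e0 \<in> measure_support \<nu>" using r by (simp add: support_eq_radii)
  from total_potential_le_on_support[OF this _ h_lsc] show ?thesis
    using total_potential_radial[of "r *\<^sub>R e0"] b n by simp
qed

lemma pot_finite: "r \<in> radii \<Longrightarrow> pot r < \<infinity>" "r \<in> radii \<Longrightarrow> q r < \<infinity>"
  using pot_le_robin[of r] robin_finite by (auto simp: less_top[symmetric] top_unique)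

lemma shell_test:
  assumes "0 \<le> \<alpha>" "\<alpha> < \<beta>" "\<beta> \<le> 1"
  shows "\<exists>r. \<alpha> < r \<and> r < \<beta> \<and> robin \<le> pot r + q r"
proof -
  obtain x where "\<alpha> < norm x" "norm x < \<beta>" "robin \<le> total_potential x"
    using lborel_test[OF open_shell[OF assms]] by auto
  then show ?thesis
    using total_potential_radial[of x] assms by (intro exI[of _ "norm x"]) auto
qed

lemma mass_one: "measure \<nu> UNIV > 0"
  using prob_space sets_eq_imp_space_eq[OF sets_nu] by simp

lemma q_convex_ineq:
  assumes "x \<in> {0..1}" "y \<in> {0..1}" "0 \<le> \<theta>" "\<theta> \<le> 1"
  shows "q ((1 - \<theta>) * x + \<theta> * y) \<le> ennreal (1 - \<theta>) * q x + ennreal \<theta> * q y"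
  using q_convex assms unfolding ennreal_convex_on_def
  by (elim conjE) (drule bspec[of _ _ x], assumption, drule bspec[of _ _ y], assumption,
    drule spec[of _ "1 - \<theta>"], simp)

lemma radii_interval:
  assumes r: "r1 \<in> radii" "r2 \<in> radii" "r1 < r" "r < r2"
  shows "r \<in> radii"
proof (rule ccontr)
  assume nr: "r \<notin> radii"
  have cl: "compact (radii \<inter> {..r})" "compact (radii \<inter> {r..})"
    using compact_radii by (auto intro: compact_Int_closed)
  \<comment> \<open>\<open>a\<close> and \<open>b\<close> are the ends of the gap that contains
    \<open>r\<close>; compactness places them in \<open>radii\<close>.\<close>
  obtain a where a: "a \<in> radii" "a \<le> r" "\<And>t. t \<in> radii \<Longrightarrow> t \<le> r \<Longrightarrow> t \<le> a"
  proof -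
    have "radii \<inter> {..r} \<noteq> {}" using r by auto
    from compact_attains_sup[OF cl(1) this] show thesis using that by auto
  qed
  obtain b where b: "b \<in> radii" "r \<le> b" "\<And>t. t \<in> radii \<Longrightarrow> r \<le> t \<Longrightarrow> b \<le> t"
  proof -
    have "radii \<inter> {r..} \<noteq> {}" using r by auto
    from compact_attains_inf[OF cl(2) this] show thesis using that by auto
  qed
  have ab: "a < r" "r < b" "0 \<le> a" "b \<le> 1"
    using a b nr radii_bounds[of a] radii_bounds[of b] by (auto simp: less_le)
  have gap: "AE y in \<nu>. norm y \<le> a \<or> b \<le> norm y"
    using AE_radii by eventually_elim (use a(3) b(3) in force)
  note fin = pot_finite[OF a(1)] pot_finite[OF b(1)]
  obtain R where R: "robin = ennreal R" "0 \<le> R" using robin_finite by (auto simp: less_top_ennreal)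
  obtain qa where qa: "q a = ennreal qa" "0 \<le> qa" using fin by (auto simp: less_top_ennreal)
  obtain qb where qb: "q b = ennreal qb" "0 \<le> qb" using fin by (auto simp: less_top_ennreal)
  have pa: "pot a = ennreal (orth.radial s a)" and pb: "pot b = ennreal (orth.radial s b)"
    using fin unfolding pot_def by (auto intro: orth.potential_radial_finite)
  have nn: "0 \<le> orth.radial s t" for t
    unfolding orth.radial_def by (intro integral_nonneg_AE) auto
  have ea: "orth.radial s a + qa \<le> R" and eb: "orth.radial s b + qb \<le> R"
    using pot_le_robin[OF a(1)] pot_le_robin[OF b(1)] R qa qb nn
    by (simp_all add: pa pb ennreal_plus[symmetric] del: ennreal_plus)
  \<comment> \<open>The contradiction is reached at this point of the gap, in general different from
    \<open>r\<close>.\<close>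
  obtain t where t: "a < t" "t < b" "robin \<le> pot t + q t"
    using shell_test[of a b] ab by auto
  have cvx: "pot t = ennreal (orth.radial s t)"
      "orth.radial s t < ((b - t) * orth.radial s a + (t - a) * orth.radial s b) / (b - a)"
    using orth.potential_gap[OF gap ab(3) t(1,2) dim s_pos s_gt mass_one] fin by (auto simp: pot_def)
  define \<theta> where "\<theta> = (t - a) / (b - a)"
  have \<theta>: "0 \<le> \<theta>" "\<theta> \<le> 1" "(1 - \<theta>) * a + \<theta> * b = t" "1 - \<theta> = (b - t) / (b - a)"
  proof -
    show "0 \<le> \<theta>" "\<theta> \<le> 1" using t by (simp_all add: \<theta>_def)
    show 1: "1 - \<theta> = (b - t) / (b - a)" using t by (simp add: \<theta>_def diff_divide_eq_iff)
    have "(1 - \<theta>) * a + \<theta> * b = a + \<theta> * (b - a)" by (simp add: algebra_simps)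
    then show "(1 - \<theta>) * a + \<theta> * b = t" using t by (simp add: \<theta>_def)
  qed
  have "q t \<le> ennreal (1 - \<theta>) * q a + ennreal \<theta> * q b"
    using q_convex_ineq[of a b \<theta>] ab \<theta> by auto
  also have "\<dots> = ennreal ((1 - \<theta>) * qa + \<theta> * qb)"
  proof -
    have "0 \<le> 1 - \<theta>" using \<theta>(2) by simp
    then show ?thesis
      unfolding qa(1) qb(1) using qa(2) qb(2) \<theta>(1)
      by (simp only: ennreal_mult'[symmetric] ennreal_plus[symmetric] mult_nonneg_nonneg)
  qed
  finally have qt: "q t \<le> ennreal ((1 - \<theta>) * qa + \<theta> * qb)" .
  have nq: "0 \<le> (1 - \<theta>) * qa + \<theta> * qb"
    using qa qb \<theta>(1,2) by (intro add_nonneg_nonneg mult_nonneg_nonneg) auto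
  have "ennreal R \<le> ennreal (orth.radial s t) + q t" using t(3) by (simp add: cvx(1) R)
  also have "\<dots> \<le> ennreal (orth.radial s t) + ennreal ((1 - \<theta>) * qa + \<theta> * qb)"
    using qt by (rule add_left_mono)
  also have "\<dots> = ennreal (orth.radial s t + ((1 - \<theta>) * qa + \<theta> * qb))"
    using nn nq by (rule ennreal_plus[symmetric])
  finally have "R \<le> orth.radial s t + ((1 - \<theta>) * qa + \<theta> * qb)"
    using nn nq by (simp only: ennreal_le_iff add_nonneg_nonneg)
  moreover have "orth.radial s t < (1 - \<theta>) * orth.radial s a + \<theta> * orth.radial s b"
    using cvx(2) unfolding \<theta>(4) by (simp add: \<theta>_def add_divide_distrib)
  ultimately have "R < (1 - \<theta>) * (orth.radial s a + qa) + \<theta> * (orth.radial s b + qb)"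
    by (simp add: distrib_left)
  also have "\<dots> \<le> (1 - \<theta>) * R + \<theta> * R"
    using ea eb \<theta> by (intro add_mono mult_left_mono) auto
  also have "\<dots> = R" by (simp add: algebra_simps)
  finally show False by simp
qed

lemma radii_eq_interval: "radii = {Inf radii..Sup radii}" "Inf radii \<in> radii" "Sup radii \<in> radii"
proof -
  have c: "closed radii" "bounded radii" using compact_radii by (auto simp: compact_eq_bounded_closed)
  show i: "Inf radii \<in> radii" and u: "Sup radii \<in> radii"
    using c radii_nonempty by (auto intro: closed_contains_Inf closed_contains_Sup bounded_imp_bdd_above bounded_imp_bdd_below)
  have lu: "Inf radii \<le> t" "t \<le> Sup radii" if "t \<in> radii" for t
    using c that by (auto intro: cInf_lower cSup_upper bounded_imp_bdd_above bounded_imp_bdd_below)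
  show "radii = {Inf radii..Sup radii}"
  proof (intro equalityI subsetI)
    fix t assume "t \<in> {Inf radii..Sup radii}"
    then show "t \<in> radii"
      using radii_interval[OF i u, of t] i u by (cases "t = Inf radii \<or> t = Sup radii") auto
  qed (use lu in auto)
qed

text \<open>The chord bound for convex \<open>q\<close> from \<open>a\<close> towards one point
  \<open>c\<close> of finite value, with the weight of \<open>q a\<close> enlarged to 1. On the
  other side of \<open>a\<close> the field may be infinite; as \<open>c\<close> can lie on either
  side, the potential has to be steep on both.\<close>

lemma q_slope:
  assumes a: "a \<in> {0..1}" and c: "c \<in> {0..1}" "c \<noteq> a" "q c = ennreal qc" "0 \<le> qc"
    and t: "\<bar>t - a\<bar> \<le> \<bar>c - a\<bar>" "(t - a) * (c - a) \<ge> 0"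
  shows "q t \<le> q a + ennreal (\<bar>t - a\<bar> * (qc / \<bar>c - a\<bar>))"
proof -
  define \<theta> where "\<theta> = \<bar>t - a\<bar> / \<bar>c - a\<bar>"
  have \<theta>: "0 \<le> \<theta>" "\<theta> \<le> 1" using t c by (auto simp: \<theta>_def divide_le_eq_1)
  have "\<theta> = (t - a) / (c - a)"
  proof (cases "c > a")
    case True
    then have "t \<ge> a" using t(2) by (simp add: zero_le_mult_iff)
    then show ?thesis using True by (simp add: \<theta>_def)
  next
    case False
    then have ca: "c < a" using c(2) by simp
    then have "t \<le> a" using t(2) by (simp add: zero_le_mult_iff)
    then have "\<theta> = (- (t - a)) / (- (c - a))" using ca by (simp add: \<theta>_def)
    then show ?thesis by (simp only: minus_divide_divide)
  qed
  then have "\<theta> * (c - a) = t - a" using c(2) by simp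
  then have eq: "(1 - \<theta>) * a + \<theta> * c = t" by (simp add: algebra_simps)
  have "q t \<le> ennreal (1 - \<theta>) * q a + ennreal \<theta> * q c"
    using q_convex_ineq[OF a c(1) \<theta>] unfolding eq .
  also have "\<dots> \<le> 1 * q a + ennreal \<theta> * q c"
    using \<theta> by (intro add_right_mono mult_right_mono) (auto simp: ennreal_le_1)
  also have "ennreal \<theta> * q c = ennreal (\<bar>t - a\<bar> * (qc / \<bar>c - a\<bar>))"
    using \<theta> c by (simp add: \<theta>_def flip: ennreal_mult)
  finally show ?thesis by simp
qed

lemma radii_nontrivial: "Inf radii < Sup radii"
proof (rule ccontr)
  assume neg: "\<not> ?thesis"
  define a where "a = Inf radii"
  have ra: "a \<in> radii" using radii_eq_interval by (simp add: a_def)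
  then have rad: "radii = {a}"
  proof -
    have "x = a" if "x \<in> radii" for x
    proof -
      have "x \<in> {Inf radii..Sup radii}" using that radii_eq_interval(1) by blast
      then show ?thesis using neg by (simp add: a_def)
    qed
    then show ?thesis using ra by blast
  qed
  have a01: "0 \<le> a" "a \<le> 1" using radii_bounds[OF ra] by auto
  have sph: "AE y in \<nu>. norm y = a" using AE_radii rad by simp
  have fin: "potential s \<nu> (a *\<^sub>R e0) < \<infinity>" "q a < \<infinity>" using pot_finite[OF ra] by (auto simp: pot_def)
  \<comment> \<open>For \<open>a = 0\<close> the measure would be a point mass, whose potential at 0
    is infinite.\<close>
  have "a \<noteq> 0"
  proof
    assume "a = 0"
    then have "AE y in \<nu>. y \<noteq> 0" using orth.potential_finite(1)[OF fin(1)] by simp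
    with sph have "AE y in \<nu>. False" by eventually_elim (use \<open>a = 0\<close> in simp)
    then show False by (simp add: eventually_False ae_filter_eq_bot_iff emeasure_space_1)
  qed
  then have a: "a > 0" using a01 by simp
  interpret S: sphere_measure \<nu> a s
    using a sph mass_one s_pos s_gt fin by unfold_locales auto
  obtain c where c: "c \<in> {0..1}" "c \<noteq> a" "q c < \<infinity>" using q_finite by metis
  obtain qc where qc: "q c = ennreal qc" "0 \<le> qc" using c by (auto simp: less_top_ennreal)
  obtain qa where qa: "q a = ennreal qa" "0 \<le> qa" using fin by (auto simp: less_top_ennreal)
  obtain R where R: "robin = ennreal R" "0 \<le> R" using robin_finite by (auto simp: less_top_ennreal)
  have nn: "0 \<le> orth.radial s t" for t
    unfolding orth.radial_def by (intro integral_nonneg_AE) auto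
  have "pot a = ennreal (orth.radial s a)"
    using fin unfolding pot_def by (auto intro: orth.potential_radial_finite)
  then have ea: "orth.radial s a + qa \<le> R"
    using pot_le_robin[OF ra] R qa nn by (simp add: ennreal_plus[symmetric] del: ennreal_plus)
  \<comment> \<open>The slope allowed by \<open>q_slope\<close>, plus 1 to obtain a strict
    inequality.\<close>
  define K where "K = qc / \<bar>c - a\<bar> + 1"
  have K: "K > 0" using qc c by (simp add: K_def add_nonneg_pos)
  have less: "pot t + q t < robin"
    if t: "t \<noteq> a" "\<bar>t - a\<bar> \<le> \<bar>c - a\<bar>" "(t - a) * (c - a) \<ge> 0" "0 \<le> t"
      and steep: "orth.radial s t + K * \<bar>t - a\<bar> \<le> orth.radial s a" for t
  proof -
    have "potential s \<nu> (t *\<^sub>R e0) = ennreal (orth.radial s t)"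
    proof -
      define \<delta> where "\<delta> = \<bar>t - a\<bar> / 2"
      have \<delta>: "\<delta> > 0" using t by (simp add: \<delta>_def)
      have "orth.separated (t - \<delta>) (t + \<delta>) \<delta>"
        unfolding orth.separated_def
      proof (intro conjI \<delta>)
        show "AE y in \<nu>. \<forall>u\<in>{t - \<delta><..<t + \<delta>}. \<delta> \<le> norm (u *\<^sub>R e0 - y)"
          using sph
        proof eventually_elim
          case (elim y)
          show ?case
          proof
            fix u assume u: "u \<in> {t - \<delta><..<t + \<delta>}"
            have "\<bar>\<bar>u\<bar> - a\<bar> \<le> norm (u *\<^sub>R e0 - y)"
              using orth.norm_scaleR_axis0_diff[of u y] elim by simp
            moreover have "\<delta> \<le> \<bar>\<bar>u\<bar> - a\<bar>"
            proof -
              have "\<bar>\<bar>u\<bar> - t\<bar> \<le> \<bar>u - t\<bar>" using abs_triangle_ineq3[of u t] t(4) by simp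
              moreover have "\<bar>u - t\<bar> < \<delta>" using u by (simp add: abs_less_iff)
              moreover have "\<bar>t - a\<bar> \<le> \<bar>\<bar>u\<bar> - t\<bar> + \<bar>\<bar>u\<bar> - a\<bar>"
                using abs_triangle_ineq4[of "\<bar>u\<bar> - a" "\<bar>u\<bar> - t"] by simp
              ultimately show ?thesis by (simp add: \<delta>_def)
            qed
            ultimately show "\<delta> \<le> norm (u *\<^sub>R e0 - y)" by simp
          qed
        qed
      qed
      then show ?thesis
        using \<delta> s_pos by (intro orth.potential_radial_sep[of "t - \<delta>" "t + \<delta>" \<delta>]) auto
    qed
    then have pt: "pot t = ennreal (orth.radial s t)" by (simp add: pot_def)
    have "q t \<le> ennreal (qa + \<bar>t - a\<bar> * (qc / \<bar>c - a\<bar>))"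
      using q_slope[of a c qc t] a01 c qc t qa by simp
    then have "pot t + q t \<le> ennreal (orth.radial s t) + ennreal (qa + \<bar>t - a\<bar> * (qc / \<bar>c - a\<bar>))"
      unfolding pt by (rule add_left_mono)
    also have "\<dots> = ennreal (orth.radial s t + (qa + \<bar>t - a\<bar> * (qc / \<bar>c - a\<bar>)))"
      using nn qa qc by (intro ennreal_plus[symmetric]) auto
    also have "\<dots> < ennreal R"
    proof (rule ennreal_lessI)
      have "K * \<bar>t - a\<bar> = \<bar>t - a\<bar> * (qc / \<bar>c - a\<bar>) + \<bar>t - a\<bar>"
        unfolding K_def by (simp only: distrib_right mult_1) (simp only: mult.commute)
      then show "orth.radial s t + (qa + \<bar>t - a\<bar> * (qc / \<bar>c - a\<bar>)) < R"
        using steep ea t(1) by linarith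
      then show "0 < R" using nn[of t] qa qc by (smt (verit) divide_nonneg_nonneg mult_nonneg_nonneg abs_ge_zero)
    qed
    finally show ?thesis by (simp add: R)
  qed
  show False
  proof (cases "c > a")
    case True
    obtain h0 where h0: "h0 > 0" "\<And>h. 0 < h \<Longrightarrow> h < h0 \<Longrightarrow> orth.radial s (a + h) + K * h \<le> orth.radial s a"
      using S.radial_steep_right[OF K] by blast
    define \<beta> where "\<beta> = min c (a + h0)"
    obtain t where t: "a < t" "t < \<beta>" "robin \<le> pot t + q t"
    proof -
      have "a < \<beta>" "\<beta> \<le> 1" using True h0(1) c(1) by (auto simp: \<beta>_def min_le_iff_disj)
      then show thesis using shell_test[of a \<beta>] a that by auto
    qed
    have "pot t + q t < robin"
      using t True a h0(2)[of "t - a"] by (intro less) (auto simp: \<beta>_def)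
    then show False using t(3) by simp
  next
    case False
    obtain h0 where h0: "h0 > 0" "\<And>h. 0 < h \<Longrightarrow> h < h0 \<Longrightarrow> orth.radial s (a - h) + K * h \<le> orth.radial s a"
      using S.radial_steep_left[OF K] by blast
    define \<alpha> where "\<alpha> = max c (a - h0)"
    have ca: "c < a" using False c by simp
    obtain t where t: "\<alpha> < t" "t < a" "robin \<le> pot t + q t"
    proof -
      have "0 \<le> \<alpha>" "\<alpha> < a" using ca h0(1) c(1) by (auto simp: \<alpha>_def le_max_iff_disj)
      then show thesis using shell_test[of \<alpha> a] a01 that by auto
    qed
    have "pot t + q t < robin"
      using t ca c h0(2)[of "a - t"] by (intro less) (auto simp: \<alpha>_def mult_nonpos_nonpos)
    then show False using t(3) by simp
  qed
qed

lemma radii_increasing: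
  assumes q: "mono_on {0..1} q"
  shows "Inf radii = 0"
proof (rule ccontr)
  assume n0: "Inf radii \<noteq> 0"
  define a where "a = Inf radii"
  have ra: "a \<in> radii" using radii_eq_interval by (simp add: a_def)
  have a: "0 < a" "a \<le> 1" using radii_bounds[OF ra] n0 by (auto simp: a_def)
  interpret O: outer_measure \<nu> a
  proof
    show "AE y in \<nu>. a \<le> norm y"
      using AE_radii by eventually_elim (use radii_eq_interval in \<open>auto simp: a_def\<close>)
  qed (use a in auto)
  obtain t where t: "0 < t" "t < a" "robin \<le> pot t + q t"
    using shell_test[of 0 a] a by auto
  have "pot t < pot a"
    using O.potential_strict_increasing[of t s] t dim s_pos s_gt mass_one pot_finite(1)[OF ra]
    by (simp add: pot_def)
  moreover have "q t \<le> q a" using q t a by (auto intro: mono_onD)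
  ultimately have "pot t + q t < pot a + q a"
    using pot_finite[OF ra] by (intro ennreal_add_less_le_mono) auto
  then show False using t(3) pot_le_robin[OF ra] by simp
qed

lemma radii_decreasing:
  assumes q: "antimono_on {0..1} q"
  shows "Sup radii = 1"
proof (rule ccontr)
  assume n1: "Sup radii \<noteq> 1"
  define b where "b = Sup radii"
  have rb: "b \<in> radii" using radii_eq_interval by (simp add: b_def)
  have b: "0 \<le> b" "b < 1" using radii_bounds[OF rb] n1 by (auto simp: b_def)
  interpret I: inner_measure \<nu> b
  proof
    show "AE y in \<nu>. norm y \<le> b"
      using AE_radii by eventually_elim (use radii_eq_interval in \<open>auto simp: b_def\<close>)
  qed (use b in auto)
  obtain t where t: "b < t" "t < 1" "robin \<le> pot t + q t"
    using shell_test[of b 1] b by auto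
  have "pot t < pot b"
    using I.potential_strict_decreasing[of t s] t s_pos s_gt mass_one pot_finite(1)[OF rb]
    by (simp add: pot_def)
  moreover have "q t \<le> q b" using q t b by (auto intro: monotone_onD)
  ultimately have "pot t + q t < pot b + q b"
    using pot_finite[OF rb] by (intro ennreal_add_less_le_mono) auto
  then show False using t(3) pot_le_robin[OF rb] by simp
qed

end

section \<open>From the disk to the ball of one dimension less\<close>

text \<open>As \<open>f\<close> is 0 off \<open>A\<close>, each superlevel set is the intersection
  of the closed set \<open>A\<close> with an open one.\<close>

lemma borel_measurable_lsc_on:
  fixes f :: "'a::topological_space \<Rightarrow> ennreal"
  assumes A: "closed A" and lsc: "lower_semicontinuous_on A f" and out: "\<And>x. x \<notin> A \<Longrightarrow> f x = 0"
  shows "f \<in> borel_measurable borel"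
proof (rule borel_measurableI_greater)
  fix c :: ennreal
  have "\<exists>G. open G \<and> x \<in> G \<and> G \<inter> A \<subseteq> {x. c < f x}" if "x \<in> A" "c < f x" for x
  proof -
    have "eventually (\<lambda>y. c < f y) (at x within A)"
      using lsc that unfolding lower_semicontinuous_on_def by blast
    then obtain G where "open G" "x \<in> G" "\<And>y. y \<in> G \<Longrightarrow> y \<noteq> x \<Longrightarrow> y \<in> A \<Longrightarrow> c < f y"
      unfolding eventually_at_topological by blast
    then show ?thesis using that by (intro exI[of _ G]) auto
  qed
  then obtain G where G: "\<And>x. x \<in> A \<Longrightarrow> c < f x \<Longrightarrow> open (G x) \<and> x \<in> G x \<and> G x \<inter> A \<subseteq> {x. c < f x}"
    by metis
  define V where "V = (\<Union>x\<in>{x \<in> A. c < f x}. G x)"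
  have "open V" using G unfolding V_def by blast
  have 1: "x \<in> A \<inter> V" if "c < f x" for x
  proof -
    have "x \<in> A" using that out[of x] by force
    then show ?thesis using that G by (auto simp: V_def)
  qed
  have 2: "c < f x" if x: "x \<in> A \<inter> V" for x
  proof -
    obtain z where z: "z \<in> A" "c < f z" "x \<in> G z" using x by (auto simp: V_def)
    then have "G z \<inter> A \<subseteq> {x. c < f x}" using G by blast
    then show ?thesis using z x by blast
  qed
  have "{x \<in> space borel. c < f x} = A \<inter> V"
  proof (intro equalityI subsetI)
    show "x \<in> A \<inter> V" if "x \<in> {x \<in> space borel. c < f x}" for x
      by (rule 1) (use that in blast)
    show "x \<in> {x \<in> space borel. c < f x}" if "x \<in> A \<inter> V" for x
      using 2[OF that] by simp
  qed
  then show "{x \<in> space borel. c < f x} \<in> sets borel"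
    using A \<open>open V\<close> by auto
qed

lemma measurable_Pair_zero [measurable]: "Pair (0::real) \<in> (borel :: (real ^ 'n) measure) \<rightarrow>\<^sub>M borel"
  by (intro borel_measurable_continuous_onI continuous_intros)

lemma riesz_energy_eq: "riesz_energy s M = mutual_energy s M M"
  by (simp add: riesz_energy_def mutual_energy_def)

lemma unit_disk_eq: "unit_disk = {0} \<times> cball (0 :: real ^ 'n) 1"
  by (auto simp: unit_disk_def)

lemma disk_field_measurable:
  fixes Q :: "real \<times> (real ^ 'n) \<Rightarrow> ennreal"
  assumes Q: "lower_semicontinuous_on unit_disk Q"
  defines "h \<equiv> \<lambda>y. Q (0, y) * indicator (cball 0 1) y"
  shows "lower_semicontinuous_on (cball 0 1) h" "h \<in> borel_measurable borel"
proof -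
  show lsc: "lower_semicontinuous_on (cball 0 1) h"
    unfolding lower_semicontinuous_on_def
  proof (intro ballI allI impI)
    fix y c assume y: "y \<in> cball (0 :: real ^ 'n) 1" "c < h y"
    then have "eventually (\<lambda>x. c < Q x) (at (0, y) within unit_disk)"
      using Q unfolding lower_semicontinuous_on_def by (auto simp: h_def unit_disk_eq)
    then obtain G where G: "open G" "(0, y) \<in> G" "\<And>x. x \<in> G \<Longrightarrow> x \<noteq> (0, y) \<Longrightarrow> x \<in> unit_disk \<Longrightarrow> c < Q x"
      unfolding eventually_at_topological by blast
    have "open (Pair 0 -` G)" using G(1) by (intro open_vimage continuous_intros)
    then show "eventually (\<lambda>y. c < h y) (at y within cball 0 1)"
      unfolding eventually_at_topological using G
      by (intro exI[of _ "Pair 0 -` G"]) (auto simp: h_def unit_disk_eq)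
  qed
  show "h \<in> borel_measurable borel"
    by (rule borel_measurable_lsc_on[OF closed_cball lsc]) (simp add: h_def)
qed

lemma disk_prob_measures_conc:
  fixes \<mu> :: "(real \<times> (real ^ 'n)) measure"
  assumes "\<mu> \<in> disk_prob_measures"
  shows "AE x in \<mu>. x \<in> unit_disk"
proof -
  have "sets \<mu> = sets borel" "measure_support \<mu> \<subseteq> unit_disk"
    using assms by (auto simp: disk_prob_measures_def)
  from AE_measure_support[OF this(1)] this(2) show ?thesis by (auto elim!: eventually_mono)
qed

text \<open>Almost every point has first coordinate 0, so projecting it away loses nothing and
  \<open>Pair 0\<close> restores the measure.\<close>

lemma disk_prob_measures_eq_distr:
  fixes \<mu> :: "(real \<times> (real ^ 'n)) measure"
  assumes mu: "\<mu> \<in> disk_prob_measures"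
  shows "prob_space (distr \<mu> borel snd)" "emeasure (distr \<mu> borel snd) (cball 0 1) = 1"
    "\<mu> = distr (distr \<mu> borel snd) borel (Pair 0)"
proof -
  have sets[measurable_cong]: "sets \<mu> = sets borel" and p: "prob_space \<mu>"
    using mu by (auto simp: disk_prob_measures_def)
  interpret prob_space \<mu> by (rule p)
  have [measurable]: "snd \<in> \<mu> \<rightarrow>\<^sub>M (borel :: (real ^ 'n) measure)"
    using measurable_cong_sets[OF sets refl] borel_measurable_continuous_onI[OF continuous_on_snd[OF continuous_on_id]] by auto
  note AE = disk_prob_measures_conc[OF mu]
  show "prob_space (distr \<mu> borel snd)" by (rule prob_space_distr) measurable
  then interpret D: prob_space "distr \<mu> borel snd" .
  have "AE y in distr \<mu> borel snd. y \<in> cball 0 1"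
    using AE by (subst AE_distr_iff) (auto elim!: eventually_mono simp: unit_disk_eq)
  then show "emeasure (distr \<mu> borel snd) (cball 0 1) = 1"
    by (intro D.emeasure_eq_1_AE) auto
  have "distr (distr \<mu> borel snd) borel (Pair (0::real)) = distr \<mu> borel (\<lambda>x. (0, snd x))"
    by (subst distr_distr) (auto simp: comp_def)
  also have "\<dots> = distr \<mu> \<mu> (\<lambda>x. x)"
  proof (rule distr_cong_AE)
    show "AE x in \<mu>. (0, snd x) = x" using AE by eventually_elim (auto simp: unit_disk_eq)
    show "(\<lambda>x. (0, snd x)) \<in> \<mu> \<rightarrow>\<^sub>M (borel :: (real \<times> (real ^ 'n)) measure)"
      using measurable_compose[OF _ measurable_Pair_zero, of snd \<mu>] by simp
  qed (auto simp: sets)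
  also have "\<dots> = \<mu>" by (rule distr_id2) simp
  finally show "\<mu> = distr (distr \<mu> borel snd) borel (Pair 0)" by simp
qed

lemma measure_support_distr_Pair:
  fixes N :: "(real ^ 'n) measure"
  assumes N: "sets N = sets borel"
  shows "measure_support (distr N borel (Pair (0::real))) = {0} \<times> measure_support N"
proof (intro equalityI subsetI)
  note [measurable_cong] = N
  have sp: "space N = UNIV" using sets_eq_imp_space_eq[OF N] by simp
  have em: "emeasure (distr N borel (Pair (0::real))) W = emeasure N (Pair 0 -` W)" if "open W" for W
    using that by (subst emeasure_distr) (auto simp: sp)
  fix x assume x: "x \<in> measure_support (distr N borel (Pair (0::real)))"
  obtain t y where xy: "x = (t, y)" by (cases x)
  have "t = 0"
  proof (rule ccontr)
    assume "t \<noteq> 0"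
    then have "x \<in> (- {0}) \<times> UNIV" by (simp add: xy)
    moreover have op: "open ((- {0::real}) \<times> (UNIV :: (real ^ 'n) set))" by (intro open_Times open_Compl) auto
    ultimately have "emeasure N (Pair 0 -` ((- {0}) \<times> UNIV)) > 0"
      using x em[OF op] by (auto simp: measure_support_def)
    then show False by simp
  qed
  moreover have "y \<in> measure_support N"
    unfolding measure_support_def
  proof (intro CollectI allI impI)
    fix V assume V: "open V \<and> y \<in> V"
    then have op: "open (UNIV \<times> V :: (real \<times> (real ^ 'n)) set)" by (intro open_Times) auto
    have "0 < emeasure (distr N borel (Pair (0::real))) (UNIV \<times> V)"
      using x V op by (auto simp: measure_support_def xy)
    also have "\<dots> = emeasure N V" unfolding em[OF op] by (simp add: vimage_def)
    finally show "0 < emeasure N V" .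
  qed
  ultimately show "x \<in> {0} \<times> measure_support N" by (simp add: xy)
next
  note [measurable_cong] = N
  have sp: "space N = UNIV" using sets_eq_imp_space_eq[OF N] by simp
  fix x assume "x \<in> {0::real} \<times> measure_support N"
  then obtain y where y: "x = (0, y)" "y \<in> measure_support N" by auto
  show "x \<in> measure_support (distr N borel (Pair (0::real)))"
    unfolding measure_support_def
  proof (intro CollectI allI impI)
    fix W assume W: "open W \<and> x \<in> W"
    then have "open (Pair 0 -` W)" by (intro open_vimage continuous_intros) auto
    then have "emeasure N (Pair 0 -` W) > 0" using y W by (auto simp: measure_support_def)
    then show "emeasure (distr N borel (Pair (0::real))) W > 0"
      using W by (subst emeasure_distr) (auto simp: sp)
  qed
qed

lemma distr_Pair_in_disk_prob_measures:
  fixes N :: "(real ^ 'n) measure"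
  assumes N: "prob_space N" "sets N = sets borel" "emeasure N (cball 0 1) = 1"
  shows "distr N borel (Pair 0) \<in> disk_prob_measures"
proof -
  interpret prob_space N by fact
  note [measurable_cong] = N(2)
  have "measure_support N \<subseteq> cball 0 1"
    using N by (intro measure_support_subset_closed) auto
  then show ?thesis
    by (auto simp: disk_prob_measures_def unit_disk_eq measure_support_distr_Pair[OF N(2)] intro!: prob_space_distr)
qed

text \<open>\<open>Pair 0\<close> is an isometry, so the energies agree; the field integral over
  \<open>unit_disk\<close> becomes that of \<open>h\<close>, the field cut off outside the
  ball.\<close>

lemma weighted_energy_distr_Pair:
  fixes N :: "(real ^ 'n) measure" and Q :: "real \<times> (real ^ 'n) \<Rightarrow> ennreal"
  assumes N: "prob_space N" "sets N = sets borel" and Q: "lower_semicontinuous_on unit_disk Q"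
  defines "h \<equiv> \<lambda>y. Q (0, y) * indicator (cball 0 1) y"
  shows "weighted_energy s Q (distr N borel (Pair 0)) = mutual_energy s N N + 2 * (\<integral>\<^sup>+y. h y \<partial>N)"
proof -
  note [measurable_cong] = N(2)
  have [measurable]: "h \<in> borel_measurable borel"
    unfolding h_def by (rule disk_field_measurable[OF Q])
  have iso: "mutual_energy s (distr N borel (Pair (0::real))) (distr N borel (Pair 0)) = mutual_energy s N N"
    using N by (intro mutual_energy_distr_isometry) (auto simp: dist_Pair_Pair)
  \<comment> \<open>\<open>Q\<close> is arbitrary off the disk, so measurability is established for
    this expression in \<open>h\<close>, which agrees with the integrand restricted to the
    disk.\<close>
  have "(\<lambda>x. if fst x = 0 then h (snd x) else 0) \<in> borel_measurable ((borel :: real measure) \<Otimes>\<^sub>M (borel :: (real ^ 'n) measure))"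
    by measurable
  then have [measurable]: "(\<lambda>x. if fst x = 0 then h (snd x) else 0) \<in> borel_measurable (borel :: (real \<times> (real ^ 'n)) measure)"
    by (simp add: borel_prod)
  have "(\<integral>\<^sup>+x\<in>unit_disk. Q x \<partial>distr N borel (Pair 0)) = (\<integral>\<^sup>+x. (if fst x = 0 then h (snd x) else 0) \<partial>distr N borel (Pair (0::real)))"
    by (intro nn_integral_cong) (auto simp: h_def unit_disk_eq indicator_def)
  also have "\<dots> = (\<integral>\<^sup>+y. h y \<partial>N)"
    by (subst nn_integral_distr) auto
  finally show ?thesis by (simp add: weighted_energy_def riesz_energy_eq iso)
qed

text \<open>If at most one radius had a finite value, the set where \<open>Q\<close> is finite would
  lie on a sphere, a null set. Two radii are wanted so that one of them differs from the radius of a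
  hypothetical support on a single sphere.\<close>

lemma external_field_radial_finite:
  fixes Q :: "real \<times> (real ^ 'n) \<Rightarrow> ennreal"
  assumes Q: "external_field Q" and radial: "\<And>y. norm y \<le> 1 \<Longrightarrow> Q (0, y) = q (norm y)"
  shows "\<exists>c\<in>{0..1}. \<exists>c'\<in>{0..1}. c \<noteq> c' \<and> q c < \<infinity> \<and> q c' < \<infinity>"
proof (rule ccontr)
  assume "\<not> ?thesis"
  then have uniq: "c = c'" if "c \<in> {0..1}" "c' \<in> {0..1}" "q c < \<infinity>" "q c' < \<infinity>" for c c'
    using that by blast
  let ?F = "{x \<in> unit_disk. Q x < \<infinity>}"
  have "emeasure hyperplane_surface_measure ?F \<noteq> 0"
    using Q by (simp add: external_field_def zero_less_iff_neq_zero)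
  \<comment> \<open>\<open>emeasure\<close> is 0 on nonmeasurable sets, so a nonzero value also
    yields measurability.\<close>
  then have Fs: "?F \<in> sets (hyperplane_surface_measure :: (real \<times> (real ^ 'n)) measure)"
    using emeasure_notin_sets by blast
  have "emeasure hyperplane_surface_measure ?F = emeasure lborel (Pair (0::real) -` ?F \<inter> space (lborel :: (real ^ 'n) measure))"
    using Fs unfolding hyperplane_surface_measure_def by (intro emeasure_distr) auto
  also have "\<dots> = 0"
  proof -
    obtain c where c: "Pair (0::real) -` ?F \<subseteq> sphere 0 c"
    proof (cases "Pair (0::real) -` ?F = {}")
      case False
      then obtain y0 where y0: "(0, y0) \<in> ?F" by auto
      have "Pair (0::real) -` ?F \<subseteq> sphere 0 (norm y0)"
      proof
        fix y assume "y \<in> Pair (0::real) -` ?F"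
        then have "norm y = norm y0"
          using y0 radial[of y] radial[of y0] by (intro uniq) (auto simp: unit_disk_eq)
        then show "y \<in> sphere 0 (norm y0)" by simp
      qed
      then show thesis using that by blast
    qed (use that in blast)
    have "emeasure lborel (sphere (0 :: real ^ 'n) c) = 0"
      using negligible_sphere[of "0 :: real ^ 'n" c] closed_sphere[of "0 :: real ^ 'n" c]
      by (simp add: negligible_iff_null_sets null_sets_def emeasure_completion)
    then have "emeasure lborel (Pair (0::real) -` ?F \<inter> space (lborel :: (real ^ 'n) measure)) \<le> 0"
      using c emeasure_mono[of "Pair (0::real) -` ?F \<inter> space lborel" "sphere (0 :: real ^ 'n) c" lborel] by simp
    then show ?thesis by simp
  qed
  finally show False
    using \<open>emeasure hyperplane_surface_measure ?F \<noteq> 0\<close> by simp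
qed

text \<open>Without a competitor of finite energy the infimum could be \<infinity> and every measure
  extremal. Between two radii of finite field, convexity bounds \<open>q\<close> by
  \<open>q c + q c'\<close>, and normalized Lebesgue measure on that shell has finite
  energy.\<close>

lemma finite_energy_exists:
  fixes q :: "real \<Rightarrow> ennreal" and h :: "real ^ 'n \<Rightarrow> ennreal" and s :: real
  assumes s: "0 < s" "s < CARD('n)" and [measurable]: "h \<in> borel_measurable borel"
    and h: "\<And>y. norm y \<le> 1 \<Longrightarrow> h y = q (norm y)"
    and convex: "ennreal_convex_on {0..1} q"
    and fin: "\<exists>c\<in>{0..1}. \<exists>c'\<in>{0..1}. c \<noteq> c' \<and> q c < \<infinity> \<and> q c' < \<infinity>"
  shows "\<exists>N. prob_space N \<and> sets N = sets borel \<and> emeasure N (cball (0 :: real ^ 'n) 1) = 1 \<and>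
    mutual_energy s N N + 2 * (\<integral>\<^sup>+y. h y \<partial>N) < \<infinity>"
proof -
  obtain c c' where c: "c \<in> {0..1}" "c' \<in> {0..1}" "c < c'" "q c < \<infinity>" "q c' < \<infinity>"
    using fin by (metis linorder_neqE_linordered_idom)
  define A where "A = {y :: real ^ 'n. c < norm y \<and> norm y < c'}"
  have A: "A \<in> sets borel" "A \<subseteq> cball 0 1" "emeasure lborel A > 0"
    using open_shell[of c c', where 'a="real ^ 'n"] c by (simp_all add: A_def)
  define N where "N = uniform_measure lborel A"
  note test = uniform_lborel_test_measure[OF A, folded N_def]
  interpret prob_space N by (rule test(1))
  have sets[measurable_cong]: "sets N = sets borel" by (simp add: N_def)
  have "s < real DIM(real ^ 'n)" using s by simp
  then obtain B where B: "B < \<infinity>" "\<And>x. x \<in> cball 0 1 \<Longrightarrow> potential s N x \<le> B"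
    using potential_uniform_lborel_bounded[OF s(1) _ A] unfolding N_def by blast
  have "mutual_energy s N N \<le> (\<integral>\<^sup>+x. B \<partial>N)"
    unfolding mutual_energy_potential using test(3) A(2) B(2)
    by (intro nn_integral_mono_AE) (auto elim!: eventually_mono)
  then have 1: "mutual_energy s N N < \<infinity>" using B(1) by (simp add: emeasure_space_1)
  have hle: "h y \<le> q c + q c'" if y: "y \<in> A" for y
  proof -
    define \<theta> where "\<theta> = (norm y - c) / (c' - c)"
    have \<theta>: "0 \<le> \<theta>" "\<theta> \<le> 1" using y c by (auto simp: \<theta>_def A_def)
    have "\<theta> * (c' - c) = norm y - c" using c by (simp add: \<theta>_def)
    then have eq: "(1 - \<theta>) *\<^sub>R c + \<theta> *\<^sub>R c' = norm y" by (simp add: algebra_simps)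
    have "q ((1 - \<theta>) *\<^sub>R c + \<theta> *\<^sub>R c') \<le> ennreal (1 - \<theta>) * q c + ennreal \<theta> * q c'"
      using convex c \<theta> unfolding ennreal_convex_on_def by auto
    also have "\<dots> \<le> 1 * q c + 1 * q c'"
      using \<theta> by (intro add_mono mult_right_mono) (auto simp: ennreal_le_1)
    finally show ?thesis using h[of y] A(2) y unfolding eq by auto
  qed
  have "(\<integral>\<^sup>+y. h y \<partial>N) \<le> (\<integral>\<^sup>+y. q c + q c' \<partial>N)"
    using test(3) hle by (intro nn_integral_mono_AE) (auto elim!: eventually_mono)
  also have "\<dots> < \<infinity>" using c by (simp add: emeasure_space_1)
  finally have "mutual_energy s N N + 2 * (\<integral>\<^sup>+y. h y \<partial>N) < \<infinity>"
    using 1 by (simp add: ennreal_mult_less_top)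
  then show ?thesis using test(2) sets prob_space_axioms by blast
qed

lemma polar_decomposition:
  fixes y :: "'a::euclidean_space"
  obtains u where "u \<in> sphere 0 1" "y = norm y *\<^sub>R u"
proof -
  obtain e :: 'a where e: "norm e = 1" using norm_Basis nonempty_Basis by blast
  \<comment> \<open>At 0 any unit vector serves; this is how the centre belongs to a ring with inner
    radius 0.\<close>
  define u where "u = (if y = 0 then e else y /\<^sub>R norm y)"
  have "u \<in> sphere 0 1" "y = norm y *\<^sub>R u" using e by (auto simp: u_def)
  then show thesis by (rule that)
qed

text \<open>For \<open>0 \<le> a\<close> the scalar \<open>r\<close> in \<open>disk_ring\<close> is
  the norm of its point; for negative \<open>r\<close> the norm would be \<open>- r\<close>.\<close>

lemma disk_ring_eq:
  assumes "0 \<le> a"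
  shows "disk_ring a b = {0} \<times> {y :: real ^ 'n. norm y \<in> {a..b}}"
proof (intro equalityI subsetI)
  fix x assume "x \<in> {0::real} \<times> {y :: real ^ 'n. norm y \<in> {a..b}}"
  then obtain y where y: "x = (0, y)" "a \<le> norm y" "norm y \<le> b" by auto
  obtain u where u: "u \<in> sphere 0 1" "y = norm y *\<^sub>R u" by (rule polar_decomposition)
  show "x \<in> disk_ring a b" unfolding disk_ring_def using y u by blast
qed (use assms in \<open>auto simp: disk_ring_def\<close>)

theorem theorem1p1:
  fixes d :: nat
    and s lam :: real
    and Q :: "real \<times> (real ^ 'n) \<Rightarrow> ennreal"
    and q :: "real \<Rightarrow> ennreal"
    and \<mu> :: "(real \<times> (real ^ 'n)) measure"
  assumes dim: "d = CARD('n) + 1" and d: "d \<ge> 3"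
    and lam: "0 < lam" "lam < 1"
    and s: "s = (real d - 3) + 2 * lam"
    and Q: "external_field Q"
    and radial: "\<And>r xbar. 0 \<le> r \<Longrightarrow> r \<le> 1 \<Longrightarrow> xbar \<in> sphere 0 1 \<Longrightarrow> Q (0, r *\<^sub>R xbar) = q r"
    and convex: "ennreal_convex_on {0..1} q"
    and extremal: "extremal_measure s Q \<mu>"
  shows "\<exists>a b :: real. 0 \<le> a \<and> a < b \<and> b \<le> 1 \<and>
      measure_support \<mu> = disk_ring a b \<and>
      (mono_on {0..1} q \<longrightarrow> a = 0 \<and> measure_support \<mu> = {0} \<times> cball 0 b) \<and>
      (antimono_on {0..1} q \<longrightarrow> b = 1)"
proof -
  have N2: "CARD('n) \<ge> 2" using dim d by simp
  \<comment> \<open>Since \<open>real d - 3 = real CARD('n) - 2\<close>, the range of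
    \<open>lam\<close> places \<open>s\<close> strictly between \<open>CARD('n) - 2\<close> and
    \<open>CARD('n)\<close>.\<close>
  have sN: "0 < s" "s < real CARD('n)" "s + 2 > real CARD('n)"
    using dim d lam s by auto
  have Qlsc: "lower_semicontinuous_on unit_disk Q" using Q by (simp add: external_field_def)
  have Qq: "Q (0, y) = q (norm y)" if "norm y \<le> 1" for y :: "real ^ 'n"
  proof -
    obtain u where u: "u \<in> sphere 0 1" "y = norm y *\<^sub>R u" by (rule polar_decomposition)
    show ?thesis using radial[of "norm y" u] that u by simp
  qed
  define h where "h = (\<lambda>y :: real ^ 'n. Q (0, y) * indicator (cball 0 1) y)"
  have h: "h y = q (norm y)" if "norm y \<le> 1" for y using Qq[OF that] that by (simp add: h_def)
  note hm = disk_field_measurable[OF Qlsc, folded h_def]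
  have fin: "\<exists>c\<in>{0..1}. \<exists>c'\<in>{0..1}. c \<noteq> c' \<and> q c < \<infinity> \<and> q c' < \<infinity>"
    by (rule external_field_radial_finite[OF Q Qq])
  have mu: "\<mu> \<in> disk_prob_measures" and min: "weighted_energy s Q \<mu> = minimal_energy s Q"
    using extremal by (auto simp: extremal_measure_def)
  \<comment> \<open>The projection forgets the vanishing first coordinate and moves the problem to
    the unit ball; \<open>nu(3)\<close> recovers \<mu>.\<close>
  define \<nu> where "\<nu> = distr \<mu> borel snd"
  note nu = disk_prob_measures_eq_distr[OF mu, folded \<nu>_def]
  have nu_sets: "sets \<nu> = sets borel" by (simp add: \<nu>_def)
  have W\<nu>: "weighted_energy s Q \<mu> = mutual_energy s \<nu> \<nu> + 2 * (\<integral>\<^sup>+y. h y \<partial>\<nu>)"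
    using weighted_energy_distr_Pair[OF nu(1) nu_sets Qlsc, of s, folded h_def nu(3)] .
  have minimal: "mutual_energy s \<nu> \<nu> + 2 * (\<integral>\<^sup>+y. h y \<partial>\<nu>) \<le> mutual_energy s N N + 2 * (\<integral>\<^sup>+y. h y \<partial>N)"
    if N: "prob_space N" "sets N = sets borel" "emeasure N (cball 0 1) = 1" for N
  proof -
    have "minimal_energy s Q \<le> weighted_energy s Q (distr N borel (Pair 0))"
      unfolding minimal_energy_def by (rule INF_lower) (rule distr_Pair_in_disk_prob_measures[OF N])
    then show ?thesis
      using weighted_energy_distr_Pair[OF N(1,2) Qlsc, of s, folded h_def] W\<nu> min by simp
  qed
  obtain N where N: "prob_space N" "sets N = sets borel" "emeasure N (cball (0 :: real ^ 'n) 1) = 1"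
    "mutual_energy s N N + 2 * (\<integral>\<^sup>+y. h y \<partial>N) < \<infinity>"
    using finite_energy_exists[OF sN(1,2) hm(2) h convex fin] by blast
  \<comment> \<open>Finiteness of the minimal value gives finiteness of the energy and of the field
    integral separately, as the locale demands.\<close>
  have W_fin: "mutual_energy s \<nu> \<nu> + 2 * (\<integral>\<^sup>+y. h y \<partial>\<nu>) < \<infinity>"
    using minimal[OF N(1-3)] N(4) by (rule le_less_trans)
  interpret radial_minimizer s h \<nu> q
  proof (intro radial_minimizer.intro weighted_minimizer.intro radial_minimizer_axioms.intro)
    show "mutual_energy s \<nu> \<nu> < \<infinity>" "(\<integral>\<^sup>+y. h y \<partial>\<nu>) < \<infinity>"
      using W_fin by (auto simp: ennreal_mult_less_top)
    show "h y = 0" if "norm y > 1" for y using that by (simp add: h_def)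
    show "s < real DIM(real ^ 'n)" using sN by simp
  qed (fact sN N2 hm nu(1,2) nu_sets minimal h convex fin)+
  define a where "a = Inf radii"
  define b where "b = Sup radii"
  have ab: "0 \<le> a" "a < b" "b \<le> 1"
    using radii_nontrivial radii_eq_interval(2,3) radii_bounds by (auto simp: a_def b_def)
  have "measure_support \<mu> = {0} \<times> measure_support \<nu>"
    using measure_support_distr_Pair[OF nu_sets] nu(3) by simp
  also have "\<dots> = {0} \<times> {y. norm y \<in> {a..b}}"
    unfolding support_eq_radii a_def b_def radii_eq_interval(1)[symmetric] ..
  finally have supp: "measure_support \<mu> = {0} \<times> {y. norm y \<in> {a..b}}" .
  have ring: "measure_support \<mu> = disk_ring a b"
    unfolding supp disk_ring_eq[OF ab(1)] ..
  have "a = 0 \<and> measure_support \<mu> = {0} \<times> cball 0 b" if "mono_on {0..1} q"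
  proof -
    have "a = 0" using radii_increasing[OF that] by (simp add: a_def)
    then show ?thesis unfolding supp by auto
  qed
  moreover have "b = 1" if "antimono_on {0..1} q"
    using radii_decreasing[OF that] by (simp add: b_def)
  ultimately show ?thesis using ab ring by blast
qed

end
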